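(* Let $\gamma>1$. There are constants $\Gamma(\gamma)>0$ and $C(\gamma)>0$, depending only on $\gamma$, having respectively the properties (L) and (WS) stated in the context, such that the following holds. Let $0<T<\infty$ and let $(\rho,u)$ be an entropy-admissible weak solution on $S_T$ of the compressible Euler equations with pressure $p(\rho)=\gamma^{-1}\rho^\gamma$ and initial data $(\rho_0,u_0)$. Assume $\|\rho^{-1}\|_{L^\infty(S_T)}<\infty$, let $m>0$ satisfy $$\|\rho^{-1}(\rho-1)\|_{L^\infty(S_T)}+\|u\|_{L^\infty(S_T)}\le m,$$ and let $c_0=1+C(\gamma)m$. Assume that $$\operatorname{ess\,supp}(\rho_0-1,u_0)\subset\{x\in\mathbb{R}^3:|x|\le1\}.$$ Fix a unit vector $\omega\in\mathbb{R}^3$ and $0\le k_0<1$, let $w_0$ and $T_0(k_0)$ be as defined in the context (with the constant $\Gamma(\gamma)$), and assume that $w_0$ is positive and decreasing for $k_0\le k<1$. Assume that $T>T_0(k_0)$. Set $$\mathcal T=\bigl\{0<t<T:\operatorname{ess\,supp}(\rho-1,u)\cap\{(s,x)\in S_t:|x|>1+s\}\ne\emptyset\bigr\}.$$ Then $\mathcal T\neq\emptyset$, and, setting $\tau=\inf\mathcal T$, we have $0\le\tau\le T_0(k_0)$. Moreover, $$\operatorname{ess\,supp}(\rho-1,u)\cap S_\tau\subset\{(t,x)\in S_\tau:|x|\le1+t\},$$ and for every $\tau<\tau'<T$, $$\operatorname{ess\,supp}(\rho-1,u)\cap\bigl((\tau,\tau')\times\mathbb{R}^3\bigr)\subset\bigl\{(t,x)\in(\tau,\tau')\times\mathbb{R}^3:|x|\le1+\tau+c_0(t-\tau)\bigr\},$$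 while $$\operatorname{ess\,supp}(\rho-1,u)\cap\bigl\{(t,x)\in(\tau,\tau')\times\mathbb{R}^3:1+t<|x|\le1+\tau+c_0(t-\tau)\bigr\}\ne\emptyset.$$ For every $\tau<\tau'<T$ there exist a unit vector $\nu\in\mathbb{R}^3$ and a speed $c_1$ with $1<c_1\le c_0$ such that, upon setting $$\mathcal H^{\nu,c}_{\tau,\tau'}=\{(t,x)\in(\tau,\tau')\times\mathbb{R}^3:\nu\cdot x\ge1+\tau+c(t-\tau)\},\qquad c\ge1,$$ the nonincreasing profile $$g(c)=\|\rho-1\|_{L^\infty(\mathcal H^{\nu,c}_{\tau,\tau'})}+\|u\|_{L^\infty(\mathcal H^{\nu,c}_{\tau,\tau'})},\qquad 1\le c<\infty,$$ has a jump discontinuity at $c=c_1$, with one-sided limits satisfying $$g(c_1^-)>g(c_1^+)=0.$$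
   Context: For $0<t<\infty$ set $S_t=[0,t)\times\mathbb{R}^3$ (and $S_0=\emptyset$). The compressible Euler equations are $\partial_t\rho+\nabla\cdot(\rho u)=0$, $\partial_t(\rho u)+\nabla\cdot(\rho u\otimes u)+\nabla p(\rho)=0$, with $p(\rho)=\gamma^{-1}\rho^\gamma$, $\gamma>1$. The background density is $1$, with sound speed $p'(1)^{1/2}=1$. Weak solution: $(\rho,u)$ is a weak solution on $S_T$ with initial data $(\rho_0,u_0)$ if $(\rho,u)\in L^\infty(S_T;\mathbb{R}_{>0}\times\mathbb{R}^3)$, $(\rho_0,u_0)\in L^\infty(\mathbb{R}^3;\mathbb{R}_{>0}\times\mathbb{R}^3)$ (positivity of $\rho,\rho_0$ is understood almost everywhere), and $$\iint_{S_T}(\rho\,\partial_t\varphi+\rho u\cdot\nabla_x\varphi)\,dx\,dt+\int_{\mathbb{R}^3}\rho_0\,\varphi(0,\cdot)\,dx=0,$$ $$\iint_{S_T}\bigl(\rho u\cdot\partial_t\psi+\rho\langle u\otimes u,\nabla_x\psi\rangle+\tfrac1\gamma\rho^\gamma\,\nabla_x\cdot\psi\bigr)dx\,dt+\int_{\mathbb{R}^3}\rho_0u_0\cdot\psi(0,\cdot)\,dx=0$$ for all $(\varphi,\psi)\in C^{0,1}_0(S_T;\mathbb{R}\times\mathbb{R}^3)$, i.e. all Lipschitz pairs with compact support in $S_T=[0,T)\times\mathbb{R}^3$ (so they need not vanish at $t=0$). Entropy-admissible: a weak solution is entropy-admissible if in addition $$\iint_{S_T}\Bigl[\bigl(\tfrac12\rho|u|^2+\tfrac1{\gamma(\gamma-1)}\rho^\gamma\bigr)\partial_t\varphi+\bigl(\tfrac12\rho|u|^2+\tfrac1{\gamma-1}\rho^\gamma\bigr)u\cdot\nabla_x\varphi\Bigr]dx\,dt+\int_{\mathbb{R}^3}\bigl(\tfrac12\rho_0|u_0|^2+\tfrac1{\gamma(\gamma-1)}\rho_0^\gamma\bigr)\varphi(0,\cdot)\,dx\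 \ge\ 0$$ for all nonnegative $\varphi\in C^{0,1}_0(S_T;\mathbb{R}_{\ge0})$ (compactly supported Lipschitz). $\operatorname{ess\,supp}$ denotes the essential support: the complement (in the domain) of the largest relatively open set on which the function vanishes a.e. Domains: for a fixed unit vector $\omega\in\mathbb{R}^3$, $0\le a\le b<\infty$ and $t\ge0$, $\Omega^{a,\infty}(t)=\{x\in\mathbb{R}^3:a+t\le\omega\cdot x\}$, $\Omega^{a,b}(t)=\Omega^{a,\infty}(t)\cap\{x\in\mathbb{R}^3:|x|\le b+t\}$, and for $b\le\infty$, $\Omega_T^{a,b}=\{(t,x)\in S_T:x\in\Omega^{a,b}(t)\}$. The function $w_0$ and the time $T_0(k_0)$: given the unit vector $\omega$, $0\le k_0<1$ and initial data $(\rho_0,u_0)$, $$w_0(k)=\tfrac12\int_{\Omega^{k,1}(0)}\bigl(\omega\cdot\rho_0u_0(x)+\rho_0(x)-1\bigr)(\omega\cdot x-k)^2\,dx,\qquad k_0\le k\le1,$$ which is continuous on $[k_0,1]$, and, given a constant $\Gamma(\gamma)>0$ and assuming $w_0>0$ on $[k_0,1)$, $$T_0(k_0)=\inf_{k_0<k<1}T(k,k_0)-\frac{1+k_0}{2},$$ $$T(k,k_0)=\begin{cases}\displaystyle\exp\left[\Gamma(\gamma)\frac{(1-k_0)^6}{(k-k_0)\,w_0(k)}\right],&\gamma\ge2,\\[4mm]\displaystyle\exp\left[\Gamma(\gamma)\frac{(1-k_0)^6}{(k-k_0)\,w_0(k)}\left(1+\frac{3w_0(k)}{(1-k)^4}\right)^{2-\gamma}\right],&1<\gamma<2.\end{cases}$$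 Property (L) of $\Gamma(\gamma)$: for every $0<T<\infty$, every weak solution $(\rho,u)$ on $S_T$ with initial data $(\rho_0,u_0)$, every unit vector $\omega$ and every $0\le k_0<1$ such that $\operatorname{ess\,supp}(\rho-1,u)\cap\Omega_T^{k_0,\infty}\subset\Omega_T^{k_0,1}$ and $w_0$ is positive and decreasing for $k_0\le k<1$, one has $T\le T_0(k_0)$. Property (WS) of $C(\gamma)$: for every $0<T<\infty$, every entropy-admissible weak solution $(\rho,u)$ on $S_T$ with initial data $(\rho_0,u_0)$ and $\|\rho^{-1}\|_{L^\infty(S_T)}<\infty$, every $m>0$ with $\|\rho^{-1}(\rho-1)\|_{L^\infty(S_T)}+\|u\|_{L^\infty(S_T)}\le m$, and every nonempty closed bounded set $V\subset\mathbb{R}^3$ with Lipschitz boundary such that $F(0;V):=\|\rho_0^{-1}(\rho_0-1)\|_{L^\infty(V)}+\|u_0\|_{L^\infty(V)}=0$, one has $\sup\{0\le\alpha\le1:F(\alpha;V)=0\}\ge(1+C(\gamma)m)^{-1}$, where for $0<\alpha\le1$, $F(\alpha;V)=\|\rho^{-1}(\rho-1)\|_{L^\infty(V_\alpha)}+\|u\|_{L^\infty(V_\alpha)}$, $V_\alpha=\operatorname{supp}d_\alpha\cap S_T$ and $d_\alpha(t,x)=(\operatorname{dist}(x,\mathbb{R}^3\setminus V)-t/\alpha)_+$. *)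

theory Defs
  imports "HOL-Analysis.Analysis" "HOL-Probability.Essential_Supremum"
begin

section \<open>Lebesgue spaces and essential supports\<close>

text \<open>
  Values in \<^typ>\<open>ennreal\<close>: the norm is \<open>0\<close> on null sets, in particular on the empty set,
  and \<open>\<infinity>\<close> for essentially unbounded functions.
\<close>

definition Linf_norm :: "'a::euclidean_space set \<Rightarrow> ('a \<Rightarrow> 'b::real_normed_vector) \<Rightarrow> ennreal" where
  "Linf_norm A f = esssup (lebesgue_on A) (\<lambda>x. ennreal (norm (f x)))"

definition Linf :: "'a::euclidean_space set \<Rightarrow> ('a \<Rightarrow> 'b::euclidean_space) set" where
  "Linf A = {f. f \<in> borel_measurable (lebesgue_on A) \<and> Linf_norm A f < \<infinity>}"

definition ess_null_set :: "'a::euclidean_space set \<Rightarrow> ('a \<Rightarrow> 'b::zero) \<Rightarrow> 'a set" where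
  "ess_null_set D f =
     \<Union>{U. openin (top_of_set D) U \<and> (AE x in lebesgue_on D. x \<in> U \<longrightarrow> f x = 0)}"

definition ess_supp :: "'a::euclidean_space set \<Rightarrow> ('a \<Rightarrow> 'b::zero) \<Rightarrow> 'a set" where
  "ess_supp D f = D - ess_null_set D f"

text \<open>By the Lindelof property the union is itself such a set, hence the largest one.\<close>

lemma openin_ess_null_set: "openin (top_of_set D) (ess_null_set D f)"
  unfolding ess_null_set_def by (rule openin_Union) auto

lemma AE_ess_null_set: "AE x in lebesgue_on D. x \<in> ess_null_set D f \<longrightarrow> f x = 0"
proof -
  let ?F = "{U. openin (top_of_set D) U \<and> (AE x in lebesgue_on D. x \<in> U \<longrightarrow> f x = 0)}"
  obtain F' where F': "F' \<subseteq> ?F" "countable F'" "\<Union>F' = \<Union>?F"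
    by (rule Lindelof_openin[of ?F D]) auto
  have "AE x in lebesgue_on D. \<forall>U\<in>F'. x \<in> U \<longrightarrow> f x = 0"
    using F'(1,2) by (subst AE_ball_countable) auto
  then show ?thesis
    unfolding ess_null_set_def F'(3)[symmetric] by eventually_elim blast
qed

section \<open>Weak solutions of the compressible Euler equations\<close>

type_synonym space = "real^3"
type_synonym spacetime = "real \<times> (real^3)"

definition slab :: "real \<Rightarrow> spacetime set" where
  "slab t = {0..<t} \<times> UNIV"

text \<open>
  A Lipschitz function has partial derivatives almost everywhere, and these represent its weak
  derivatives. The values of \<^const>\<open>deriv\<close> on the exceptional null set do not affect the
  integrals below, nor do the values of a test function outside the slab.
\<close>

definition dt :: "(spacetime \<Rightarrow> real) \<Rightarrow> spacetime \<Rightarrow> real" where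
  "dt \<phi> z = deriv (\<lambda>s. \<phi> (s, snd z)) (fst z)"

definition dx :: "3 \<Rightarrow> (spacetime \<Rightarrow> real) \<Rightarrow> spacetime \<Rightarrow> real" where
  "dx j \<phi> z = deriv (\<lambda>h. \<phi> (fst z, snd z + h *\<^sub>R axis j 1)) 0"

definition grad :: "(spacetime \<Rightarrow> real) \<Rightarrow> spacetime \<Rightarrow> space" where
  "grad \<phi> z = (\<chi> j. dx j \<phi> z)"

definition dt_vec :: "(spacetime \<Rightarrow> space) \<Rightarrow> spacetime \<Rightarrow> space" where
  "dt_vec \<psi> z = (\<chi> i. dt (\<lambda>y. \<psi> y $ i) z)"

definition jacobian_x :: "(spacetime \<Rightarrow> space) \<Rightarrow> spacetime \<Rightarrow> real^3^3" where
  "jacobian_x \<psi> z = (\<chi> i j. dx j (\<lambda>y. \<psi> y $ i) z)"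

definition div_x :: "(spacetime \<Rightarrow> space) \<Rightarrow> spacetime \<Rightarrow> real" where
  "div_x \<psi> z = trace (jacobian_x \<psi> z)"

definition tensor :: "space \<Rightarrow> space \<Rightarrow> real^3^3" where
  "tensor a b = (\<chi> i j. a $ i * b $ j)"

definition test_functions :: "real \<Rightarrow> (spacetime \<Rightarrow> 'b::euclidean_space) set" where
  "test_functions T = {\<phi>. (\<exists>L. L-lipschitz_on (slab T) \<phi>) \<and>
     compact (closure {z \<in> slab T. \<phi> z \<noteq> 0}) \<and> closure {z \<in> slab T. \<phi> z \<noteq> 0} \<subseteq> slab T}"

text \<open>
  In the momentum equation, \<open>\<bullet>\<close> on \<^typ>\<open>real^3^3\<close> is the Frobenius product
  \<open>\<langle>u \<otimes> u, \<nabla>\<psi>\<rangle> = (\<Sum>i j. u\<^sub>i u\<^sub>j \<partial>\<^sub>j \<psi>\<^sub>i)\<close>.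
\<close>

definition weak_solution ::
  "real \<Rightarrow> real \<Rightarrow> (spacetime \<Rightarrow> real) \<Rightarrow> (spacetime \<Rightarrow> space) \<Rightarrow>
   (space \<Rightarrow> real) \<Rightarrow> (space \<Rightarrow> space) \<Rightarrow> bool" where
  "weak_solution \<gamma> T \<rho> u \<rho>0 u0 \<longleftrightarrow>
     \<rho> \<in> Linf (slab T) \<and> u \<in> Linf (slab T) \<and> (AE z in lebesgue_on (slab T). 0 < \<rho> z) \<and>
     \<rho>0 \<in> Linf UNIV \<and> u0 \<in> Linf UNIV \<and> (AE x in lebesgue. 0 < \<rho>0 x) \<and>
     (\<forall>\<phi>\<in>test_functions T.
        (LINT z|lebesgue_on (slab T). \<rho> z * dt \<phi> z + (\<rho> z *\<^sub>R u z) \<bullet> grad \<phi> z)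
        + (LINT x|lebesgue. \<rho>0 x * \<phi> (0, x)) = 0) \<and>
     (\<forall>\<psi>\<in>test_functions T.
        (LINT z|lebesgue_on (slab T).
           (\<rho> z *\<^sub>R u z) \<bullet> dt_vec \<psi> z
           + \<rho> z * (tensor (u z) (u z) \<bullet> jacobian_x \<psi> z)
           + 1 / \<gamma> * \<rho> z powr \<gamma> * div_x \<psi> z)
        + (LINT x|lebesgue. (\<rho>0 x *\<^sub>R u0 x) \<bullet> \<psi> (0, x)) = 0)"

definition energy :: "real \<Rightarrow> real \<Rightarrow> space \<Rightarrow> real" where
  "energy \<gamma> r v = 1/2 * r * (norm v)\<^sup>2 + 1 / (\<gamma> * (\<gamma> - 1)) * r powr \<gamma>"

definition energy_flux :: "real \<Rightarrow> real \<Rightarrow> space \<Rightarrow> space" where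
  "energy_flux \<gamma> r v = (1/2 * r * (norm v)\<^sup>2 + 1 / (\<gamma> - 1) * r powr \<gamma>) *\<^sub>R v"

definition entropy_admissible ::
  "real \<Rightarrow> real \<Rightarrow> (spacetime \<Rightarrow> real) \<Rightarrow> (spacetime \<Rightarrow> space) \<Rightarrow>
   (space \<Rightarrow> real) \<Rightarrow> (space \<Rightarrow> space) \<Rightarrow> bool" where
  "entropy_admissible \<gamma> T \<rho> u \<rho>0 u0 \<longleftrightarrow> weak_solution \<gamma> T \<rho> u \<rho>0 u0 \<and>
     (\<forall>\<phi>\<in>test_functions T. (\<forall>z\<in>slab T. 0 \<le> \<phi> z) \<longrightarrow>
        (LINT z|lebesgue_on (slab T).
           energy \<gamma> (\<rho> z) (u z) * dt \<phi> z + energy_flux \<gamma> (\<rho> z) (u z) \<bullet> grad \<phi> z)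
        + (LINT x|lebesgue. energy \<gamma> (\<rho>0 x) (u0 x) * \<phi> (0, x)) \<ge> 0)"

definition deviation_norm ::
  "'a::euclidean_space set \<Rightarrow> ('a \<Rightarrow> real) \<Rightarrow> ('a \<Rightarrow> space) \<Rightarrow> ennreal" where
  "deviation_norm A r v = Linf_norm A (\<lambda>z. inverse (r z) * (r z - 1)) + Linf_norm A v"

definition perturbation_supp ::
  "'a::euclidean_space set \<Rightarrow> ('a \<Rightarrow> real) \<Rightarrow> ('a \<Rightarrow> space) \<Rightarrow> 'a set" where
  "perturbation_supp D r v = ess_supp D (\<lambda>z. (r z - 1, v z))"

section \<open>The lifespan bound\<close>

definition Omega_inf :: "space \<Rightarrow> real \<Rightarrow> real \<Rightarrow> space set" where
  "Omega_inf \<omega> a t = {x. a + t \<le> \<omega> \<bullet> x}"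

definition Omega :: "space \<Rightarrow> real \<Rightarrow> real \<Rightarrow> real \<Rightarrow> space set" where
  "Omega \<omega> a b t = Omega_inf \<omega> a t \<inter> {x. norm x \<le> b + t}"

definition Omega_slab_inf :: "space \<Rightarrow> real \<Rightarrow> real \<Rightarrow> spacetime set" where
  "Omega_slab_inf \<omega> a T = {(t, x). (t, x) \<in> slab T \<and> x \<in> Omega_inf \<omega> a t}"

definition Omega_slab :: "space \<Rightarrow> real \<Rightarrow> real \<Rightarrow> real \<Rightarrow> spacetime set" where
  "Omega_slab \<omega> a b T = {(t, x). (t, x) \<in> slab T \<and> x \<in> Omega \<omega> a b t}"

definition w0 :: "space \<Rightarrow> (space \<Rightarrow> real) \<Rightarrow> (space \<Rightarrow> space) \<Rightarrow> real \<Rightarrow> real" where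
  "w0 \<omega> \<rho>0 u0 k = 1/2 * (LINT x|lebesgue_on (Omega \<omega> k 1 0).
     (\<omega> \<bullet> (\<rho>0 x *\<^sub>R u0 x) + \<rho>0 x - 1) * (\<omega> \<bullet> x - k)\<^sup>2)"

definition time_bound :: "real \<Rightarrow> real \<Rightarrow> (real \<Rightarrow> real) \<Rightarrow> real \<Rightarrow> real \<Rightarrow> real" where
  "time_bound \<gamma> \<Gamma> w k k0 =
     (if \<gamma> \<ge> 2 then exp (\<Gamma> * ((1 - k0) ^ 6 / ((k - k0) * w k)))
      else exp (\<Gamma> * ((1 - k0) ^ 6 / ((k - k0) * w k)) *
                  (1 + 3 * w k / (1 - k) ^ 4) powr (2 - \<gamma>)))"

definition T0 :: "real \<Rightarrow> real \<Rightarrow> (real \<Rightarrow> real) \<Rightarrow> real \<Rightarrow> real" where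
  "T0 \<gamma> \<Gamma> w k0 = (INF k\<in>{k0<..<1}. time_bound \<gamma> \<Gamma> w k k0) - (1 + k0) / 2"

definition positive_decreasing :: "(real \<Rightarrow> real) \<Rightarrow> real \<Rightarrow> bool" where
  "positive_decreasing w k0 \<longleftrightarrow> (\<forall>k\<in>{k0..<1}. 0 < w k) \<and> antimono_on {k0..<1} w"

definition lifespan_property :: "real \<Rightarrow> real \<Rightarrow> bool" where
  "lifespan_property \<gamma> \<Gamma> \<longleftrightarrow>
     (\<forall>T \<rho> u \<rho>0 u0 \<omega> k0.
        0 < T \<and> weak_solution \<gamma> T \<rho> u \<rho>0 u0 \<and> norm \<omega> = 1 \<and> 0 \<le> k0 \<and> k0 < 1 \<and>
        perturbation_supp (slab T) \<rho> u \<inter> Omega_slab_inf \<omega> k0 T \<subseteq> Omega_slab \<omega> k0 1 T \<and>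
        positive_decreasing (w0 \<omega> \<rho>0 u0) k0
        \<longrightarrow> T \<le> T0 \<gamma> \<Gamma> (w0 \<omega> \<rho>0 u0) k0)"

section \<open>Finite propagation of the quiescent region\<close>

text \<open>
  Near each boundary point, the set is the region above the graph of a Lipschitz function over the
  plane orthogonal to a unit vector \<open>e\<close>; the orthogonal projection of \<open>x\<close> to that plane is
  \<open>x - (x \<bullet> e) e\<close>.
\<close>

definition lipschitz_boundary :: "space set \<Rightarrow> bool" where
  "lipschitz_boundary V \<longleftrightarrow>
     (\<forall>p\<in>frontier V. \<exists>r>0. \<exists>e L. \<exists>h :: space \<Rightarrow> real. norm e = 1 \<and> L-lipschitz_on UNIV h \<and>
        V \<inter> ball p r = {x \<in> ball p r. h (x - (x \<bullet> e) *\<^sub>R e) \<le> x \<bullet> e})"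

definition cone_function :: "space set \<Rightarrow> real \<Rightarrow> spacetime \<Rightarrow> real" where
  "cone_function V \<alpha> z = max 0 (infdist (snd z) (- V) - fst z / \<alpha>)"

definition cone_region :: "real \<Rightarrow> space set \<Rightarrow> real \<Rightarrow> spacetime set" where
  "cone_region T V \<alpha> = closure {z \<in> {0..} \<times> UNIV. cone_function V \<alpha> z \<noteq> 0} \<inter> slab T"

definition cone_deviation ::
  "real \<Rightarrow> (spacetime \<Rightarrow> real) \<Rightarrow> (spacetime \<Rightarrow> space) \<Rightarrow>
   (space \<Rightarrow> real) \<Rightarrow> (space \<Rightarrow> space) \<Rightarrow> space set \<Rightarrow> real \<Rightarrow> ennreal" where
  "cone_deviation T \<rho> u \<rho>0 u0 V \<alpha> =
     (if \<alpha> = 0 then deviation_norm V \<rho>0 u0 else deviation_norm (cone_region T V \<alpha>) \<rho> u)"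

definition propagation_property :: "real \<Rightarrow> real \<Rightarrow> bool" where
  "propagation_property \<gamma> C \<longleftrightarrow>
     (\<forall>T \<rho> u \<rho>0 u0 m V.
        0 < T \<and> entropy_admissible \<gamma> T \<rho> u \<rho>0 u0 \<and>
        Linf_norm (slab T) (\<lambda>z. inverse (\<rho> z)) < \<infinity> \<and>
        0 < m \<and> deviation_norm (slab T) \<rho> u \<le> ennreal m \<and>
        V \<noteq> {} \<and> closed V \<and> bounded V \<and> lipschitz_boundary V \<and>
        cone_deviation T \<rho> u \<rho>0 u0 V 0 = 0
        \<longrightarrow> Sup {\<alpha>. 0 \<le> \<alpha> \<and> \<alpha> \<le> 1 \<and> cone_deviation T \<rho> u \<rho>0 u0 V \<alpha> = 0}
              \<ge> inverse (1 + C * m))"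

section \<open>Escape from the sonic cone\<close>

definition escape_times :: "real \<Rightarrow> (spacetime \<Rightarrow> real) \<Rightarrow> (spacetime \<Rightarrow> space) \<Rightarrow> real set" where
  "escape_times T \<rho> u = {t. 0 < t \<and> t < T \<and>
     perturbation_supp (slab T) \<rho> u \<inter> {(s, x). (s, x) \<in> slab t \<and> norm x > 1 + s} \<noteq> {}}"

definition half_space_region :: "space \<Rightarrow> real \<Rightarrow> real \<Rightarrow> real \<Rightarrow> spacetime set" where
  "half_space_region \<nu> c \<tau> \<tau>' =
     {(t, x). \<tau> < t \<and> t < \<tau>' \<and> \<nu> \<bullet> x \<ge> 1 + \<tau> + c * (t - \<tau>)}"

definition front_profile ::
  "(spacetime \<Rightarrow> real) \<Rightarrow> (spacetime \<Rightarrow> space) \<Rightarrow> space \<Rightarrow> real \<Rightarrow> real \<Rightarrow> real \<Rightarrow> ennreal" where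
  "front_profile \<rho> u \<nu> \<tau> \<tau>' c =
     Linf_norm (half_space_region \<nu> c \<tau> \<tau>') (\<lambda>z. \<rho> z - 1)
     + Linf_norm (half_space_region \<nu> c \<tau> \<tau>') u"

end

theory Submission
  imports Defs
begin

text \<open>
  The theorem rests on two facts about the constant state with density \<open>1\<close> and velocity \<open>0\<close>.

  \<^item> Perturbations of size \<open>m\<close> travel with speed at most \<open>1 + C m\<close>. Subtracting multiples of the mass
    equation and of the constant state from the entropy inequality gives a balance law for the
    relative energy, which is nonnegative and vanishes only at the constant state. The flux of the
    relative energy is bounded by \<open>1 + C m\<close> times the relative energy (\<open>rel_flux_le_rel_energy\<close>): near
    density one the ratio is the sonic speed one up to an error linear in the amplitude, and at large density
    it is controlled by the velocity, which is itself at most \<open>m\<close>. Testing with a function whose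
    support is a backward cone of that slope makes the integrand nonpositive, so the relative energy
    vanishes in the cone (\<open>cone_quiescent\<close>). Cones over balls are enough: they exhaust every set
    \<open>V\<close> in \<open>propagation_property\<close>, the exterior of a ball, and a half-space.

  \<^item> A solution that stays inside the sonic cone beyond a plane cannot live long. Testing the sum of
    the mass equation and the \<open>\<omega>\<close>-momentum equation with \<open>\<chi>(t) s\<^sup>2 / 2\<close>, where
    \<open>s = (\<omega> \<bullet> x - k - t)\<^sub>+\<close>, the terms linear in the perturbation cancel in the part where the weight is
    differentiated, and \<open>\<chi> s (\<rho> (\<omega> \<bullet> u)\<^sup>2 + P(\<rho>))\<close> remains, with \<open>P\<close> the pressure in excess of
    its linearisation. This absorbs the term with \<open>\<chi>'\<close> by Young's inequality
    (\<open>momentum_young\<close>), leaving \<open>w\<^sub>0(k)\<close> bounded by a multiple of the integral of \<open>s\<^sup>3 (\<theta>')\<^sup>2\<close>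
    over spherical caps of height at most \<open>1 - k\<close>, where \<open>\<theta>\<close> is a root of \<open>\<chi>\<close>. The
    caps have volume at most of order \<open>(1 - k)\<^sup>2 (1 + t)\<close>, so a
    logarithmic \<open>\<theta>\<close> is the right choice and yields, once \<open>T > (1 - k\<^sub>0) / 2\<close>, the bound \<open>log (1 + T) \<le> \<Gamma> (1 - k)\<^sup>5 / w\<^sub>0(k)\<close>
    (\<open>w0_le_log\<close>). This implies \<open>T \<le> T\<^sub>0(k\<^sub>0)\<close> (\<open>lifespan_bound\<close>).

  By the second fact the solution must leave the sonic cone no later than \<open>T\<^sub>0(k\<^sub>0)\<close>, and by the first one, applied
  from the escape time \<open>\<tau>\<close> on, it stays inside a cone of slope \<open>c\<^sub>0\<close>. For the jump, take \<open>\<nu>\<close> in the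
  direction of a point of the support outside the sonic cone, and \<open>c\<^sub>1\<close> as the infimum of the speeds
  at which the profile vanishes. If the profile tended to zero from the left at \<open>c\<^sub>1 > 1\<close>, the perturbation
  beyond some front of speed \<open>c < c\<^sub>1\<close> would be so small that it could travel at speed \<open>c\<close> at most;
  nothing could then have entered from behind, and the profile would vanish to the left of \<open>c\<^sub>1\<close>.
\<close>

section \<open>The relative energy and its flux\<close>

text \<open>
  The energy and its flux, corrected by the affine function of the density that makes the energy and its first
  derivative vanish at the constant state; likewise for the pressure. The function \<open>enthalpy\<close> is
  the derivative of the potential part of the relative energy.
\<close>

definition rel_energy :: "real \<Rightarrow> real \<Rightarrow> space \<Rightarrow> real" where
  "rel_energy \<gamma> r v = energy \<gamma> r v - r / (\<gamma> - 1) + 1 / \<gamma>"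

definition rel_flux :: "real \<Rightarrow> real \<Rightarrow> space \<Rightarrow> space" where
  "rel_flux \<gamma> r v = energy_flux \<gamma> r v - (r / (\<gamma> - 1)) *\<^sub>R v"

definition rel_pressure :: "real \<Rightarrow> real \<Rightarrow> real" where
  "rel_pressure \<gamma> r = (r powr \<gamma> - 1) / \<gamma> - (r - 1)"

definition enthalpy :: "real \<Rightarrow> real \<Rightarrow> real" where
  "enthalpy \<gamma> r = (r powr (\<gamma> - 1) - 1) / (\<gamma> - 1)"

lemma rel_energy_eq:
  assumes "\<gamma> > 1"
  shows "rel_energy \<gamma> r v = 1/2 * r * (norm v)\<^sup>2 + rel_pressure \<gamma> r / (\<gamma> - 1)"
proof -
  have "1 / \<gamma> = 1 / (\<gamma> - 1) - 1 / (\<gamma> * (\<gamma> - 1))"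
    using assms by (simp add: divide_simps)
  moreover have "rel_pressure \<gamma> r / (\<gamma> - 1)
      = r powr \<gamma> / (\<gamma> * (\<gamma> - 1)) - r / (\<gamma> - 1) + (1 / (\<gamma> - 1) - 1 / (\<gamma> * (\<gamma> - 1)))"
    by (simp add: rel_pressure_def diff_divide_distrib)
  ultimately show ?thesis
    by (simp add: rel_energy_def energy_def)
qed

lemma rel_flux_eq:
  assumes "\<gamma> > 1" "r > 0"
  shows "rel_flux \<gamma> r v = (1/2 * r * (norm v)\<^sup>2 + r * enthalpy \<gamma> r) *\<^sub>R v"
proof -
  have "r * r powr (\<gamma> - 1) = r powr \<gamma>"
    using assms powr_add[of r 1 "\<gamma> - 1"] by simp
  then have "r * enthalpy \<gamma> r = 1 / (\<gamma> - 1) * r powr \<gamma> - r / (\<gamma> - 1)"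
    unfolding enthalpy_def by (simp add: diff_divide_distrib right_diff_distrib)
  then show ?thesis
    unfolding rel_flux_def energy_flux_def by (simp add: scaleR_left_diff_distrib[symmetric])
qed

lemma enthalpy_1 [simp]: "enthalpy \<gamma> 1 = 0" and rel_pressure_1 [simp]: "rel_pressure \<gamma> 1 = 0"
  by (simp_all add: enthalpy_def rel_pressure_def)

lemma DERIV_enthalpy:
  assumes "\<gamma> > 1" "x > 0"
  shows "(enthalpy \<gamma> has_real_derivative x powr (\<gamma> - 2)) (at x)"
proof -
  have "(enthalpy \<gamma> has_real_derivative (\<gamma> - 1) * x powr (\<gamma> - 1 - 1) / (\<gamma> - 1)) (at x)"
    unfolding enthalpy_def
    by (rule derivative_eq_intros has_real_derivative_powr refl | use assms in simp)+
  moreover have "(\<gamma> - 1) * x powr (\<gamma> - 1 - 1) / (\<gamma> - 1) = x powr (\<gamma> - 2)"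
    using assms by simp
  ultimately show ?thesis by simp
qed

lemma DERIV_rel_pressure:
  assumes "\<gamma> > 1" "x > 0"
  shows "(rel_pressure \<gamma> has_real_derivative (\<gamma> - 1) * enthalpy \<gamma> x) (at x)"
proof -
  have "(rel_pressure \<gamma> has_real_derivative \<gamma> * x powr (\<gamma> - 1) / \<gamma> - 1) (at x)"
    unfolding rel_pressure_def
    by (rule derivative_eq_intros has_real_derivative_powr refl | use assms in simp)+
  moreover have "\<gamma> * x powr (\<gamma> - 1) / \<gamma> - 1 = (\<gamma> - 1) * enthalpy \<gamma> x"
    using assms by (simp add: enthalpy_def)
  ultimately show ?thesis by simp
qed

lemma mult_powr_enthalpy:
  assumes "\<gamma> > 1" "x > 0"
  shows "x * x powr (\<gamma> - 2) = 1 + (\<gamma> - 1) * enthalpy \<gamma> x"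
proof -
  have "x * x powr (\<gamma> - 2) = x powr (\<gamma> - 1)"
    using assms powr_add[of x 1 "\<gamma> - 2"] by simp
  then show ?thesis using assms by (simp add: enthalpy_def)
qed

lemma enthalpy_mono:
  assumes "\<gamma> > 1" "0 < x" "x \<le> y"
  shows "enthalpy \<gamma> x \<le> enthalpy \<gamma> y"
  unfolding enthalpy_def using assms by (intro divide_right_mono diff_right_mono powr_mono2) auto

lemma enthalpy_strict_mono:
  assumes "\<gamma> > 1" "0 < x" "x < y"
  shows "enthalpy \<gamma> x < enthalpy \<gamma> y"
  unfolding enthalpy_def using assms
  by (intro divide_strict_right_mono diff_strict_right_mono powr_less_mono2) auto

lemma enthalpy_nonneg: "\<gamma> > 1 \<Longrightarrow> 1 \<le> x \<Longrightarrow> 0 \<le> enthalpy \<gamma> x"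
  using enthalpy_mono[of \<gamma> 1 x] by simp

lemma enthalpy_nonpos: "\<gamma> > 1 \<Longrightarrow> 0 < x \<Longrightarrow> x \<le> 1 \<Longrightarrow> enthalpy \<gamma> x \<le> 0"
  using enthalpy_mono[of \<gamma> x 1] by simp

lemma le_if_DERIV_nonneg_above:
  fixes f :: "real \<Rightarrow> real"
  assumes "a \<le> b" "\<And>x. a \<le> x \<Longrightarrow> x \<le> b \<Longrightarrow> (f has_real_derivative f' x) (at x)"
    "\<And>x. a \<le> x \<Longrightarrow> x \<le> b \<Longrightarrow> 0 \<le> f' x"
  shows "f a \<le> f b"
  by (rule DERIV_nonneg_imp_nondecreasing[OF assms(1)]) (use assms(2,3) in auto)

lemma le_if_DERIV_nonpos_below:
  fixes f :: "real \<Rightarrow> real"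
  assumes "a \<le> b" "\<And>x. a \<le> x \<Longrightarrow> x \<le> b \<Longrightarrow> (f has_real_derivative f' x) (at x)"
    "\<And>x. a \<le> x \<Longrightarrow> x \<le> b \<Longrightarrow> f' x \<le> 0"
  shows "f b \<le> f a"
  by (rule DERIV_nonpos_imp_nonincreasing[OF assms(1)]) (use assms(2,3) in auto)

lemma rel_pressure_nonneg:
  assumes "\<gamma> > 1" "r > 0"
  shows "0 \<le> rel_pressure \<gamma> r"
proof (cases "r \<ge> 1")
  case True
  have "rel_pressure \<gamma> 1 \<le> rel_pressure \<gamma> r"
    by (rule le_if_DERIV_nonneg_above[OF True DERIV_rel_pressure])
       (use assms enthalpy_nonneg in \<open>auto intro!: mult_nonneg_nonneg\<close>)
  then show ?thesis by simp
next
  case False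
  have "rel_pressure \<gamma> 1 \<le> rel_pressure \<gamma> r"
    by (rule le_if_DERIV_nonpos_below[OF _ DERIV_rel_pressure])
       (use assms False enthalpy_nonpos in \<open>auto intro!: mult_nonneg_nonpos\<close>)
  then show ?thesis by simp
qed

text \<open>
  The flux bound compares \<open>\<rho> (enthalpy)\<^sup>2\<close> with twice the potential energy. Below the background density the
  difference of right and left side has derivative \<open>- (2 \<gamma> - 1) (enthalpy)\<^sup>2\<close>, so the comparison holds with constant one.
\<close>

lemma enthalpy_le_rel_pressure_below:
  assumes "\<gamma> > 1" "0 < r" "r \<le> 1"
  shows "r * (enthalpy \<gamma> r)\<^sup>2 \<le> 2 * rel_pressure \<gamma> r / (\<gamma> - 1)"
proof -
  let ?k = "enthalpy \<gamma>"
  let ?f = "\<lambda>x. 2 * rel_pressure \<gamma> x / (\<gamma> - 1) - x * (?k x)\<^sup>2"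
  have cancel: "2 * ((\<gamma> - 1) * k) / (\<gamma> - 1) = 2 * k" for k
    using assms by simp
  have D: "(?f has_real_derivative - (2 * \<gamma> - 1) * (?k x)\<^sup>2) (at x)" if "x > 0" for x
  proof -
    have "(?f has_real_derivative 2 * ((\<gamma> - 1) * ?k x) / (\<gamma> - 1)
        - (1 * (?k x)\<^sup>2 + (2 * ?k x * x powr (\<gamma> - 2)) * x)) (at x)"
      by (rule derivative_eq_intros DERIV_enthalpy DERIV_rel_pressure refl
          | use assms that in simp)+
    moreover have "2 * ((\<gamma> - 1) * ?k x) / (\<gamma> - 1) - (1 * (?k x)\<^sup>2 + (2 * ?k x * x powr (\<gamma> - 2)) * x)
        = 2 * ?k x - (?k x)\<^sup>2 - 2 * ?k x * (x * x powr (\<gamma> - 2))"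
      by (subst cancel) (simp add: algebra_simps)
    moreover have "\<dots> = - (2 * \<gamma> - 1) * (?k x)\<^sup>2"
      unfolding mult_powr_enthalpy[OF assms(1) that] by (simp add: algebra_simps power2_eq_square)
    ultimately show ?thesis by (simp only:)
  qed
  have "?f 1 \<le> ?f r"
    by (rule le_if_DERIV_nonpos_below[OF assms(3) D]) (use assms in \<open>auto intro!: mult_nonpos_nonneg\<close>)
  then show ?thesis by simp
qed

text \<open>
  Between density one and two the factor has to be one at density one, since the propagation speed
  must tend to the sound speed for small perturbations.
\<close>

lemma enthalpy_le_rel_pressure_near:
  assumes "\<gamma> > 1"
  obtains A where "A \<ge> 0"
    "\<And>r. 1 \<le> r \<Longrightarrow> r \<le> 2 \<Longrightarrow> r * (enthalpy \<gamma> r)\<^sup>2 \<le> (1 + A * (r - 1)) * (2 * rel_pressure \<gamma> r / (\<gamma> - 1))"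
proof -
  let ?k = "enthalpy \<gamma>"
  define M where "M = 2 powr \<gamma>"
  define A where "A = (2 * \<gamma> - 1) * M"
  have M: "M \<ge> 0" "A \<ge> 0" using assms by (auto simp: M_def A_def)
  have k: "?k x \<le> M * (x - 1)" if "1 \<le> x" "x \<le> 2" for x
  proof -
    have "M * (1 - 1) - ?k 1 \<le> M * (x - 1) - ?k x"
    proof (rule le_if_DERIV_nonneg_above[OF that(1)])
      fix y :: real assume y: "1 \<le> y" "y \<le> x"
      show "((\<lambda>x. M * (x - 1) - ?k x) has_real_derivative M - y powr (\<gamma> - 2)) (at y)"
        by (rule derivative_eq_intros DERIV_enthalpy refl | use assms y in simp)+
      have "y powr (\<gamma> - 2) \<le> y powr \<gamma>" using y by (intro powr_mono) auto
      also have "\<dots> \<le> M" unfolding M_def using y that assms by (intro powr_mono2) auto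
      finally show "0 \<le> M - y powr (\<gamma> - 2)" by simp
    qed
    then show ?thesis by simp
  qed
  let ?h = "\<lambda>x. 2 * rel_pressure \<gamma> x / (\<gamma> - 1)"
  let ?f = "\<lambda>x. (1 + A * (x - 1)) * ?h x - x * (?k x)\<^sup>2"
  have cancel: "2 * ((\<gamma> - 1) * k) / (\<gamma> - 1) = 2 * k" for k
    using assms by simp
  have D: "(?f has_real_derivative 2 * A * ?k x * (x - 1) + A * ?h x - (2 * \<gamma> - 1) * (?k x)\<^sup>2) (at x)"
    if "x > 0" for x
  proof -
    have "(?f has_real_derivative A * ?h x + (2 * ((\<gamma> - 1) * ?k x) / (\<gamma> - 1)) * (1 + A * (x - 1))
        - (1 * (?k x)\<^sup>2 + (2 * ?k x * x powr (\<gamma> - 2)) * x)) (at x)"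
      by (rule derivative_eq_intros DERIV_enthalpy DERIV_rel_pressure refl
          | use assms that in simp)+
    moreover have "A * ?h x + (2 * ((\<gamma> - 1) * ?k x) / (\<gamma> - 1)) * (1 + A * (x - 1)) - (1 * (?k x)\<^sup>2 + (2 * ?k x * x powr (\<gamma> - 2)) * x)
        = 2 * ?k x * (1 + A * (x - 1)) + A * ?h x - (?k x)\<^sup>2 - 2 * ?k x * (x * x powr (\<gamma> - 2))"
      by (subst cancel) (simp add: algebra_simps)
    moreover have "\<dots> = 2 * A * ?k x * (x - 1) + A * ?h x - (2 * \<gamma> - 1) * (?k x)\<^sup>2"
      unfolding mult_powr_enthalpy[OF assms(1) that] by (simp add: algebra_simps power2_eq_square)
    ultimately show ?thesis by (simp only:)
  qed
  show ?thesis
  proof (rule that[OF M(2)])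
    fix r :: real assume r: "1 \<le> r" "r \<le> 2"
    have "?f 1 \<le> ?f r"
    proof (rule le_if_DERIV_nonneg_above[OF r(1) D])
      fix x :: real assume x: "1 \<le> x" "x \<le> r"
      have kx: "0 \<le> ?k x" using x assms enthalpy_nonneg by auto
      have "(2 * \<gamma> - 1) * (?k x * ?k x) \<le> (2 * \<gamma> - 1) * (?k x * (M * (x - 1)))"
        using k[of x] x r kx assms by (intro mult_left_mono) auto
      then have "(2 * \<gamma> - 1) * (?k x)\<^sup>2 \<le> A * ?k x * (x - 1)"
        by (simp add: A_def power2_eq_square mult_ac)
      moreover have "0 \<le> A * ?k x * (x - 1)" using M kx x by simp
      moreover have "0 \<le> A * ?h x"
        using M rel_pressure_nonneg[of \<gamma> x] x assms by simp
      ultimately show "0 \<le> 2 * A * ?k x * (x - 1) + A * ?h x - (2 * \<gamma> - 1) * (?k x)\<^sup>2" by linarith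
    qed (use r in auto)
    then show "r * (?k r)\<^sup>2 \<le> (1 + A * (r - 1)) * ?h r" by simp
  qed
qed

lemma rel_pressure_pos:
  assumes "\<gamma> > 1" "r > 0" "r \<noteq> 1"
  shows "0 < rel_pressure \<gamma> r"
proof -
  consider "r < 1" | "1 < r" "r \<le> 2" | "2 < r" using assms by linarith
  then show ?thesis
  proof cases
    case 1
    have "0 < r * (enthalpy \<gamma> r)\<^sup>2"
      using enthalpy_strict_mono[of \<gamma> r 1] assms 1 by simp
    then have "0 < 2 * rel_pressure \<gamma> r / (\<gamma> - 1)"
      using enthalpy_le_rel_pressure_below[of \<gamma> r] assms 1 by linarith
    then show ?thesis using assms by (simp add: zero_less_divide_iff)
  next
    case 2
    obtain A where A: "A \<ge> 0"
      "\<And>r. 1 \<le> r \<Longrightarrow> r \<le> 2 \<Longrightarrow> r * (enthalpy \<gamma> r)\<^sup>2 \<le> (1 + A * (r - 1)) * (2 * rel_pressure \<gamma> r / (\<gamma> - 1))"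
      using enthalpy_le_rel_pressure_near[OF assms(1)] by blast
    have "0 < r * (enthalpy \<gamma> r)\<^sup>2"
      using enthalpy_strict_mono[of \<gamma> 1 r] assms 2 by simp
    then have "rel_pressure \<gamma> r \<noteq> 0"
      using A(2)[of r] 2 by auto
    then show ?thesis using rel_pressure_nonneg[of \<gamma> r] assms by linarith
  next
    case 3
    obtain A where A: "A \<ge> 0"
      "\<And>r. 1 \<le> r \<Longrightarrow> r \<le> 2 \<Longrightarrow> r * (enthalpy \<gamma> r)\<^sup>2 \<le> (1 + A * (r - 1)) * (2 * rel_pressure \<gamma> r / (\<gamma> - 1))"
      using enthalpy_le_rel_pressure_near[OF assms(1)] by blast
    have "0 < 2 * (enthalpy \<gamma> 2)\<^sup>2"
      using enthalpy_strict_mono[of \<gamma> 1 2] assms by simp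
    then have "rel_pressure \<gamma> 2 \<noteq> 0"
      using A(2)[of 2] by auto
    then have "0 < rel_pressure \<gamma> 2" using rel_pressure_nonneg[of \<gamma> 2] assms by linarith
    also have "rel_pressure \<gamma> 2 \<le> rel_pressure \<gamma> r"
      by (rule le_if_DERIV_nonneg_above[OF _ DERIV_rel_pressure])
         (use assms 3 enthalpy_nonneg in \<open>auto intro!: mult_nonneg_nonneg\<close>)
    finally show ?thesis .
  qed
qed

text \<open>
  At large density the ratio of \<open>\<rho> enthalpy\<close> and potential energy stays bounded, as both grow like \<open>\<rho>\<^sup>\<gamma>\<close>. A comparison
  without the square is used there because the velocity supplies the factor \<open>m\<close>.
\<close>

lemma enthalpy_le_rel_pressure_far:
  assumes "\<gamma> > 1"
  obtains A where "A \<ge> 0" "\<And>r. 2 \<le> r \<Longrightarrow> r * enthalpy \<gamma> r \<le> A * (rel_pressure \<gamma> r / (\<gamma> - 1))"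
proof -
  let ?k = "enthalpy \<gamma>" and ?h = "\<lambda>x. rel_pressure \<gamma> x / (\<gamma> - 1)"
  define A where "A = \<gamma> + 1 / ?k 2 + 2 * ?k 2 / ?h 2"
  have k2: "?k 2 > 0" using enthalpy_strict_mono[of \<gamma> 1 2] assms by simp
  have h2: "?h 2 > 0" using rel_pressure_pos[of \<gamma> 2] assms by simp
  have A: "A \<ge> 0" using k2 h2 assms unfolding A_def by (intro add_nonneg_nonneg divide_nonneg_pos) auto
  have q2: "0 \<le> 2 * ?k 2 / ?h 2" using k2 h2 by (intro divide_nonneg_pos) auto
  let ?f = "\<lambda>x. A * ?h x - x * ?k x"
  have "?f 2 \<le> ?f r" if r: "2 \<le> r" for r
  proof (rule le_if_DERIV_nonneg_above[OF r])
    fix x :: real assume x: "2 \<le> x" "x \<le> r"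
    have "(?f has_real_derivative A * ((\<gamma> - 1) * ?k x) / (\<gamma> - 1)
        - (1 * ?k x + x powr (\<gamma> - 2) * x)) (at x)"
      by (rule derivative_eq_intros DERIV_enthalpy DERIV_rel_pressure refl
          | use assms x in simp)+
    moreover have "A * ((\<gamma> - 1) * ?k x) / (\<gamma> - 1) - (1 * ?k x + x powr (\<gamma> - 2) * x)
       = A * ?k x - ?k x - x * x powr (\<gamma> - 2)"
    proof -
      have "A * ((\<gamma> - 1) * ?k x) / (\<gamma> - 1) = A * ?k x" using assms by simp
      then show ?thesis by simp
    qed
    moreover have "\<dots> = (A - \<gamma>) * ?k x - 1"
      using mult_powr_enthalpy[of \<gamma> x] assms x by (simp add: algebra_simps)
    ultimately show "(?f has_real_derivative (A - \<gamma>) * ?k x - 1) (at x)" by simp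
    have "1 = (1 / ?k 2) * ?k 2" using k2 by simp
    also have "\<dots> \<le> (A - \<gamma>) * ?k x"
    proof (rule mult_mono)
      show "1 / ?k 2 \<le> A - \<gamma>" using q2 by (simp add: A_def)
      show "0 \<le> A - \<gamma>" using q2 k2 unfolding A_def by simp
    qed (use k2 enthalpy_mono[of \<gamma> 2 x] x assms in auto)
    finally show "0 \<le> (A - \<gamma>) * ?k x - 1" by simp
  qed
  moreover have "0 \<le> ?f 2"
  proof -
    have "x = (x / y) * y" if "0 < y" for x y :: real using that by simp
    from this[OF h2] have "2 * ?k 2 = (2 * ?k 2 / ?h 2) * ?h 2" .
    also have "\<dots> \<le> A * ?h 2" using h2 k2 assms by (intro mult_right_mono) (auto simp: A_def add_nonneg_nonneg)
    finally show ?thesis by simp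
  qed
  ultimately show ?thesis by (intro that[OF A]) (metis diff_ge_0_iff_ge order_trans)
qed

lemma rel_energy_nonneg: "\<gamma> > 1 \<Longrightarrow> r > 0 \<Longrightarrow> 0 \<le> rel_energy \<gamma> r v"
  using rel_pressure_nonneg[of \<gamma> r] by (simp add: rel_energy_eq)

lemma rel_energy_eq_0_iff:
  assumes "\<gamma> > 1" "r > 0"
  shows "rel_energy \<gamma> r v = 0 \<longleftrightarrow> r = 1 \<and> v = 0"
proof
  assume 0: "rel_energy \<gamma> r v = 0"
  have "0 \<le> rel_pressure \<gamma> r / (\<gamma> - 1)" "0 \<le> 1/2 * r * (norm v)\<^sup>2"
    using rel_pressure_nonneg[of \<gamma> r] assms by auto
  then have *: "rel_pressure \<gamma> r / (\<gamma> - 1) = 0" "1/2 * r * (norm v)\<^sup>2 = 0"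
    using 0 rel_energy_eq[OF assms(1), of r v] by linarith+
  then show "r = 1 \<and> v = 0" using rel_pressure_pos[of \<gamma> r] assms by fastforce
qed (use assms in \<open>simp add: rel_energy_eq\<close>)

text \<open>
  The product of velocity and pressure is estimated by the geometric mean of kinetic and potential
  energy, hence by their sum.
\<close>

lemma enthalpy_flux_le_rel_energy:
  fixes v :: space
  assumes "\<gamma> > 1" "r > 0" "b \<ge> 0"
    and k: "r * (enthalpy \<gamma> r)\<^sup>2 \<le> (1 + b)\<^sup>2 * (2 * rel_pressure \<gamma> r / (\<gamma> - 1))"
  shows "r * \<bar>enthalpy \<gamma> r\<bar> * norm v \<le> (1 + b) * rel_energy \<gamma> r v"
proof -
  define h where "h = rel_pressure \<gamma> r / (\<gamma> - 1)"
  have h: "h \<ge> 0" using rel_pressure_nonneg[of \<gamma> r] assms by (simp add: h_def)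
  define s where "s = sqrt (2 * h)"
  have s: "s \<ge> 0" "s\<^sup>2 = 2 * h" using h by (auto simp: s_def)
  have "(sqrt r * \<bar>enthalpy \<gamma> r\<bar>)\<^sup>2 \<le> ((1 + b) * s)\<^sup>2"
    using k assms by (simp add: power_mult_distrib s h_def)
  then have 1: "sqrt r * \<bar>enthalpy \<gamma> r\<bar> \<le> (1 + b) * s"
    by (rule power2_le_imp_le) (use s assms in auto)
  have "r * \<bar>enthalpy \<gamma> r\<bar> * norm v = (sqrt r * \<bar>enthalpy \<gamma> r\<bar>) * (sqrt r * norm v)"
    using assms by (simp add: algebra_simps)
  also have "\<dots> \<le> ((1 + b) * s) * (sqrt r * norm v)"
    by (rule mult_right_mono[OF 1]) (use assms in auto)
  also have "\<dots> = (1 + b) * (s * (sqrt r * norm v))" by simp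
  also have "\<dots> \<le> (1 + b) * (1/2 * (sqrt r * norm v)\<^sup>2 + h)"
  proof (rule mult_left_mono)
    have "0 \<le> (sqrt r * norm v - s)\<^sup>2" by simp
    then show "s * (sqrt r * norm v) \<le> 1/2 * (sqrt r * norm v)\<^sup>2 + h"
      using s by (simp add: power2_diff algebra_simps)
  qed (use assms in simp)
  also have "\<dots> = (1 + b) * rel_energy \<gamma> r v"
    using assms by (simp add: rel_energy_eq h_def power_mult_distrib)
  finally show ?thesis .
qed

text \<open>
  The flux consists of the kinetic energy, transported with speed at most \<open>m\<close>, and the work
  \<open>\<rho> enthalpy v\<close> of the pressure. The second part is estimated separately for density below one, between one and two, and above two.
  The bound on \<open>1 - 1 / \<rho>\<close> gives no upper bound on the density when \<open>m \<ge> 1\<close>, which is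
  why large densities need their own argument.
\<close>

lemma rel_flux_le_rel_energy:
  assumes "\<gamma> > 1"
  obtains C where "C > 0"
    "\<And>m r v. r > 0 \<Longrightarrow> \<bar>inverse r * (r - 1)\<bar> + norm v \<le> m \<Longrightarrow>
       norm (rel_flux \<gamma> r v) \<le> (1 + C * m) * rel_energy \<gamma> r v"
proof -
  obtain A where A: "A \<ge> 0"
    "\<And>r. 1 \<le> r \<Longrightarrow> r \<le> 2 \<Longrightarrow> r * (enthalpy \<gamma> r)\<^sup>2 \<le> (1 + A * (r - 1)) * (2 * rel_pressure \<gamma> r / (\<gamma> - 1))"
    using enthalpy_le_rel_pressure_near[OF assms] by blast
  obtain B where B: "B \<ge> 0"
    "\<And>r. 2 \<le> r \<Longrightarrow> r * enthalpy \<gamma> r \<le> B * (rel_pressure \<gamma> r / (\<gamma> - 1))"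
    using enthalpy_le_rel_pressure_far[OF assms] by blast
  define C where "C = 1 + 2 * A + B"
  have C: "C > 0" using A B by (simp add: C_def)
  show ?thesis
  proof (rule that[OF C])
    fix m r and v :: space
    assume r: "r > 0" and m: "\<bar>inverse r * (r - 1)\<bar> + norm v \<le> m"
    let ?E = "rel_energy \<gamma> r v" and ?k = "enthalpy \<gamma> r"
    have E: "0 \<le> ?E" using rel_energy_nonneg assms r by blast
    have vm: "norm v \<le> m" "0 \<le> m" using m norm_ge_zero[of v] abs_ge_zero[of "inverse r * (r - 1)"] by linarith+
    have sm: "inverse r * (r - 1) \<le> m" using m norm_ge_zero[of v] by linarith
    have h: "0 \<le> rel_pressure \<gamma> r / (\<gamma> - 1)" using rel_pressure_nonneg[of \<gamma> r] assms r by simp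
    have kin: "0 \<le> 1/2 * r * (norm v)\<^sup>2" using r by simp
    have key: "r * \<bar>?k\<bar> * norm v \<le> (1 + (2 * A + B) * m) * ?E"
    proof -
      consider "r \<le> 1" | "1 \<le> r" "r \<le> 2" | "2 \<le> r" by linarith
      then show ?thesis
      proof cases
        case 1
        have "r * \<bar>?k\<bar> * norm v \<le> (1 + 0) * ?E"
          by (rule enthalpy_flux_le_rel_energy)
             (use enthalpy_le_rel_pressure_below[of \<gamma> r] assms r 1 in auto)
        also have "\<dots> \<le> (1 + (2 * A + B) * m) * ?E"
          using E A B vm by (intro mult_right_mono) auto
        finally show ?thesis .
      next
        case 2
        have Am: "0 \<le> A * (r - 1)" using A 2 by simp
        have "r - 1 = r * (inverse r * (r - 1))" using r by simp
        also have "\<dots> \<le> 2 * m" using 2 sm by (intro mult_mono) auto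
        finally have rm: "r - 1 \<le> 2 * m" .
        have "r * ?k\<^sup>2 \<le> (1 + A * (r - 1)) * (2 * rel_pressure \<gamma> r / (\<gamma> - 1))"
          using A(2)[OF 2] .
        also have "\<dots> \<le> (1 + A * (r - 1))\<^sup>2 * (2 * rel_pressure \<gamma> r / (\<gamma> - 1))"
          using Am h by (intro mult_right_mono self_le_power) auto
        finally have "r * \<bar>?k\<bar> * norm v \<le> (1 + A * (r - 1)) * ?E"
          by (intro enthalpy_flux_le_rel_energy) (use assms r Am in auto)
        also have "\<dots> \<le> (1 + (2 * A + B) * m) * ?E"
        proof (intro mult_right_mono[OF _ E] add_left_mono)
          have "A * (r - 1) \<le> A * (2 * m)" using rm A by (intro mult_left_mono) auto
          also have "\<dots> \<le> (2 * A + B) * m" using B vm by (simp add: algebra_simps)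
          finally show "A * (r - 1) \<le> (2 * A + B) * m" .
        qed
        finally show ?thesis .
      next
        case 3
        have k0: "0 \<le> ?k" using enthalpy_nonneg assms 3 by simp
        have "r * \<bar>?k\<bar> * norm v \<le> B * (rel_pressure \<gamma> r / (\<gamma> - 1)) * m"
        proof (rule mult_mono[OF _ vm(1)])
          show "r * \<bar>?k\<bar> \<le> B * (rel_pressure \<gamma> r / (\<gamma> - 1))"
            using B(2)[OF 3] k0 by simp
          show "0 \<le> B * (rel_pressure \<gamma> r / (\<gamma> - 1))"
            using B(1) h by (rule mult_nonneg_nonneg)
        qed simp
        also have "\<dots> = (B * m) * (rel_pressure \<gamma> r / (\<gamma> - 1))" by simp
        also have "\<dots> \<le> (1 + (2 * A + B) * m) * ?E"
        proof (rule mult_mono)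
          have "0 \<le> A * m" using A vm by simp
          then show "B * m \<le> 1 + (2 * A + B) * m" by (simp add: distrib_right)
          show "rel_pressure \<gamma> r / (\<gamma> - 1) \<le> ?E"
            using kin rel_energy_eq[OF assms] by simp
          show "0 \<le> 1 + (2 * A + B) * m" using A B vm by simp
        qed (use h in auto)
        finally show ?thesis .
      qed
    qed
    have "norm (rel_flux \<gamma> r v) = \<bar>1/2 * r * (norm v)\<^sup>2 + r * ?k\<bar> * norm v"
      by (simp add: rel_flux_eq[OF assms r])
    also have "\<dots> \<le> (1/2 * r * (norm v)\<^sup>2 + r * \<bar>?k\<bar>) * norm v"
    proof (rule mult_right_mono)
      have "\<bar>r * ?k\<bar> = r * \<bar>?k\<bar>" using r by (simp add: abs_mult)
      then show "\<bar>1/2 * r * (norm v)\<^sup>2 + r * ?k\<bar> \<le> 1/2 * r * (norm v)\<^sup>2 + r * \<bar>?k\<bar>"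
        using abs_triangle_ineq[of "1/2 * r * (norm v)\<^sup>2" "r * ?k"] kin by simp
    qed simp
    also have "\<dots> = 1/2 * r * (norm v)\<^sup>2 * norm v + r * \<bar>?k\<bar> * norm v"
      by (simp add: distrib_right)
    also have "\<dots> \<le> ?E * m + (1 + (2 * A + B) * m) * ?E"
    proof (rule add_mono[OF _ key])
      show "1/2 * r * (norm v)\<^sup>2 * norm v \<le> ?E * m"
        using kin vm E h rel_energy_eq[OF assms, of r v] by (intro mult_mono) auto
    qed
    also have "\<dots> = (1 + C * m) * ?E" by (simp add: C_def algebra_simps)
    finally show "norm (rel_flux \<gamma> r v) \<le> (1 + C * m) * ?E" .
  qed
qed

section \<open>Coercivity of the momentum flux\<close>

lemma rel_pressure_ge_square:
  assumes "\<gamma> > 1"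
  obtains c where "c > 0" "\<And>r. 0 < r \<Longrightarrow> r \<le> 2 \<Longrightarrow> c * (r - 1)\<^sup>2 \<le> rel_pressure \<gamma> r"
proof -
  let ?k = "enthalpy \<gamma>"
  \<comment> \<open>a lower bound for the difference quotients of the enthalpy at the background density, on \<open>(0, 2]\<close>\<close>
  define d where "d = min (1 / (\<gamma> - 1)) (min 1 (2 powr (\<gamma> - 2)))"
  define c where "c = (\<gamma> - 1) * d / 2"
  have d: "d > 0" using assms by (auto simp: d_def)
  then have c: "c > 0" using assms by (simp add: c_def)
  have above: "d * (x - 1) \<le> ?k x" if "1 \<le> x" "x \<le> 2" for x
  proof -
    have "?k 1 - d * (1 - 1) \<le> ?k x - d * (x - 1)"
    proof (rule le_if_DERIV_nonneg_above[OF that(1)])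
      fix y :: real assume y: "1 \<le> y" "y \<le> x"
      show "((\<lambda>x. ?k x - d * (x - 1)) has_real_derivative y powr (\<gamma> - 2) - d) (at y)"
        by (rule derivative_eq_intros DERIV_enthalpy refl | use assms y in simp)+
      show "0 \<le> y powr (\<gamma> - 2) - d"
      proof (cases "\<gamma> \<ge> 2")
        case True
        then have "1 \<le> y powr (\<gamma> - 2)" using y by (intro ge_one_powr_ge_zero) auto
        then show ?thesis by (simp add: d_def)
      next
        case False
        then have "2 powr (\<gamma> - 2) \<le> y powr (\<gamma> - 2)" using y that by (intro powr_mono2') auto
        then show ?thesis by (simp add: d_def)
      qed
    qed
    then show ?thesis by simp
  qed
  have below: "?k x \<le> d * (x - 1)" if "0 < x" "x \<le> 1" for x
  proof (cases "\<gamma> \<ge> 2")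
    case True
    have "x powr (\<gamma> - 1) \<le> x powr 1" using True that by (intro powr_mono') auto
    then have "?k x \<le> (x - 1) / (\<gamma> - 1)"
      unfolding enthalpy_def using assms that by (intro divide_right_mono) auto
    also have "\<dots> = (1 / (\<gamma> - 1)) * (x - 1)" by simp
    also have "\<dots> \<le> d * (x - 1)"
      using that by (intro mult_right_mono_neg) (auto simp: d_def)
    finally show ?thesis .
  next
    case False
    have "d * (1 - 1) - ?k 1 \<le> d * (x - 1) - ?k x"
    proof (rule le_if_DERIV_nonpos_below[OF that(2)])
      fix y :: real assume y: "x \<le> y" "y \<le> 1"
      show "((\<lambda>x. d * (x - 1) - ?k x) has_real_derivative d - y powr (\<gamma> - 2)) (at y)"
        by (rule derivative_eq_intros DERIV_enthalpy refl | use assms y that in simp)+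
      have "1 powr (\<gamma> - 2) \<le> y powr (\<gamma> - 2)" using y that False by (intro powr_mono2') auto
      then show "d - y powr (\<gamma> - 2) \<le> 0" by (simp add: d_def)
    qed
    then show ?thesis by simp
  qed
  let ?f = "\<lambda>x. rel_pressure \<gamma> x - c * (x - 1)\<^sup>2"
  have D: "(?f has_real_derivative (\<gamma> - 1) * (?k x - d * (x - 1))) (at x)" if "x > 0" for x
  proof -
    have "(?f has_real_derivative (\<gamma> - 1) * ?k x - c * (2 * (x - 1))) (at x)"
      by (rule derivative_eq_intros DERIV_rel_pressure refl | use assms that in simp)+
    moreover have "(\<gamma> - 1) * ?k x - c * (2 * (x - 1)) = (\<gamma> - 1) * (?k x - d * (x - 1))"
    proof -
      have "c * (2 * (x - 1)) = (\<gamma> - 1) * (d * (x - 1))" by (simp add: c_def)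
      then show ?thesis by (simp only: right_diff_distrib)
    qed
    ultimately show ?thesis by (simp only:)
  qed
  show ?thesis
  proof (rule that[OF c])
    fix r :: real assume r: "0 < r" "r \<le> 2"
    have "?f 1 \<le> ?f r"
    proof (cases "1 \<le> r")
      case True
      show ?thesis
        by (rule le_if_DERIV_nonneg_above[OF True D])
           (use assms r above in \<open>auto intro!: mult_nonneg_nonneg\<close>)
    next
      case False
      then have "r \<le> 1" by simp
      then show ?thesis
        by (rule le_if_DERIV_nonpos_below[OF _ D])
           (use assms r below in \<open>auto intro!: mult_nonneg_nonpos\<close>)
    qed
    then show "c * (r - 1)\<^sup>2 \<le> rel_pressure \<gamma> r" by simp
  qed
qed

lemma rel_pressure_ge_powr:
  assumes "\<gamma> > 1"
  obtains c where "c > 0" "\<And>r. 2 \<le> r \<Longrightarrow> c * r powr \<gamma> \<le> rel_pressure \<gamma> r"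
proof -
  define c where "c = min (rel_pressure \<gamma> 2 / 2 powr \<gamma>) ((1 - 2 powr (1 - \<gamma>)) / \<gamma>)"
  have "2 powr (1 - \<gamma>) < (2::real) powr 0" using assms by (intro powr_less_mono) auto
  then have c: "c > 0"
    using assms rel_pressure_pos[of \<gamma> 2] by (auto simp: c_def)
  have cg: "\<gamma> * c \<le> 1 - 2 powr (1 - \<gamma>)"
  proof -
    have "\<gamma> * c \<le> \<gamma> * ((1 - 2 powr (1 - \<gamma>)) / \<gamma>)"
      using assms by (intro mult_left_mono) (auto simp: c_def)
    then show ?thesis using assms by simp
  qed
  let ?f = "\<lambda>x. rel_pressure \<gamma> x - c * x powr \<gamma>"
  show ?thesis
  proof (rule that[OF c])
    fix r :: real assume r: "2 \<le> r"
    have "?f 2 \<le> ?f r"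
    proof (rule le_if_DERIV_nonneg_above[OF r])
      fix x :: real assume x: "2 \<le> x" "x \<le> r"
      have "(?f has_real_derivative (\<gamma> - 1) * enthalpy \<gamma> x - c * (\<gamma> * x powr (\<gamma> - 1))) (at x)"
        by (rule derivative_eq_intros DERIV_rel_pressure has_real_derivative_powr refl
            | use assms x in simp)+
      moreover have "(\<gamma> - 1) * enthalpy \<gamma> x - c * (\<gamma> * x powr (\<gamma> - 1))
          = (1 - \<gamma> * c) * x powr (\<gamma> - 1) - 1"
      proof -
        have "(\<gamma> - 1) * enthalpy \<gamma> x = x powr (\<gamma> - 1) - 1" using assms by (simp add: enthalpy_def)
        then show ?thesis by (simp add: algebra_simps)
      qed
      ultimately show "(?f has_real_derivative (1 - \<gamma> * c) * x powr (\<gamma> - 1) - 1) (at x)" by (simp only:)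
      have "1 = 2 powr (1 - \<gamma>) * 2 powr (\<gamma> - 1)" by (simp add: powr_add[symmetric])
      also have "\<dots> \<le> (1 - \<gamma> * c) * x powr (\<gamma> - 1)"
      proof (rule mult_mono)
        show "2 powr (\<gamma> - 1) \<le> x powr (\<gamma> - 1)" using x assms by (intro powr_mono2) auto
        show "2 powr (1 - \<gamma>) \<le> 1 - \<gamma> * c" using cg by simp
        have "0 \<le> 2 powr (1 - \<gamma>)" by simp
        then show "0 \<le> 1 - \<gamma> * c" using cg by linarith
      qed auto
      finally show "0 \<le> (1 - \<gamma> * c) * x powr (\<gamma> - 1) - 1" by simp
    qed
    moreover have "c * 2 powr \<gamma> \<le> rel_pressure \<gamma> 2"
    proof -
      have "c * 2 powr \<gamma> \<le> (rel_pressure \<gamma> 2 / 2 powr \<gamma>) * 2 powr \<gamma>"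
        by (intro mult_right_mono) (auto simp: c_def)
      then show ?thesis by simp
    qed
    ultimately show "c * r powr \<gamma> \<le> rel_pressure \<gamma> r" by linarith
  qed
qed

lemma young_square:
  fixes x y c :: real
  assumes "c > 0"
  shows "x * y \<le> c * x\<^sup>2 + y\<^sup>2 / (4 * c)"
proof -
  have "0 \<le> (2 * c * x - y)\<^sup>2 / (4 * c)" using assms by simp
  also have "\<dots> = c * x\<^sup>2 - x * y + y\<^sup>2 / (4 * c)"
    using assms by (simp add: power2_eq_square field_simps)
  finally show ?thesis by simp
qed

text \<open>
  For small \<open>b\<close> the left side is absorbed by \<open>c r \<le> c r\<^sup>\<gamma>\<close>. For large \<open>b\<close> it is comparable to \<open>r b\<^sup>2\<close>,
  and either the power of \<open>r\<close> absorbs it or \<open>r\<close> is at most a multiple of \<open>b\<^sup>2\<^sup>/\<^sup>(\<^sup>\<gamma>\<^sup>-\<^sup>1\<^sup>)\<close>.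
\<close>

lemma density_powr_young:
  fixes \<gamma> c :: real
  assumes "\<gamma> > 1" "c > 0"
  obtains B where "B \<ge> 0"
    "\<And>r b. 1 \<le> r \<Longrightarrow> 0 \<le> b \<Longrightarrow> r * (b + b\<^sup>2) \<le> c * r powr \<gamma> + B * (b\<^sup>2 * b powr (2 / (\<gamma> - 1)))"
proof -
  define b0 where "b0 = min 1 (c / 2)"
  have b0: "0 < b0" "b0 \<le> 1" "2 * b0 \<le> c" using assms by (auto simp: b0_def)
  define K where "K = 1 + 1 / b0"
  have K: "K > 0" using b0 by (auto simp: K_def add_pos_pos)
  define B where "B = K * (K / c) powr (1 / (\<gamma> - 1))"
  have B: "B \<ge> 0" using K by (simp add: B_def)
  show ?thesis
  proof (rule that[OF B])
    fix r b :: real assume r: "1 \<le> r" and b: "0 \<le> b"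
    have rg: "r powr \<gamma> = r * r powr (\<gamma> - 1)" using r powr_add[of r 1 "\<gamma> - 1"] by simp
    have q1: "1 \<le> r powr (\<gamma> - 1)" using r assms by (intro ge_one_powr_ge_zero) auto
    have pos: "0 \<le> B * (b\<^sup>2 * b powr (2 / (\<gamma> - 1)))" using B by simp
    show "r * (b + b\<^sup>2) \<le> c * r powr \<gamma> + B * (b\<^sup>2 * b powr (2 / (\<gamma> - 1)))"
    proof (cases "b \<le> b0")
      case True
      have "b\<^sup>2 \<le> b" using b b0 True by (simp add: power2_eq_square mult_left_le_one_le)
      then have "b + b\<^sup>2 \<le> c" using True b0 by linarith
      also have "c \<le> c * r powr (\<gamma> - 1)" using q1 assms by simp
      finally have "r * (b + b\<^sup>2) \<le> r * (c * r powr (\<gamma> - 1))" using r by (intro mult_left_mono) auto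
      then show ?thesis using pos by (simp add: rg algebra_simps)
    next
      case False
      have "b = (1 / b) * b\<^sup>2" using False b0 by (simp add: power2_eq_square)
      also have "\<dots> \<le> (1 / b0) * b\<^sup>2"
        using False b0 by (intro mult_right_mono) (auto simp: frac_le)
      finally have bK: "b + b\<^sup>2 \<le> K * b\<^sup>2" by (simp add: K_def algebra_simps)
      then have rK: "r * (b + b\<^sup>2) \<le> r * (K * b\<^sup>2)" using r by (intro mult_left_mono) auto
      show ?thesis
      proof (cases "K * b\<^sup>2 \<le> c * r powr (\<gamma> - 1)")
        case True
        then have "r * (K * b\<^sup>2) \<le> r * (c * r powr (\<gamma> - 1))" using r by (intro mult_left_mono) auto
        then show ?thesis using rK pos by (simp add: rg algebra_simps)
      next
        case False
        then have "r powr (\<gamma> - 1) \<le> (K / c) * b\<^sup>2" using assms by (simp add: field_simps)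
        then have "(r powr (\<gamma> - 1)) powr (1 / (\<gamma> - 1)) \<le> ((K / c) * b\<^sup>2) powr (1 / (\<gamma> - 1))"
          using assms by (intro powr_mono2) auto
        moreover have "(r powr (\<gamma> - 1)) powr (1 / (\<gamma> - 1)) = r"
          using assms r by (simp add: powr_powr)
        moreover have "((K / c) * b\<^sup>2) powr (1 / (\<gamma> - 1)) = (K / c) powr (1 / (\<gamma> - 1)) * b powr (2 / (\<gamma> - 1))"
        proof -
          have "b > 0" using \<open>\<not> b \<le> b0\<close> b0 by linarith
          then have "b\<^sup>2 = b powr 2" by simp
          then show ?thesis
            using powr_mult[of "K / c" "b powr 2" "1 / (\<gamma> - 1)"] K assms by (simp add: powr_powr)
        qed
        ultimately have "r \<le> (K / c) powr (1 / (\<gamma> - 1)) * b powr (2 / (\<gamma> - 1))" by simp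
        then have "r * (K * b\<^sup>2) \<le> (K / c) powr (1 / (\<gamma> - 1)) * b powr (2 / (\<gamma> - 1)) * (K * b\<^sup>2)"
          using K by (intro mult_right_mono) auto
        also have "\<dots> = B * (b\<^sup>2 * b powr (2 / (\<gamma> - 1)))" by (simp add: B_def)
        finally show ?thesis using rK assms by (smt (verit) mult_nonneg_nonneg powr_ge_zero)
      qed
    qed
  qed
qed

text \<open>
  In the application \<open>\<theta>\<^sup>N\<close> is the time cutoff and \<open>\<theta>\<^sup>N\<^sup>-\<^sup>1 a\<close> is its rate of decay times half the height. With \<open>b = a / \<theta>\<close> all terms
  carry the factor \<open>\<theta>\<^sup>N\<close>, and the powers of \<open>b\<close> lost by Young's inequality are at most
  \<open>2 + 2 / (\<gamma> - 1)\<close>; the lower bound on \<open>N\<close> makes \<open>\<theta>\<^sup>N\<close> compensate the negative powers of \<open>\<theta>\<close>.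
  Since \<open>a \<le> M\<close>, all remaining powers of \<open>a\<close> reduce to \<open>a\<^sup>2\<close>, so the same estimate serves every \<open>\<gamma> > 1\<close>.
\<close>

lemma momentum_young:
  assumes "\<gamma> > 1" "N \<ge> 2 + 2 / (\<gamma> - 1)" "M \<ge> 0"
  obtains B where "B > 0"
    "\<And>r v \<theta> a. 0 < r \<Longrightarrow> 0 < \<theta> \<Longrightarrow> \<theta> \<le> 1 \<Longrightarrow> 0 \<le> a \<Longrightarrow> a \<le> M \<Longrightarrow>
       \<bar>r - 1 + r * v\<bar> * (\<theta> powr (N - 1) * a)
         \<le> \<theta> powr N * (r * v\<^sup>2 + rel_pressure \<gamma> r) + B * a\<^sup>2"
proof -
  obtain c1 where c1: "c1 > 0" "\<And>r. 0 < r \<Longrightarrow> r \<le> 2 \<Longrightarrow> c1 * (r - 1)\<^sup>2 \<le> rel_pressure \<gamma> r"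
    using rel_pressure_ge_square[OF assms(1)] by blast
  obtain c2 where c2: "c2 > 0" "\<And>r. 2 \<le> r \<Longrightarrow> c2 * r powr \<gamma> \<le> rel_pressure \<gamma> r"
    using rel_pressure_ge_powr[OF assms(1)] by blast
  obtain B' where B': "B' \<ge> 0"
    "\<And>r b. 1 \<le> r \<Longrightarrow> 0 \<le> b \<Longrightarrow> r * (b + b\<^sup>2) \<le> c2 * r powr \<gamma> + B' * (b\<^sup>2 * b powr (2 / (\<gamma> - 1)))"
    using density_powr_young[OF assms(1) c2(1)] by blast
  define B where "B = 1 + 1 / (4 * c1) + B' * M powr (2 / (\<gamma> - 1))"
  have B: "B > 0" using c1 B' by (auto simp: B_def intro!: add_pos_nonneg)
  show ?thesis
  proof (rule that[OF B])
    fix r v \<theta> a :: real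
    assume r: "0 < r" and th: "0 < \<theta>" "\<theta> \<le> 1" and a: "0 \<le> a" "a \<le> M"
    define b where "b = a / \<theta>"
    have b: "b \<ge> 0" using a th by (simp add: b_def)
    have tN: "\<theta> powr N > 0" using th by simp
    have aN: "\<theta> powr (N - 1) * a = \<theta> powr N * b"
      using th by (simp add: b_def powr_diff)
    have "0 \<le> 2 / (\<gamma> - 1)" using assms by simp
    then have N2: "N \<ge> 2" using assms by linarith
    have bsq: "\<theta> powr N * b\<^sup>2 \<le> a\<^sup>2"
    proof -
      have "\<theta> powr N \<le> \<theta> powr 2" using th N2 by (intro powr_mono') auto
      then have "\<theta> powr N * b\<^sup>2 \<le> \<theta> powr 2 * b\<^sup>2" by (intro mult_right_mono) auto
      then show ?thesis using th by (simp add: b_def power_divide)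
    qed
    have bigb: "\<theta> powr N * (b\<^sup>2 * b powr (2 / (\<gamma> - 1))) \<le> M powr (2 / (\<gamma> - 1)) * a\<^sup>2"
    proof -
      let ?q = "2 / (\<gamma> - 1)"
      have q: "?q > 0" using assms by simp
      have "\<theta> powr N \<le> \<theta> powr (2 + ?q)" using th assms by (intro powr_mono') auto
      then have "\<theta> powr N * (b\<^sup>2 * b powr ?q) \<le> \<theta> powr (2 + ?q) * (b\<^sup>2 * b powr ?q)"
        using b by (intro mult_right_mono) auto
      also have "\<dots> = (\<theta> powr 2 * b\<^sup>2) * (\<theta> powr ?q * b powr ?q)" by (simp add: powr_add)
      also have "\<theta> powr 2 * b\<^sup>2 = a\<^sup>2" using th by (simp add: b_def power_divide)
      also have "\<theta> powr ?q * b powr ?q = a powr ?q"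
        using powr_mult[of \<theta> b ?q] th b by (simp add: b_def)
      also have "a\<^sup>2 * a powr ?q \<le> a\<^sup>2 * M powr ?q"
        using a q by (intro mult_left_mono powr_mono2) auto
      finally show ?thesis by (simp add: mult.commute)
    qed
    have mom: "r * \<bar>v\<bar> * b \<le> r * v\<^sup>2 + r * b\<^sup>2 / 4"
    proof -
      have "\<bar>v\<bar> * b \<le> v\<^sup>2 + b\<^sup>2 / 4" using young_square[of 1 "\<bar>v\<bar>" b] by simp
      then have "r * (\<bar>v\<bar> * b) \<le> r * (v\<^sup>2 + b\<^sup>2 / 4)" using r by (intro mult_left_mono) auto
      then show ?thesis by (simp add: algebra_simps)
    qed
    have split: "\<bar>r - 1 + r * v\<bar> * b \<le> \<bar>r - 1\<bar> * b + r * \<bar>v\<bar> * b"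
    proof -
      have "\<bar>r - 1 + r * v\<bar> \<le> \<bar>r - 1\<bar> + r * \<bar>v\<bar>"
        using abs_triangle_ineq[of "r - 1" "r * v"] r by (simp add: abs_mult)
      from mult_right_mono[OF this b] show ?thesis by (simp add: algebra_simps)
    qed
    have "\<theta> powr N * (\<bar>r - 1 + r * v\<bar> * b)
      \<le> \<theta> powr N * (r * v\<^sup>2 + rel_pressure \<gamma> r) + B * a\<^sup>2"
    proof (cases "r \<le> 2")
      case True
      have "\<bar>r - 1\<bar> * b \<le> c1 * (r - 1)\<^sup>2 + b\<^sup>2 / (4 * c1)"
        using young_square[OF c1(1), of "\<bar>r - 1\<bar>" b] by simp
      moreover have "c1 * (r - 1)\<^sup>2 \<le> rel_pressure \<gamma> r" using c1 r True by simp
      moreover have "r * b\<^sup>2 / 4 \<le> b\<^sup>2"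
      proof -
        have "r * b\<^sup>2 \<le> 2 * b\<^sup>2" using True by (intro mult_right_mono) auto
        moreover have "0 \<le> b\<^sup>2" by simp
        ultimately show ?thesis by linarith
      qed
      ultimately have "\<bar>r - 1 + r * v\<bar> * b \<le> r * v\<^sup>2 + rel_pressure \<gamma> r + (1 + 1 / (4 * c1)) * b\<^sup>2"
        using split mom by (simp add: algebra_simps)
      then have "\<theta> powr N * (\<bar>r - 1 + r * v\<bar> * b)
          \<le> \<theta> powr N * (r * v\<^sup>2 + rel_pressure \<gamma> r + (1 + 1 / (4 * c1)) * b\<^sup>2)"
        using tN by (intro mult_left_mono) auto
      also have "\<dots> = \<theta> powr N * (r * v\<^sup>2 + rel_pressure \<gamma> r) + (1 + 1 / (4 * c1)) * (\<theta> powr N * b\<^sup>2)"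
        by (simp add: algebra_simps)
      also have "(1 + 1 / (4 * c1)) * (\<theta> powr N * b\<^sup>2) \<le> B * a\<^sup>2"
        using bsq c1 B' by (intro mult_mono) (auto simp: B_def)
      finally show ?thesis by simp
    next
      case False
      have "\<bar>r - 1\<bar> * b \<le> r * b" using False b by (intro mult_right_mono) auto
      moreover have "r * b\<^sup>2 / 4 \<le> r * b\<^sup>2" using r by simp
      ultimately have "\<bar>r - 1 + r * v\<bar> * b \<le> r * v\<^sup>2 + r * (b + b\<^sup>2)"
        using split mom by (simp add: algebra_simps)
      also have "r * (b + b\<^sup>2) \<le> c2 * r powr \<gamma> + B' * (b\<^sup>2 * b powr (2 / (\<gamma> - 1)))"
        using B'(2)[of r b] False b by simp
      also have "c2 * r powr \<gamma> \<le> rel_pressure \<gamma> r" using c2 False by simp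
      finally have "\<bar>r - 1 + r * v\<bar> * b \<le> r * v\<^sup>2 + rel_pressure \<gamma> r + B' * (b\<^sup>2 * b powr (2 / (\<gamma> - 1)))"
        by simp
      then have "\<theta> powr N * (\<bar>r - 1 + r * v\<bar> * b)
          \<le> \<theta> powr N * (r * v\<^sup>2 + rel_pressure \<gamma> r + B' * (b\<^sup>2 * b powr (2 / (\<gamma> - 1))))"
        using tN by (intro mult_left_mono) auto
      also have "\<dots> = \<theta> powr N * (r * v\<^sup>2 + rel_pressure \<gamma> r)
          + B' * (\<theta> powr N * (b\<^sup>2 * b powr (2 / (\<gamma> - 1))))"
        by (simp add: algebra_simps)
      also have "B' * (\<theta> powr N * (b\<^sup>2 * b powr (2 / (\<gamma> - 1)))) \<le> B' * (M powr (2 / (\<gamma> - 1)) * a\<^sup>2)"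
        using bigb B' by (intro mult_left_mono) auto
      also have "\<dots> \<le> B * a\<^sup>2"
        using c1 by (auto simp: B_def algebra_simps)
      finally show ?thesis by simp
    qed
    then show "\<bar>r - 1 + r * v\<bar> * (\<theta> powr (N - 1) * a)
        \<le> \<theta> powr N * (r * v\<^sup>2 + rel_pressure \<gamma> r) + B * a\<^sup>2"
      unfolding aN by (simp only: mult.left_commute)
  qed
qed

section \<open>Essentially bounded functions\<close>

lemma slab_sets_borel [measurable, simp]: "slab T \<in> sets borel"
  unfolding slab_def by (intro borel_Times) auto

lemma slab_sets_lebesgue [measurable, simp]: "slab T \<in> sets lebesgue"
  by (simp add: sets_completionI_sets)

lemma mem_slab [simp]: "(t, x) \<in> slab T \<longleftrightarrow> 0 \<le> t \<and> t < T"
  by (auto simp: slab_def)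

lemma mem_slab_iff: "z \<in> slab T \<longleftrightarrow> 0 \<le> fst z \<and> fst z < T"
  by (cases z) simp

lemma convex_slab: "convex (slab T)"
  unfolding slab_def by (intro convex_Times) auto

lemma space_lebesgue_on_slab [simp]: "space (lebesgue_on (slab T)) = slab T"
  by simp

lemma AE_norm_le_Linf_norm:
  assumes "Linf_norm A f \<le> ennreal m"
  shows "AE x in lebesgue_on A. norm (f x) \<le> m \<or> (m < 0 \<and> f x = 0)"
proof -
  have "AE x in lebesgue_on A. ennreal (norm (f x)) \<le> Linf_norm A f"
    unfolding Linf_norm_def by (rule esssup_AE)
  then show ?thesis
  proof eventually_elim
    case (elim x)
    then have "ennreal (norm (f x)) \<le> ennreal m" using assms by (rule order_trans)
    then show ?case by (cases "m \<ge> 0") (auto simp: ennreal_le_iff ennreal_neg)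
  qed
qed

lemma Linf_normI:
  assumes "f \<in> borel_measurable (lebesgue_on A)" "AE x in lebesgue_on A. norm (f x) \<le> m"
  shows "Linf_norm A f \<le> ennreal m"
  unfolding Linf_norm_def
  by (rule esssup_I) (use assms in \<open>auto elim!: eventually_mono intro: ennreal_leI\<close>)

lemma Linf_norm_eq_0D:
  assumes "Linf_norm A f = 0"
  shows "AE x in lebesgue_on A. f x = 0"
  using AE_norm_le_Linf_norm[of A f 0] assms by simp

lemma Linf_norm_eq_0I:
  assumes "f \<in> borel_measurable (lebesgue_on A)" "AE x in lebesgue_on A. f x = 0"
  shows "Linf_norm A f = 0"
  using Linf_normI[OF assms(1), of 0] assms(2) by (auto elim: eventually_mono)

lemma Linf_iff:
  fixes f :: "'a::euclidean_space \<Rightarrow> 'b::euclidean_space"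
  shows "f \<in> Linf A \<longleftrightarrow> f \<in> borel_measurable (lebesgue_on A) \<and>
     (\<exists>B. AE x in lebesgue_on A. norm (f x) \<le> B)"
proof safe
  assume f: "f \<in> Linf A"
  then show "f \<in> borel_measurable (lebesgue_on A)" by (simp add: Linf_def)
  have "Linf_norm A f < \<infinity>" using f by (simp add: Linf_def)
  then have "Linf_norm A f \<le> ennreal (enn2real (Linf_norm A f))" by simp
  from AE_norm_le_Linf_norm[OF this]
  show "\<exists>B. AE x in lebesgue_on A. norm (f x) \<le> B"
    by (intro exI[of _ "enn2real (Linf_norm A f)"]) (auto elim!: eventually_mono simp: not_less)
next
  fix B assume "f \<in> borel_measurable (lebesgue_on A)" "AE x in lebesgue_on A. norm (f x) \<le> B"
  then have "Linf_norm A f \<le> ennreal B" by (rule Linf_normI)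
  then have "Linf_norm A f < \<infinity>" by (simp add: order_le_less_trans)
  then show "f \<in> Linf A" using \<open>f \<in> borel_measurable _\<close> by (simp add: Linf_def)
qed

lemma LinfI:
  fixes f :: "'a::euclidean_space \<Rightarrow> 'b::euclidean_space"
  assumes "f \<in> borel_measurable (lebesgue_on A)" "AE x in lebesgue_on A. norm (f x) \<le> B"
  shows "f \<in> Linf A"
  using assms by (auto simp: Linf_iff)

lemma LinfE:
  fixes f :: "'a::euclidean_space \<Rightarrow> 'b::euclidean_space"
  assumes "f \<in> Linf A"
  obtains B where "B \<ge> 0" "AE x in lebesgue_on A. norm (f x) \<le> B"
proof -
  obtain B where "AE x in lebesgue_on A. norm (f x) \<le> B" using assms by (auto simp: Linf_iff)
  then have "AE x in lebesgue_on A. norm (f x) \<le> max B 0" by (auto elim!: eventually_mono)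
  then show ?thesis by (intro that[of "max B 0"]) auto
qed

lemma Linf_measurable: "f \<in> Linf A \<Longrightarrow> f \<in> borel_measurable (lebesgue_on A)"
  by (simp add: Linf_def)

lemma Linf_const: "(\<lambda>_. c) \<in> Linf A"
  by (rule LinfI[of _ _ "norm c"]) auto

lemma Linf_add:
  assumes "f \<in> Linf A" "g \<in> Linf A"
  shows "(\<lambda>x. f x + g x) \<in> Linf A"
proof -
  obtain B C where *: "AE x in lebesgue_on A. norm (f x) \<le> B" "AE x in lebesgue_on A. norm (g x) \<le> C"
    using assms by (metis LinfE)
  show ?thesis
  proof (rule LinfI[of _ _ "B + C"])
    show "AE x in lebesgue_on A. norm (f x + g x) \<le> B + C"
      using * by eventually_elim (rule norm_triangle_mono)
  qed (intro borel_measurable_add Linf_measurable assms)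
qed

lemma Linf_scaleR:
  assumes "f \<in> Linf A" "g \<in> Linf A"
  shows "(\<lambda>x. f x *\<^sub>R g x) \<in> Linf A"
proof -
  obtain B C where *: "B \<ge> 0" "AE x in lebesgue_on A. norm (f x) \<le> B"
     "C \<ge> 0" "AE x in lebesgue_on A. norm (g x) \<le> C"
    using assms by (metis LinfE)
  show ?thesis
  proof (rule LinfI[of _ _ "B * C"])
    show "AE x in lebesgue_on A. norm (f x *\<^sub>R g x) \<le> B * C"
      using *(2,4) by eventually_elim (use * in \<open>auto intro!: mult_mono\<close>)
  qed (intro borel_measurable_scaleR Linf_measurable assms)
qed

lemma Linf_mult:
  fixes f g :: "'a::euclidean_space \<Rightarrow> real"
  shows "f \<in> Linf A \<Longrightarrow> g \<in> Linf A \<Longrightarrow> (\<lambda>x. f x * g x) \<in> Linf A"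
  using Linf_scaleR[of f A g] by simp

lemma Linf_inner:
  assumes "f \<in> Linf A" "g \<in> Linf A"
  shows "(\<lambda>x. f x \<bullet> g x) \<in> Linf A"
proof -
  obtain B C where *: "B \<ge> 0" "AE x in lebesgue_on A. norm (f x) \<le> B"
     "C \<ge> 0" "AE x in lebesgue_on A. norm (g x) \<le> C"
    using assms by (metis LinfE)
  show ?thesis
  proof (rule LinfI[of _ _ "B * C"])
    show "AE x in lebesgue_on A. norm (f x \<bullet> g x) \<le> B * C"
      using *(2,4)
    proof eventually_elim
      case (elim x)
      have "\<bar>f x \<bullet> g x\<bar> \<le> norm (f x) * norm (g x)" by (rule Cauchy_Schwarz_ineq2)
      also have "\<dots> \<le> B * C" using elim * by (intro mult_mono) auto
      finally show ?case by simp
    qed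
  qed (intro borel_measurable_inner Linf_measurable assms)
qed

lemma Linf_cmult:
  fixes f :: "'a::euclidean_space \<Rightarrow> real"
  shows "f \<in> Linf A \<Longrightarrow> (\<lambda>x. c * f x) \<in> Linf A"
  using Linf_mult[OF Linf_const[of c]] .

lemma Linf_diff:
  assumes "f \<in> Linf A" "g \<in> Linf A"
  shows "(\<lambda>x. f x - g x) \<in> Linf A"
  using Linf_add[OF assms(1) Linf_scaleR[OF Linf_const[of "-1"] assms(2)]] by simp

lemma Linf_powr:
  fixes f :: "'a::euclidean_space \<Rightarrow> real"
  assumes "f \<in> Linf A" "AE x in lebesgue_on A. 0 < f x" "p \<ge> 0"
  shows "(\<lambda>x. f x powr p) \<in> Linf A"
proof -
  obtain B where *: "B \<ge> 0" "AE x in lebesgue_on A. norm (f x) \<le> B"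
    using assms by (metis LinfE)
  show ?thesis
  proof (rule LinfI[of _ _ "B powr p"])
    show "AE x in lebesgue_on A. norm (f x powr p) \<le> B powr p"
      using *(2) assms(2) by eventually_elim (use assms(3) in \<open>auto intro!: powr_mono2\<close>)
  qed (use Linf_measurable[OF assms(1)] in measurable)
qed

lemma integrable_Linf_mult:
  fixes f g :: "'a::euclidean_space \<Rightarrow> real"
  assumes "f \<in> Linf A" "integrable (lebesgue_on A) g"
  shows "integrable (lebesgue_on A) (\<lambda>x. f x * g x)"
proof -
  obtain B where B: "B \<ge> 0" "AE x in lebesgue_on A. norm (f x) \<le> B"
    using assms by (metis LinfE)
  show ?thesis
  proof (rule Bochner_Integration.integrable_bound)
    show "integrable (lebesgue_on A) (\<lambda>x. B * g x)" using assms(2) by simp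
    show "AE x in lebesgue_on A. norm (f x * g x) \<le> norm (B * g x)"
      using B(2) by eventually_elim (use B in \<open>auto simp: abs_mult intro!: mult_right_mono\<close>)
    show "(\<lambda>x. f x * g x) \<in> borel_measurable (lebesgue_on A)"
      using Linf_measurable[OF assms(1)] assms(2) by measurable
  qed
qed

lemma integrable_Linf_inner:
  fixes f g :: "'a::euclidean_space \<Rightarrow> 'b::euclidean_space"
  assumes "f \<in> Linf A" "integrable (lebesgue_on A) g"
  shows "integrable (lebesgue_on A) (\<lambda>x. f x \<bullet> g x)"
proof -
  obtain B where B: "B \<ge> 0" "AE x in lebesgue_on A. norm (f x) \<le> B"
    using assms by (metis LinfE)
  show ?thesis
  proof (rule Bochner_Integration.integrable_bound)
    show "integrable (lebesgue_on A) (\<lambda>x. B * norm (g x))" using assms(2) by simp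
    show "AE x in lebesgue_on A. norm (f x \<bullet> g x) \<le> norm (B * norm (g x))"
      using B(2)
    proof eventually_elim
      case (elim x)
      have "\<bar>f x \<bullet> g x\<bar> \<le> norm (f x) * norm (g x)" by (rule Cauchy_Schwarz_ineq2)
      also have "\<dots> \<le> B * norm (g x)" using elim by (intro mult_right_mono) auto
      finally show ?case using B by simp
    qed
    show "(\<lambda>x. f x \<bullet> g x) \<in> borel_measurable (lebesgue_on A)"
      using Linf_measurable[OF assms(1)] assms(2) by measurable
  qed
qed

section \<open>Continuously differentiable test functions\<close>

text \<open>
  Differentiability at time \<open>0\<close> is two-sided, so the test functions are differentiated on an open set of times
  that contains the initial one. It excludes \<open>-1\<close> because \<open>log (1 + t)\<close> occurs below.
\<close>

definition time_domain :: "spacetime set" where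
  "time_domain = {z. fst z > -1/2}"

text \<open>
  \<open>g\<close> and \<open>G\<close> are the time derivative and the spatial gradient of \<open>\<phi>\<close>. Carrying them as explicit
  continuous functions avoids the almost everywhere derivatives of general Lipschitz functions.
\<close>

definition C1_test :: "real \<Rightarrow> (spacetime \<Rightarrow> real) \<Rightarrow> (spacetime \<Rightarrow> real) \<Rightarrow> (spacetime \<Rightarrow> space) \<Rightarrow> bool" where
  "C1_test T \<phi> g G \<longleftrightarrow>
     (\<forall>z\<in>time_domain. (\<phi> has_derivative (\<lambda>h. g z * fst h + G z \<bullet> snd h)) (at z)) \<and>
     continuous_on time_domain g \<and> continuous_on time_domain G \<and>
     (\<exists>S<T. \<exists>R. \<forall>z\<in>time_domain. \<phi> z \<noteq> 0 \<longrightarrow> fst z \<le> S \<and> norm (snd z) \<le> R)"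

lemma open_time_domain: "open time_domain"
  unfolding time_domain_def by (intro open_Collect_less continuous_intros)

lemma slab_subset_time_domain: "slab T \<subseteq> time_domain"
  by (auto simp: time_domain_def slab_def)

context
  fixes T \<phi> g G
  assumes test: "C1_test T \<phi> g G"
begin

lemma C1_test_has_derivative:
  "z \<in> time_domain \<Longrightarrow> (\<phi> has_derivative (\<lambda>h. g z * fst h + G z \<bullet> snd h)) (at z)"
  using test by (auto simp: C1_test_def)

lemma C1_test_continuous: "continuous_on time_domain g" "continuous_on time_domain G"
  using test by (auto simp: C1_test_def)

lemma C1_test_continuous_self: "continuous_on time_domain \<phi>"
  by (rule has_derivative_continuous_on) (use C1_test_has_derivative has_derivative_at_withinI in blast)

lemma C1_test_support:
  obtains S R where "S < T" "R \<ge> 0"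
    "\<And>z. z \<in> time_domain \<Longrightarrow> S < fst z \<or> R < norm (snd z) \<Longrightarrow> \<phi> z = 0 \<and> g z = 0 \<and> G z = 0"
proof -
  obtain S R where SR: "S < T" "\<And>z. z \<in> time_domain \<Longrightarrow> \<phi> z \<noteq> 0 \<Longrightarrow> fst z \<le> S \<and> norm (snd z) \<le> R"
    using test unfolding C1_test_def by blast
  show ?thesis
  proof (rule that[OF SR(1), of "max R 0"])
    fix z assume z: "z \<in> time_domain" "S < fst z \<or> max R 0 < norm (snd z)"
    let ?U = "time_domain \<inter> ({y. S < fst y} \<union> {y. R < norm (snd y)})"
    have "open ?U"
      by (intro open_Int open_Un open_time_domain open_Collect_less continuous_intros)
    moreover have "z \<in> ?U" using z by auto
    moreover have "\<phi> y = 0" if "y \<in> ?U" for y using SR(2)[of y] that by force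
    ultimately have "(\<phi> has_derivative (\<lambda>_. 0)) (at z)"
      by (intro has_derivative_transform_within_open[OF has_derivative_const[of 0]]) auto
    from has_derivative_unique[OF C1_test_has_derivative[OF z(1)] this]
    have eq: "g z * fst h + G z \<bullet> snd h = 0" for h :: spacetime by meson
    show "\<phi> z = 0 \<and> g z = 0 \<and> G z = 0"
      using eq[of "(1, 0)"] eq[of "(0, G z)"] \<open>z \<in> ?U\<close> \<open>\<And>y. y \<in> ?U \<Longrightarrow> \<phi> y = 0\<close> by simp
  qed simp
qed

lemma C1_test_bounded:
  obtains B where "B \<ge> 0" "\<And>z. z \<in> slab T \<Longrightarrow> \<bar>\<phi> z\<bar> \<le> B \<and> \<bar>g z\<bar> \<le> B \<and> norm (G z) \<le> B"
proof -
  obtain S R where SR: "S < T" "R \<ge> 0"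
    "\<And>z. z \<in> time_domain \<Longrightarrow> S < fst z \<or> R < norm (snd z) \<Longrightarrow> \<phi> z = 0 \<and> g z = 0 \<and> G z = 0"
    using C1_test_support by blast
  let ?K = "{0..S} \<times> cball (0::space) R"
  have K: "compact ?K" "?K \<subseteq> time_domain"
    by (auto intro!: compact_Times simp: time_domain_def)
  have "compact (\<phi> ` ?K)" "compact (g ` ?K)" "compact (G ` ?K)"
    using K C1_test_continuous C1_test_continuous_self
    by (auto intro!: compact_continuous_image intro: continuous_on_subset)
  then have "bounded (\<phi> ` ?K)" "bounded (g ` ?K)" "bounded (G ` ?K)"
    by (auto intro: compact_imp_bounded)
  then obtain B1 B2 B3 where B: "\<And>z. z \<in> ?K \<Longrightarrow> norm (\<phi> z) \<le> B1" "\<And>z. z \<in> ?K \<Longrightarrow> norm (g z) \<le> B2"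
     "\<And>z. z \<in> ?K \<Longrightarrow> norm (G z) \<le> B3"
    unfolding bounded_iff by (metis imageI)
  show ?thesis
  proof (rule that[of "max 0 (max B1 (max B2 B3))"])
    fix z assume z: "z \<in> slab T"
    show "\<bar>\<phi> z\<bar> \<le> max 0 (max B1 (max B2 B3)) \<and> \<bar>g z\<bar> \<le> max 0 (max B1 (max B2 B3))
       \<and> norm (G z) \<le> max 0 (max B1 (max B2 B3))"
    proof (cases "z \<in> ?K")
      case True
      then show ?thesis using B[OF True] by auto
    next
      case False
      then have "S < fst z \<or> R < norm (snd z)" using z by (cases z) (auto simp: not_le)
      moreover have "z \<in> time_domain" using z slab_subset_time_domain by blast
      ultimately have "\<phi> z = 0 \<and> g z = 0 \<and> G z = 0" by (intro SR(3))
      then show ?thesis by simp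
    qed
  qed simp
qed

lemma C1_test_test_function: "\<phi> \<in> test_functions T"
proof -
  obtain B where B: "B \<ge> 0" "\<And>z. z \<in> slab T \<Longrightarrow> \<bar>\<phi> z\<bar> \<le> B \<and> \<bar>g z\<bar> \<le> B \<and> norm (G z) \<le> B"
    using C1_test_bounded by blast
  obtain S R where SR: "S < T" "R \<ge> 0"
    "\<And>z. z \<in> time_domain \<Longrightarrow> S < fst z \<or> R < norm (snd z) \<Longrightarrow> \<phi> z = 0 \<and> g z = 0 \<and> G z = 0"
    using C1_test_support by blast
  have "(2 * B)-lipschitz_on (slab T) \<phi>"
  proof (rule bounded_derivative_imp_lipschitz[OF _ convex_slab])
    fix z assume z: "z \<in> slab T"
    then show "(\<phi> has_derivative (\<lambda>h. g z * fst h + G z \<bullet> snd h)) (at z within slab T)"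
      using C1_test_has_derivative slab_subset_time_domain has_derivative_at_withinI by blast
    show "onorm (\<lambda>h. g z * fst h + G z \<bullet> snd h) \<le> 2 * B"
    proof (rule onorm_le)
      fix h :: spacetime
      have "norm (g z * fst h + G z \<bullet> snd h) \<le> norm (g z * fst h) + norm (G z \<bullet> snd h)"
        by (rule norm_triangle_ineq)
      also have "norm (g z * fst h) \<le> B * norm h"
        unfolding norm_mult using B z norm_fst_le[of "fst h" "snd h"] by (intro mult_mono) auto
      also have "norm (G z \<bullet> snd h) \<le> B * norm h"
        using B z norm_snd_le[of "snd h" "fst h"]
        by (intro order_trans[OF Cauchy_Schwarz_ineq2[of "G z" "snd h", folded real_norm_def]] mult_mono) auto
      finally show "norm (g z * fst h + G z \<bullet> snd h) \<le> 2 * B * norm h" by simp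
    qed
  qed (use B in auto)
  moreover have sub: "closure {z \<in> slab T. \<phi> z \<noteq> 0} \<subseteq> {0..S} \<times> cball 0 R"
  proof (rule closure_minimal)
    show "{z \<in> slab T. \<phi> z \<noteq> 0} \<subseteq> {0..S} \<times> cball 0 R"
    proof
      fix z assume "z \<in> {z \<in> slab T. \<phi> z \<noteq> 0}"
      then show "z \<in> {0..S} \<times> cball 0 R"
        using SR(3)[of z] slab_subset_time_domain[of T] by (cases z) (force simp: not_less)
    qed
    show "closed ({0..S} \<times> cball (0::space) R)" by (intro closed_Times) auto
  qed
  moreover have "compact (closure {z \<in> slab T. \<phi> z \<noteq> 0})"
  proof -
    have "compact ({0..S} \<times> cball (0::space) R)" by (intro compact_Times) auto
    then have "compact ({0..S} \<times> cball (0::space) R \<inter> closure {z \<in> slab T. \<phi> z \<noteq> 0})"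
      by (rule compact_Int_closed) simp
    then show ?thesis using Int_absorb1[OF sub] by simp
  qed
  moreover have "{0..S} \<times> cball (0::space) R \<subseteq> slab T" using SR(1) by (auto simp: slab_def)
  ultimately show ?thesis unfolding test_functions_def by blast
qed

lemma C1_test_dt: "z \<in> time_domain \<Longrightarrow> dt \<phi> z = g z"
proof -
  assume z: "z \<in> time_domain"
  have "((\<lambda>s. (s, snd z)) has_derivative (\<lambda>h. (h, 0))) (at (fst z))"
    by (auto intro!: derivative_eq_intros)
  from has_derivative_compose[OF this, of \<phi> "\<lambda>h. g z * fst h + G z \<bullet> snd h"]
  have "((\<lambda>s. \<phi> (s, snd z)) has_derivative (\<lambda>h. g z * h)) (at (fst z))"
    using C1_test_has_derivative[OF z] by simp
  then have "((\<lambda>s. \<phi> (s, snd z)) has_real_derivative g z) (at (fst z))"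
    by (simp add: has_field_derivative_def)
  then show ?thesis unfolding dt_def by (rule DERIV_imp_deriv)
qed

lemma C1_test_has_directional_derivative:
  assumes z: "z \<in> time_domain"
  shows "((\<lambda>h. \<phi> (fst z, snd z + h *\<^sub>R w)) has_real_derivative G z \<bullet> w) (at 0)"
proof -
  have "((\<lambda>h. (fst z, snd z + h *\<^sub>R w)) has_derivative (\<lambda>h. (0, h *\<^sub>R w))) (at 0)"
    by (auto intro!: derivative_eq_intros)
  from has_derivative_compose[OF this, of \<phi> "\<lambda>h. g z * fst h + G z \<bullet> snd h"]
  have "((\<lambda>h. \<phi> (fst z, snd z + h *\<^sub>R w)) has_derivative (\<lambda>h. h * (G z \<bullet> w))) (at 0)"
    using C1_test_has_derivative[OF z] by simp
  then show ?thesis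
    by (simp add: has_field_derivative_def mult.commute[of _ "G z \<bullet> w"])
qed

lemma C1_test_dx: "z \<in> time_domain \<Longrightarrow> dx j \<phi> z = G z $ j"
  unfolding dx_def using DERIV_imp_deriv[OF C1_test_has_directional_derivative[of z "axis j 1"]]
  by (simp add: inner_axis)

lemma C1_test_grad: "z \<in> time_domain \<Longrightarrow> grad \<phi> z = G z"
  by (simp add: grad_def C1_test_dx vec_eq_iff)

lemma C1_test_integrable:
  "integrable (lebesgue_on (slab T)) \<phi>" "integrable (lebesgue_on (slab T)) g"
  "integrable (lebesgue_on (slab T)) G"
proof -
  obtain B where B: "B \<ge> 0" "\<And>z. z \<in> slab T \<Longrightarrow> \<bar>\<phi> z\<bar> \<le> B \<and> \<bar>g z\<bar> \<le> B \<and> norm (G z) \<le> B"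
    using C1_test_bounded by blast
  obtain S R where SR: "S < T" "R \<ge> 0"
    "\<And>z. z \<in> time_domain \<Longrightarrow> S < fst z \<or> R < norm (snd z) \<Longrightarrow> \<phi> z = 0 \<and> g z = 0 \<and> G z = 0"
    using C1_test_support by blast
  let ?K = "{0..S} \<times> cball (0::space) R"
  have K: "compact ?K" by (intro compact_Times) auto
  then have Kl: "?K \<in> lmeasurable" by (rule lmeasurable_compact)
  have "?K \<inter> slab T \<in> lmeasurable" by (rule fmeasurable_Int_fmeasurable[OF Kl]) simp
  then have "integrable (lebesgue_on (slab T)) (indicat_real ?K)"
    by (subst integrable_restrict_space)
       (auto simp: indicator_inter_arith[symmetric] Int_commute mult.commute fmeasurable_def)
  then have I: "integrable (lebesgue_on (slab T)) (\<lambda>z. B * indicat_real ?K z)" by simp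
  have le: "norm (\<phi> z) \<le> norm (B * indicat_real ?K z) \<and> norm (g z) \<le> norm (B * indicat_real ?K z)
      \<and> norm (G z) \<le> norm (B * indicat_real ?K z)" if z: "z \<in> slab T" for z
  proof (cases "z \<in> ?K")
    case True
    then show ?thesis using B z by auto
  next
    case False
    then have "S < fst z \<or> R < norm (snd z)" using z by (cases z) (auto simp: not_le)
    moreover have "z \<in> time_domain" using z slab_subset_time_domain by blast
    ultimately have "\<phi> z = 0 \<and> g z = 0 \<and> G z = 0" by (intro SR(3))
    then show ?thesis by simp
  qed
  have meas: "\<phi> \<in> borel_measurable (lebesgue_on (slab T))" "g \<in> borel_measurable (lebesgue_on (slab T))"
      "G \<in> borel_measurable (lebesgue_on (slab T))"
    using C1_test_continuous C1_test_continuous_self slab_subset_time_domain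
    by (auto intro!: continuous_imp_measurable_on_sets_lebesgue intro: continuous_on_subset)
  show "integrable (lebesgue_on (slab T)) \<phi>"
    by (rule Bochner_Integration.integrable_bound[OF I meas(1)]) (use le in \<open>auto intro!: AE_I2\<close>)
  show "integrable (lebesgue_on (slab T)) g"
    by (rule Bochner_Integration.integrable_bound[OF I meas(2)]) (use le in \<open>auto intro!: AE_I2\<close>)
  show "integrable (lebesgue_on (slab T)) G"
    by (rule Bochner_Integration.integrable_bound[OF I meas(3)]) (use le in \<open>auto intro!: AE_I2\<close>)
qed

end

lemma lborel_integral_translation:
  fixes f :: "'a::euclidean_space \<Rightarrow> 'b::{banach, second_countable_topology}"
  assumes [measurable]: "f \<in> borel_measurable borel"
  shows "(LINT x|lborel. f (c + x)) = (LINT x|lborel. f x)"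
proof -
  have "(LINT x|lborel. f x) = (LINT x|distr lborel borel ((+) c). f x)"
    by (simp add: lborel_distr_plus)
  also have "\<dots> = (LINT x|lborel. f (c + x))"
    by (rule integral_distr) auto
  finally show ?thesis ..
qed

lemma lebesgue_integral_eq_lborel:
  fixes f :: "'a::euclidean_space \<Rightarrow> 'b::{banach, second_countable_topology}"
  assumes "A \<in> sets borel" "(\<lambda>x. indicator A x *\<^sub>R f x) \<in> borel_measurable borel"
  shows "(LINT x|lebesgue_on A. f x) = (LINT x|lborel. indicator A x *\<^sub>R f x)"
    and "integrable (lebesgue_on A) f \<longleftrightarrow> integrable lborel (\<lambda>x. indicator A x *\<^sub>R f x)"
proof -
  have A: "A \<in> sets lebesgue" using assms(1) by simp
  show "(LINT x|lebesgue_on A. f x) = (LINT x|lborel. indicator A x *\<^sub>R f x)"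
    using A assms by (simp add: integral_restrict_space integral_completion)
  show "integrable (lebesgue_on A) f \<longleftrightarrow> integrable lborel (\<lambda>x. indicator A x *\<^sub>R f x)"
    using A assms by (simp add: integrable_restrict_space integrable_completion)
qed

context
  fixes T \<phi> g G
  assumes test: "C1_test T \<phi> g G" and T: "0 < T"
begin

lemma C1_test_initial_continuous: "continuous_on UNIV (\<lambda>x. \<phi> (0, x))"
proof -
  have "continuous_on UNIV (\<phi> \<circ> Pair 0)"
    by (intro continuous_on_compose continuous_intros
        continuous_on_subset[OF C1_test_continuous_self[OF test]]) (auto simp: time_domain_def)
  then show ?thesis by (simp add: comp_def)
qed

lemma C1_test_initial_integrable: "integrable lebesgue (\<lambda>x. \<phi> (0, x))"
proof -
  obtain S R where SR: "S < T" "R \<ge> 0"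
    "\<And>z. z \<in> time_domain \<Longrightarrow> S < fst z \<or> R < norm (snd z) \<Longrightarrow> \<phi> z = 0 \<and> g z = 0 \<and> G z = 0"
    using C1_test_support[OF test] by blast
  have "integrable lborel (\<lambda>x. indicator (cball 0 R) x *\<^sub>R \<phi> (0, x))"
    using C1_test_initial_continuous
    by (intro borel_integrable_compact) (auto intro: continuous_on_subset)
  moreover have "indicator (cball 0 R) x *\<^sub>R \<phi> (0, x) = \<phi> (0, x)" for x
    using SR(3)[of "(0, x)"] by (auto simp: time_domain_def indicator_def)
  ultimately have "integrable lborel (\<lambda>x. \<phi> (0, x))" by (simp only:)
  then show ?thesis by (subst integrable_completion) auto
qed

text \<open>
  The state with density \<open>1\<close> and velocity \<open>0\<close> satisfies the mass equation.
\<close>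

lemma C1_test_time_integral:
  "(LINT z|lebesgue_on (slab T). g z) = - (LINT x|lebesgue. \<phi> (0, x))"
proof -
  obtain S R where SR: "S < T" "R \<ge> 0"
    "\<And>z. z \<in> time_domain \<Longrightarrow> S < fst z \<or> R < norm (snd z) \<Longrightarrow> \<phi> z = 0 \<and> g z = 0 \<and> G z = 0"
    using C1_test_support[OF test] by blast
  define k where "k z = indicat_real (slab T) z *\<^sub>R g z" for z
  have kb [measurable]: "k \<in> borel_measurable borel"
    unfolding k_def using C1_test_continuous[OF test] slab_subset_time_domain
    by (intro borel_measurable_continuous_on_indicator) (auto intro: continuous_on_subset)
  have "(LINT z|lebesgue_on (slab T). g z) = (LINT z|lborel. k z)"
    unfolding k_def by (rule lebesgue_integral_eq_lborel) (use kb in \<open>simp_all add: k_def[abs_def]\<close>)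
  also have "\<dots> = integral\<^sup>L (lborel \<Otimes>\<^sub>M lborel) (\<lambda>(t, x). k (t, x))"
    by (simp add: lborel_prod)
  also have "\<dots> = (LINT x|lborel. (LINT t|lborel. k (t, x)))"
  proof (rule lborel_pair.integral_snd[symmetric])
    have "integrable lborel k"
      using C1_test_integrable(2)[OF test] kb
      by (subst (asm) lebesgue_integral_eq_lborel(2)) (simp_all add: k_def[abs_def])
    then show "integrable (lborel \<Otimes>\<^sub>M lborel) (\<lambda>(t, x). k (t, x))" by (simp add: lborel_prod)
  qed
  also have "(\<lambda>x. (LINT t|lborel. k (t, x))) = (\<lambda>x. - \<phi> (0, x))"
  proof
    fix x
    have td: "(t, x) \<in> time_domain" if "0 \<le> t" for t using that by (simp add: time_domain_def)
    have "(LINT t|lborel. indicator {0..T} t *\<^sub>R g (t, x)) = \<phi> (T, x) - \<phi> (0, x)"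
    proof (rule integral_FTC_Icc)
      fix t assume t: "0 \<le> t" "t \<le> T"
      have "((\<lambda>s. (s, x)) has_derivative (\<lambda>h. (h, 0))) (at t)"
        by (auto intro!: derivative_eq_intros)
      from has_derivative_compose[OF this, of \<phi> "\<lambda>h. g (t, x) * fst h + G (t, x) \<bullet> snd h"]
      have "((\<lambda>s. \<phi> (s, x)) has_derivative (\<lambda>h. g (t, x) * h)) (at t)"
        using C1_test_has_derivative[OF test td[OF t(1)]] by simp
      then show "((\<lambda>s. \<phi> (s, x)) has_vector_derivative g (t, x)) (at t within {0..T})"
        by (simp add: has_vector_derivative_def mult.commute has_derivative_at_withinI)
    next
      have "continuous_on {0..T} (g \<circ> (\<lambda>t. (t, x)))"
        by (intro continuous_on_compose continuous_intros
            continuous_on_subset[OF C1_test_continuous(1)[OF test]]) (use td in auto)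
      then show "continuous_on {0..T} (\<lambda>t. g (t, x))" by (simp add: comp_def)
    qed (use T in simp)
    moreover have "indicator {0..T} t *\<^sub>R g (t, x) = k (t, x)" for t
      using SR(3)[of "(T, x)"] SR(1) td[of T] T by (auto simp: k_def indicator_def)
    ultimately show "(LINT t|lborel. k (t, x)) = - \<phi> (0, x)"
      using SR(3)[of "(T, x)"] SR(1) td[of T] T by simp
  qed
  also have "(LINT x|lborel. - \<phi> (0, x)) = - (LINT x|lebesgue. \<phi> (0, x))"
    by (simp add: integral_completion borel_measurable_continuous_onI[OF C1_test_initial_continuous])
  finally show ?thesis .
qed

text \<open>
  The constant pressure of the background exerts no net force. Difference quotients in the direction \<open>w\<close> integrate to zero by translation
  invariance, and they converge dominatedly because \<open>\<phi>\<close> is Lipschitz.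
\<close>

lemma C1_test_space_integral: "(LINT z|lebesgue_on (slab T). G z \<bullet> w) = 0"
proof -
  obtain S R where SR: "S < T" "R \<ge> 0"
    "\<And>z. z \<in> time_domain \<Longrightarrow> S < fst z \<or> R < norm (snd z) \<Longrightarrow> \<phi> z = 0 \<and> g z = 0 \<and> G z = 0"
    using C1_test_support[OF test] by blast
  obtain L where L: "L-lipschitz_on (slab T) \<phi>"
    using C1_test_test_function[OF test] by (auto simp: test_functions_def)
  have L0: "L \<ge> 0" using L by (rule lipschitz_on_nonneg)
  define f where "f z = indicat_real (slab T) z *\<^sub>R \<phi> z" for z
  have fb [measurable]: "f \<in> borel_measurable borel"
    unfolding f_def using C1_test_continuous_self[OF test] slab_subset_time_domain
    by (intro borel_measurable_continuous_on_indicator) (auto intro: continuous_on_subset)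
  have fi: "integrable lborel f"
    using C1_test_integrable(1)[OF test] fb
    by (subst (asm) lebesgue_integral_eq_lborel(2)) (simp_all add: f_def[abs_def])
  define k where "k z = indicat_real (slab T) z *\<^sub>R (G z \<bullet> w)" for z
  have kb: "k \<in> borel_measurable borel"
    unfolding k_def using C1_test_continuous[OF test] slab_subset_time_domain
    by (intro borel_measurable_continuous_on_indicator continuous_intros) (auto intro: continuous_on_subset)
  define q where "q n z = real (Suc n) * (f ((0, inverse (real (Suc n)) *\<^sub>R w) + z) - f z)" for n z
  have qb [measurable]: "q n \<in> borel_measurable borel" for n unfolding q_def by measurable
  have q0: "(LINT z|lborel. q n z) = 0" for n
  proof -
    let ?c = "(0, inverse (real (Suc n)) *\<^sub>R w) :: spacetime"
    have "integrable lborel (\<lambda>z. f (?c + z))"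
    proof -
      have "integrable (distr lborel borel ((+) ?c)) f" using fi by (simp add: lborel_distr_plus)
      then show ?thesis by (subst (asm) integrable_distr_eq) auto
    qed
    then show ?thesis unfolding q_def using fi
      by (simp add: lborel_integral_translation[OF fb])
  qed
  let ?K = "{0..S} \<times> cball (0::space) (R + norm w)"
  have Kc: "compact ?K" by (intro compact_Times) auto
  have "(\<lambda>n. LINT z|lborel. q n z) \<longlonglongrightarrow> (LINT z|lborel. k z)"
  proof (rule integral_dominated_convergence)
    show "k \<in> borel_measurable lborel" "\<And>n. q n \<in> borel_measurable lborel" using kb qb by simp_all
    show "integrable lborel (\<lambda>z. L * norm w * indicat_real ?K z)"
      using Kc by (intro integrable_mult_right integrable_real_indicator)
        (simp_all add: emeasure_compact_finite[OF Kc, simplified] borel_compact[OF Kc])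
    show "AE z in lborel. (\<lambda>n. q n z) \<longlonglongrightarrow> k z"
    proof (rule AE_I2)
      fix z :: spacetime
      show "(\<lambda>n. q n z) \<longlonglongrightarrow> k z"
      proof (cases "z \<in> slab T")
        case True
        then have "z \<in> time_domain" using slab_subset_time_domain by blast
        from C1_test_has_directional_derivative[OF test this, of w]
        have "(\<lambda>h. (\<phi> (fst z, snd z + h *\<^sub>R w) - \<phi> z) / h) \<midarrow>0\<rightarrow> G z \<bullet> w"
          by (simp add: DERIV_def)
        moreover have "filterlim (\<lambda>n. inverse (real (Suc n))) (at 0) sequentially"
          using LIMSEQ_inverse_real_of_nat by (simp add: filterlim_at)
        ultimately have "(\<lambda>n. (\<phi> (fst z, snd z + inverse (real (Suc n)) *\<^sub>R w) - \<phi> z) / inverse (real (Suc n)))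
            \<longlonglongrightarrow> G z \<bullet> w"
          by (rule filterlim_compose)
        moreover have "(\<phi> (fst z, snd z + inverse (real (Suc n)) *\<^sub>R w) - \<phi> z) / inverse (real (Suc n)) = q n z" for n
        proof -
          have "(0, inverse (real (Suc n)) *\<^sub>R w) + z = (fst z, snd z + inverse (real (Suc n)) *\<^sub>R w)"
            by (cases z) (simp add: add.commute)
          moreover have "(fst z, snd z + inverse (real (Suc n)) *\<^sub>R w) \<in> slab T"
            using True by (simp add: mem_slab_iff)
          ultimately show ?thesis using True by (simp add: q_def f_def divide_inverse mult.commute)
        qed
        ultimately show ?thesis using True by (simp add: k_def)
      next
        case False
        then have "(0, h) + z \<notin> slab T" for h by (cases z) auto
        then show ?thesis using False by (simp add: q_def f_def k_def)
      qed
    qed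
    fix n
    show "AE z in lborel. norm (q n z) \<le> L * norm w * indicat_real ?K z"
    proof (rule AE_I2)
      fix z :: spacetime
      let ?c = "(0, inverse (real (Suc n)) *\<^sub>R w) :: spacetime"
      have nc: "norm ?c = inverse (real (Suc n)) * norm w" by (simp add: norm_Pair)
      have "norm (inverse (real (Suc n)) *\<^sub>R w) \<le> norm w"
        by (simp add: divide_simps distrib_left)
      note nw = this
      show "norm (q n z) \<le> L * norm w * indicat_real ?K z"
      proof (cases "z \<in> slab T")
        case True
        then have cz: "?c + z \<in> slab T" by (cases z) simp
        show ?thesis
        proof (cases "z \<in> ?K")
          case T': True
          have "\<bar>\<phi> (?c + z) - \<phi> z\<bar> \<le> L * norm ?c"
            using lipschitz_onD[OF L cz True] by (simp add: dist_norm)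
          then have "norm (q n z) \<le> real (Suc n) * (L * norm ?c)"
            using True cz by (simp add: q_def f_def abs_mult mult_left_mono)
          also have "\<dots> = L * norm w" unfolding nc by simp
          finally show ?thesis using T' by simp
        next
          case F: False
          have zt: "z \<in> time_domain" "?c + z \<in> time_domain"
            using True cz slab_subset_time_domain by blast+
          from F True have "S < fst z \<or> R + norm w < norm (snd z)" by (cases z) (auto simp: not_le)
          moreover have "norm (snd z) \<le> norm (snd (?c + z)) + norm w"
          proof -
            have "snd z = snd (?c + z) - inverse (real (Suc n)) *\<^sub>R w" by simp
            then have "norm (snd z) \<le> norm (snd (?c + z)) + norm (inverse (real (Suc n)) *\<^sub>R w)"
              by (metis norm_triangle_ineq4)
            then show ?thesis using nw by linarith
          qed
          ultimately have "S < fst z \<or> R < norm (snd z)" "S < fst (?c + z) \<or> R < norm (snd (?c + z))"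
            using norm_ge_zero[of w] by (auto simp del: snd_add norm_ge_zero)
          then have "\<phi> z = 0" "\<phi> (?c + z) = 0" using SR(3) zt by blast+
          then show ?thesis using L0 by (simp add: q_def f_def)
        qed
      next
        case False
        then have "?c + z \<notin> slab T" by (cases z) auto
        then show ?thesis using False L0 by (simp add: q_def f_def)
      qed
    qed
  qed
  then have "(LINT z|lborel. k z) = 0" using q0 by (simp add: LIMSEQ_const_iff)
  moreover have "(LINT z|lebesgue_on (slab T). G z \<bullet> w) = (LINT z|lborel. k z)"
    unfolding k_def by (rule lebesgue_integral_eq_lborel) (use kb in \<open>simp_all add: k_def[abs_def]\<close>)
  ultimately show ?thesis by simp
qed

end

section \<open>Balance laws relative to the constant state\<close>

lemma C1_test_cmult:
  assumes "C1_test T \<phi> g G"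
  shows "C1_test T (\<lambda>z. c * \<phi> z) (\<lambda>z. c * g z) (\<lambda>z. c *\<^sub>R G z)"
  unfolding C1_test_def
proof (intro conjI ballI)
  fix z assume "z \<in> time_domain"
  from has_derivative_mult_right[OF C1_test_has_derivative[OF assms this], of c]
  show "((\<lambda>z. c * \<phi> z) has_derivative (\<lambda>h. c * g z * fst h + (c *\<^sub>R G z) \<bullet> snd h)) (at z)"
    by (simp add: algebra_simps)
next
  show "continuous_on time_domain (\<lambda>z. c * g z)" "continuous_on time_domain (\<lambda>z. c *\<^sub>R G z)"
    by (intro continuous_intros C1_test_continuous[OF assms])+
next
  obtain S R where "S < T" "\<And>z. z \<in> time_domain \<Longrightarrow> \<phi> z \<noteq> 0 \<Longrightarrow> fst z \<le> S \<and> norm (snd z) \<le> R"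
    using assms unfolding C1_test_def by blast
  then show "\<exists>S<T. \<exists>R. \<forall>z\<in>time_domain. c * \<phi> z \<noteq> 0 \<longrightarrow> fst z \<le> S \<and> norm (snd z) \<le> R"
    by (metis mult_zero_right)
qed

lemma C1_test_scaleR_test_function:
  fixes w :: space
  assumes "C1_test T \<phi> g G" "w \<noteq> 0"
  shows "(\<lambda>z. \<phi> z *\<^sub>R w) \<in> test_functions T"
proof -
  have \<phi>: "\<phi> \<in> test_functions T" by (rule C1_test_test_function[OF assms(1)])
  then obtain L where L: "L-lipschitz_on (slab T) \<phi>" by (auto simp: test_functions_def)
  have "(L * norm w)-lipschitz_on (slab T) (\<lambda>z. \<phi> z *\<^sub>R w)"
  proof (rule lipschitz_onI)
    fix y z assume "y \<in> slab T" "z \<in> slab T"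
    then have "\<bar>\<phi> y - \<phi> z\<bar> \<le> L * dist y z" using lipschitz_onD[OF L] by (simp add: dist_real_def)
    then have "\<bar>\<phi> y - \<phi> z\<bar> * norm w \<le> L * dist y z * norm w" by (intro mult_right_mono) auto
    then show "dist (\<phi> y *\<^sub>R w) (\<phi> z *\<^sub>R w) \<le> L * norm w * dist y z"
      by (simp add: dist_norm scaleR_left_diff_distrib[symmetric] mult_ac)
  qed (use lipschitz_on_nonneg[OF L] in simp)
  then show ?thesis using \<phi> assms(2) by (auto simp: test_functions_def)
qed

lemma tensor_inner_outer: "tensor a a \<bullet> (\<chi> i j. w $ i * G $ j) = (w \<bullet> a) * (a \<bullet> G)"
  by (simp add: tensor_def inner_vec_def sum_distrib_left sum_distrib_right sum_product mult_ac)

lemma weak_solution_Linf: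
  assumes "weak_solution \<gamma> T \<rho> u \<rho>0 u0"
  shows "\<rho> \<in> Linf (slab T)" "u \<in> Linf (slab T)" "AE z in lebesgue_on (slab T). 0 < \<rho> z"
    "\<rho>0 \<in> Linf UNIV" "u0 \<in> Linf UNIV" "AE x in lebesgue_on UNIV. 0 < \<rho>0 x"
  using assms unfolding weak_solution_def lebesgue_on_UNIV_eq by blast+

context
  fixes \<gamma> T \<rho> u \<rho>0 u0 \<phi> g G
  assumes sol: "weak_solution \<gamma> T \<rho> u \<rho>0 u0" and T: "0 < T" and \<gamma>: "1 < \<gamma>"
    and test: "C1_test T \<phi> g G"
begin

lemma background_identity:
  "(LINT z|lebesgue_on (slab T). c * g z) + (LINT x|lebesgue. c * \<phi> (0, x)) = 0"
  using C1_test_time_integral[OF test T] by simp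

lemma mass_identity:
  "(LINT z|lebesgue_on (slab T). \<rho> z * g z + (\<rho> z *\<^sub>R u z) \<bullet> G z)
     + (LINT x|lebesgue. \<rho>0 x * \<phi> (0, x)) = 0"
proof -
  have "(LINT z|lebesgue_on (slab T). \<rho> z * dt \<phi> z + (\<rho> z *\<^sub>R u z) \<bullet> grad \<phi> z)
     = (LINT z|lebesgue_on (slab T). \<rho> z * g z + (\<rho> z *\<^sub>R u z) \<bullet> G z)"
    using slab_subset_time_domain[THEN subsetD]
    by (intro Bochner_Integration.integral_cong) (simp_all add: C1_test_dt[OF test] C1_test_grad[OF test])
  moreover have "(LINT z|lebesgue_on (slab T). \<rho> z * dt \<phi> z + (\<rho> z *\<^sub>R u z) \<bullet> grad \<phi> z)
      + (LINT x|lebesgue. \<rho>0 x * \<phi> (0, x)) = 0"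
    using sol C1_test_test_function[OF test] unfolding weak_solution_def by blast
  ultimately show ?thesis by (simp only:)
qed

lemma momentum_identity:
  assumes w: "norm w = 1"
  shows "(LINT z|lebesgue_on (slab T). \<rho> z * (w \<bullet> u z) * g z + \<rho> z * ((w \<bullet> u z) * (u z \<bullet> G z))
       + 1 / \<gamma> * \<rho> z powr \<gamma> * (G z \<bullet> w))
     + (LINT x|lebesgue. w \<bullet> (\<rho>0 x *\<^sub>R u0 x) * \<phi> (0, x)) = 0"
proof -
  let ?\<psi> = "\<lambda>z. \<phi> z *\<^sub>R w"
  have dtv: "dt_vec ?\<psi> z = g z *\<^sub>R w" if "z \<in> time_domain" for z
    using C1_test_dt[OF C1_test_cmult[OF test] that]
    by (simp add: dt_vec_def vec_eq_iff mult.commute[of _ "w $ _"])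
  have jac: "jacobian_x ?\<psi> z = (\<chi> i j. w $ i * G z $ j)" if "z \<in> time_domain" for z
    using C1_test_dx[OF C1_test_cmult[OF test] that]
    by (simp add: jacobian_x_def vec_eq_iff mult.commute[of _ "w $ _"])
  have div: "div_x ?\<psi> z = G z \<bullet> w" if "z \<in> time_domain" for z
    by (simp add: div_x_def jac[OF that] trace_def inner_vec_def mult.commute)
  have "(LINT z|lebesgue_on (slab T).
           (\<rho> z *\<^sub>R u z) \<bullet> dt_vec ?\<psi> z
           + \<rho> z * (tensor (u z) (u z) \<bullet> jacobian_x ?\<psi> z)
           + 1 / \<gamma> * \<rho> z powr \<gamma> * div_x ?\<psi> z)
     = (LINT z|lebesgue_on (slab T). \<rho> z * (w \<bullet> u z) * g z + \<rho> z * ((w \<bullet> u z) * (u z \<bullet> G z))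
       + 1 / \<gamma> * \<rho> z powr \<gamma> * (G z \<bullet> w))"
  proof (rule Bochner_Integration.integral_cong)
    fix z assume "z \<in> space (lebesgue_on (slab T))"
    then have z: "z \<in> time_domain" using slab_subset_time_domain by auto
    show "(\<rho> z *\<^sub>R u z) \<bullet> dt_vec ?\<psi> z
           + \<rho> z * (tensor (u z) (u z) \<bullet> jacobian_x ?\<psi> z)
           + 1 / \<gamma> * \<rho> z powr \<gamma> * div_x ?\<psi> z
      = \<rho> z * (w \<bullet> u z) * g z + \<rho> z * ((w \<bullet> u z) * (u z \<bullet> G z)) + 1 / \<gamma> * \<rho> z powr \<gamma> * (G z \<bullet> w)"
      unfolding dtv[OF z] jac[OF z] div[OF z] tensor_inner_outer
      by (simp add: inner_commute)
  qed simp
  moreover have "(LINT x|lebesgue. (\<rho>0 x *\<^sub>R u0 x) \<bullet> ?\<psi> (0, x))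
      = (LINT x|lebesgue. w \<bullet> (\<rho>0 x *\<^sub>R u0 x) * \<phi> (0, x))"
    by (simp add: inner_commute mult_ac)
  moreover have "(LINT z|lebesgue_on (slab T).
           (\<rho> z *\<^sub>R u z) \<bullet> dt_vec ?\<psi> z
           + \<rho> z * (tensor (u z) (u z) \<bullet> jacobian_x ?\<psi> z)
           + 1 / \<gamma> * \<rho> z powr \<gamma> * div_x ?\<psi> z)
        + (LINT x|lebesgue. (\<rho>0 x *\<^sub>R u0 x) \<bullet> ?\<psi> (0, x)) = 0"
  proof -
    have "w \<noteq> 0" using w by auto
    from C1_test_scaleR_test_function[OF test this] show ?thesis
      using sol unfolding weak_solution_def by blast
  qed
  ultimately show ?thesis by (simp only:)
qed

lemma relative_identity_integrable:
  shows "integrable (lebesgue_on (slab T)) (\<lambda>z.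
       (\<rho> z - 1 + \<rho> z * (w \<bullet> u z)) * g z + (1 + w \<bullet> u z) * ((\<rho> z *\<^sub>R u z) \<bullet> G z)
       + (\<rho> z powr \<gamma> - 1) / \<gamma> * (G z \<bullet> w))"
    and "integrable lebesgue (\<lambda>x. (w \<bullet> (\<rho>0 x *\<^sub>R u0 x) + \<rho>0 x - 1) * \<phi> (0, x))"
proof -
  note L = weak_solution_Linf[OF sol]
  note gG = C1_test_integrable[OF test]
  have wu: "(\<lambda>z. w \<bullet> u z) \<in> Linf (slab T)" by (intro Linf_inner Linf_const L)
  have "(\<lambda>z. \<rho> z - 1 + \<rho> z * (w \<bullet> u z)) \<in> Linf (slab T)"
    by (intro Linf_add Linf_diff Linf_mult Linf_const L wu)
  then have 1: "integrable (lebesgue_on (slab T)) (\<lambda>z. (\<rho> z - 1 + \<rho> z * (w \<bullet> u z)) * g z)"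
    by (rule integrable_Linf_mult) (rule gG)
  have 2: "integrable (lebesgue_on (slab T)) (\<lambda>z. (1 + w \<bullet> u z) * ((\<rho> z *\<^sub>R u z) \<bullet> G z))"
    by (intro integrable_Linf_mult integrable_Linf_inner Linf_add Linf_const Linf_scaleR L wu gG)
  have "(\<lambda>z. (1 / \<gamma>) * (\<rho> z powr \<gamma> - 1)) \<in> Linf (slab T)"
    using \<gamma> by (intro Linf_cmult Linf_diff Linf_powr Linf_const L) auto
  then have "integrable (lebesgue_on (slab T)) (\<lambda>z. (1 / \<gamma>) * (\<rho> z powr \<gamma> - 1) * (G z \<bullet> w))"
    by (rule integrable_Linf_mult) (intro integrable_inner_left gG)
  then show "integrable (lebesgue_on (slab T)) (\<lambda>z.
       (\<rho> z - 1 + \<rho> z * (w \<bullet> u z)) * g z + (1 + w \<bullet> u z) * ((\<rho> z *\<^sub>R u z) \<bullet> G z)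
       + (\<rho> z powr \<gamma> - 1) / \<gamma> * (G z \<bullet> w))"
    using 1 2 by simp
  have "(\<lambda>x. w \<bullet> (\<rho>0 x *\<^sub>R u0 x) + \<rho>0 x - 1) \<in> Linf UNIV"
    by (intro Linf_add Linf_diff Linf_inner Linf_scaleR Linf_const L)
  from integrable_Linf_mult[OF this, of "\<lambda>x. \<phi> (0, x)"]
  show "integrable lebesgue (\<lambda>x. (w \<bullet> (\<rho>0 x *\<^sub>R u0 x) + \<rho>0 x - 1) * \<phi> (0, x))"
    using C1_test_initial_integrable[OF test T] by (simp add: lebesgue_on_UNIV_eq)
qed

text \<open>
  The sum of the mass equation and the \<open>w\<close>-component of the momentum equation, minus the same sum for the constant state.
\<close>

lemma relative_identity:
  assumes w: "norm w = 1"
  shows "(LINT z|lebesgue_on (slab T).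
       (\<rho> z - 1 + \<rho> z * (w \<bullet> u z)) * g z + (1 + w \<bullet> u z) * ((\<rho> z *\<^sub>R u z) \<bullet> G z)
       + (\<rho> z powr \<gamma> - 1) / \<gamma> * (G z \<bullet> w))
     + (LINT x|lebesgue. (w \<bullet> (\<rho>0 x *\<^sub>R u0 x) + \<rho>0 x - 1) * \<phi> (0, x)) = 0"
proof -
  note L = weak_solution_Linf[OF sol]
  note gG = C1_test_integrable[OF test]
  note \<phi>0 = C1_test_initial_integrable[OF test T]
  let ?M = "lebesgue_on (slab T)"
  have wu: "(\<lambda>z. w \<bullet> u z) \<in> Linf (slab T)" by (intro Linf_inner Linf_const L)
  have I1: "integrable ?M (\<lambda>z. \<rho> z * g z + (\<rho> z *\<^sub>R u z) \<bullet> G z)"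
    by (intro Bochner_Integration.integrable_add integrable_Linf_mult integrable_Linf_inner Linf_scaleR L gG)
  have I2: "integrable ?M (\<lambda>z. \<rho> z * (w \<bullet> u z) * g z + \<rho> z * ((w \<bullet> u z) * (u z \<bullet> G z))
       + 1 / \<gamma> * \<rho> z powr \<gamma> * (G z \<bullet> w))"
    using \<gamma> by (intro Bochner_Integration.integrable_add integrable_Linf_mult integrable_Linf_inner Linf_mult
        Linf_powr Linf_const L gG wu integrable_inner_left) auto
  have I3: "integrable ?M (\<lambda>z. 1 * g z)" using gG by simp
  have I4: "integrable ?M (\<lambda>z. 1 / \<gamma> * (G z \<bullet> w))" by (intro integrable_mult_right integrable_inner_left gG)
  have J: "integrable lebesgue (\<lambda>x. f x * \<phi> (0, x))" if "f \<in> Linf UNIV" for f :: "space \<Rightarrow> real"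
    using integrable_Linf_mult[OF that, of "\<lambda>x. \<phi> (0, x)"] \<phi>0 by (simp add: lebesgue_on_UNIV_eq)
  have J1: "integrable lebesgue (\<lambda>x. \<rho>0 x * \<phi> (0, x))" by (intro J L)
  have J2: "integrable lebesgue (\<lambda>x. w \<bullet> (\<rho>0 x *\<^sub>R u0 x) * \<phi> (0, x))"
    by (intro J Linf_inner Linf_scaleR Linf_const L)
  have J3: "integrable lebesgue (\<lambda>x. 1 * \<phi> (0, x))" using \<phi>0 by simp
  have "(LINT z|?M. (\<rho> z - 1 + \<rho> z * (w \<bullet> u z)) * g z + (1 + w \<bullet> u z) * ((\<rho> z *\<^sub>R u z) \<bullet> G z)
       + (\<rho> z powr \<gamma> - 1) / \<gamma> * (G z \<bullet> w))
    = (LINT z|?M. (\<rho> z * g z + (\<rho> z *\<^sub>R u z) \<bullet> G z)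
        + (\<rho> z * (w \<bullet> u z) * g z + \<rho> z * ((w \<bullet> u z) * (u z \<bullet> G z)) + 1 / \<gamma> * \<rho> z powr \<gamma> * (G z \<bullet> w))
        - 1 * g z - 1 / \<gamma> * (G z \<bullet> w))"
    by (intro Bochner_Integration.integral_cong refl)
       (simp add: algebra_simps diff_divide_distrib)
  also have "\<dots> = (LINT z|?M. \<rho> z * g z + (\<rho> z *\<^sub>R u z) \<bullet> G z)
      + (LINT z|?M. \<rho> z * (w \<bullet> u z) * g z + \<rho> z * ((w \<bullet> u z) * (u z \<bullet> G z)) + 1 / \<gamma> * \<rho> z powr \<gamma> * (G z \<bullet> w))
      - (LINT z|?M. 1 * g z) - (LINT z|?M. 1 / \<gamma> * (G z \<bullet> w))"
    unfolding Bochner_Integration.integral_diff[OF Bochner_Integration.integrable_diff[OF Bochner_Integration.integrable_add[OF I1 I2] I3] I4]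
      Bochner_Integration.integral_diff[OF Bochner_Integration.integrable_add[OF I1 I2] I3]
      Bochner_Integration.integral_add[OF I1 I2] ..
  also have "(LINT z|?M. 1 / \<gamma> * (G z \<bullet> w)) = 0"
    using C1_test_space_integral[OF test T, of w] by simp
  finally have A: "(LINT z|?M. (\<rho> z - 1 + \<rho> z * (w \<bullet> u z)) * g z + (1 + w \<bullet> u z) * ((\<rho> z *\<^sub>R u z) \<bullet> G z)
       + (\<rho> z powr \<gamma> - 1) / \<gamma> * (G z \<bullet> w))
    = (LINT z|?M. \<rho> z * g z + (\<rho> z *\<^sub>R u z) \<bullet> G z)
      + (LINT z|?M. \<rho> z * (w \<bullet> u z) * g z + \<rho> z * ((w \<bullet> u z) * (u z \<bullet> G z)) + 1 / \<gamma> * \<rho> z powr \<gamma> * (G z \<bullet> w))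
      - (LINT z|?M. 1 * g z)" by (simp only: diff_zero)
  have "(LINT x|lebesgue. (w \<bullet> (\<rho>0 x *\<^sub>R u0 x) + \<rho>0 x - 1) * \<phi> (0, x))
    = (LINT x|lebesgue. \<rho>0 x * \<phi> (0, x) + w \<bullet> (\<rho>0 x *\<^sub>R u0 x) * \<phi> (0, x) - 1 * \<phi> (0, x))"
    by (intro Bochner_Integration.integral_cong refl) (simp add: algebra_simps)
  also have "\<dots> = (LINT x|lebesgue. \<rho>0 x * \<phi> (0, x)) + (LINT x|lebesgue. w \<bullet> (\<rho>0 x *\<^sub>R u0 x) * \<phi> (0, x))
      - (LINT x|lebesgue. 1 * \<phi> (0, x))"
    unfolding Bochner_Integration.integral_diff[OF Bochner_Integration.integrable_add[OF J1 J2] J3]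
      Bochner_Integration.integral_add[OF J1 J2] ..
  finally show ?thesis
    using A mass_identity momentum_identity[OF w] background_identity[of 1] by linarith
qed

lemma relative_energy_integrable:
  shows "integrable (lebesgue_on (slab T)) (\<lambda>z. rel_energy \<gamma> (\<rho> z) (u z) * g z + rel_flux \<gamma> (\<rho> z) (u z) \<bullet> G z)"
proof -
  note L = weak_solution_Linf[OF sol]
  note gG = C1_test_integrable[OF test]
  show ?thesis
    unfolding rel_energy_def rel_flux_def energy_def energy_flux_def power2_norm_eq_inner divide_inverse
    using \<gamma> by (intro Bochner_Integration.integrable_add integrable_Linf_mult integrable_Linf_inner Linf_add Linf_diff Linf_mult
        Linf_scaleR Linf_inner Linf_powr Linf_const L gG) auto
qed

end

text \<open>
  The entropy inequality minus \<open>1 / (\<gamma> - 1)\<close> times the mass equation plus \<open>1 / \<gamma>\<close> times the identity for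
  the constant state.
\<close>

lemma relative_energy_inequality:
  assumes adm: "entropy_admissible \<gamma> T \<rho> u \<rho>0 u0" and T: "0 < T" and \<gamma>: "1 < \<gamma>"
    and test: "C1_test T \<phi> g G" and pos: "\<And>z. z \<in> slab T \<Longrightarrow> 0 \<le> \<phi> z"
  shows "0 \<le> (LINT z|lebesgue_on (slab T). rel_energy \<gamma> (\<rho> z) (u z) * g z + rel_flux \<gamma> (\<rho> z) (u z) \<bullet> G z)
     + (LINT x|lebesgue. rel_energy \<gamma> (\<rho>0 x) (u0 x) * \<phi> (0, x))"
proof -
  have sol: "weak_solution \<gamma> T \<rho> u \<rho>0 u0" using adm by (simp add: entropy_admissible_def)
  note L = weak_solution_Linf[OF sol]
  note gG = C1_test_integrable[OF test]
  let ?M = "lebesgue_on (slab T)"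
  let ?E = "\<lambda>z. energy \<gamma> (\<rho> z) (u z) * g z + energy_flux \<gamma> (\<rho> z) (u z) \<bullet> G z"
  let ?Einit = "\<lambda>x. energy \<gamma> (\<rho>0 x) (u0 x) * \<phi> (0, x)"
  let ?k = "1 / (\<gamma> - 1)"
  have EL: "(\<lambda>z. energy \<gamma> (\<rho> z) (u z)) \<in> Linf (slab T)" "(\<lambda>z. energy_flux \<gamma> (\<rho> z) (u z)) \<in> Linf (slab T)"
    "(\<lambda>x. energy \<gamma> (\<rho>0 x) (u0 x)) \<in> Linf UNIV"
    unfolding energy_def energy_flux_def power2_norm_eq_inner using \<gamma>
    by (intro Linf_add Linf_mult Linf_scaleR Linf_inner Linf_powr Linf_const L; simp)+
  have I1: "integrable ?M ?E"
    by (intro Bochner_Integration.integrable_add integrable_Linf_mult integrable_Linf_inner EL gG)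
  have I2: "integrable ?M (\<lambda>z. ?k * (\<rho> z * g z + (\<rho> z *\<^sub>R u z) \<bullet> G z))"
    by (intro integrable_mult_right Bochner_Integration.integrable_add integrable_Linf_mult integrable_Linf_inner Linf_scaleR L gG)
  have I3: "integrable ?M (\<lambda>z. 1 / \<gamma> * g z)" using gG by (intro integrable_mult_right)
  have J: "integrable lebesgue (\<lambda>x. f x * \<phi> (0, x))" if "f \<in> Linf UNIV" for f :: "space \<Rightarrow> real"
    using integrable_Linf_mult[OF that, of "\<lambda>x. \<phi> (0, x)"] C1_test_initial_integrable[OF test T]
    by (simp add: lebesgue_on_UNIV_eq)
  have J1: "integrable lebesgue ?Einit" by (intro J EL)
  have J2: "integrable lebesgue (\<lambda>x. ?k * (\<rho>0 x * \<phi> (0, x)))" by (intro integrable_mult_right J L)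
  have J3: "integrable lebesgue (\<lambda>x. 1 / \<gamma> * \<phi> (0, x))"
    using C1_test_initial_integrable[OF test T] by (intro integrable_mult_right)
  have "(LINT z|?M. energy \<gamma> (\<rho> z) (u z) * dt \<phi> z + energy_flux \<gamma> (\<rho> z) (u z) \<bullet> grad \<phi> z) = (LINT z|?M. ?E z)"
    using slab_subset_time_domain[THEN subsetD]
    by (intro Bochner_Integration.integral_cong) (simp_all add: C1_test_dt[OF test] C1_test_grad[OF test])
  then have ent: "0 \<le> (LINT z|?M. ?E z) + (LINT x|lebesgue. ?Einit x)"
    using adm pos C1_test_test_function[OF test] by (auto simp: entropy_admissible_def)
  have "(LINT z|?M. rel_energy \<gamma> (\<rho> z) (u z) * g z + rel_flux \<gamma> (\<rho> z) (u z) \<bullet> G z)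
     = (LINT z|?M. ?E z - ?k * (\<rho> z * g z + (\<rho> z *\<^sub>R u z) \<bullet> G z) + 1 / \<gamma> * g z)"
    by (intro Bochner_Integration.integral_cong refl)
       (simp add: rel_energy_def rel_flux_def inner_diff_left algebra_simps add_divide_distrib)
  also have "\<dots> = (LINT z|?M. ?E z) - ?k * (LINT z|?M. \<rho> z * g z + (\<rho> z *\<^sub>R u z) \<bullet> G z)
      + (LINT z|?M. 1 / \<gamma> * g z)"
    unfolding Bochner_Integration.integral_add[OF Bochner_Integration.integrable_diff[OF I1 I2] I3]
      Bochner_Integration.integral_diff[OF I1 I2] integral_mult_right_zero ..
  finally have A: "(LINT z|?M. rel_energy \<gamma> (\<rho> z) (u z) * g z + rel_flux \<gamma> (\<rho> z) (u z) \<bullet> G z) = \<dots>" .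
  have "(LINT x|lebesgue. rel_energy \<gamma> (\<rho>0 x) (u0 x) * \<phi> (0, x))
      = (LINT x|lebesgue. ?Einit x - ?k * (\<rho>0 x * \<phi> (0, x)) + 1 / \<gamma> * \<phi> (0, x))"
    by (intro Bochner_Integration.integral_cong refl) (simp add: rel_energy_def algebra_simps)
  also have "\<dots> = (LINT x|lebesgue. ?Einit x) - ?k * (LINT x|lebesgue. \<rho>0 x * \<phi> (0, x))
      + (LINT x|lebesgue. 1 / \<gamma> * \<phi> (0, x))"
    unfolding Bochner_Integration.integral_add[OF Bochner_Integration.integrable_diff[OF J1 J2] J3]
      Bochner_Integration.integral_diff[OF J1 J2] integral_mult_right_zero ..
  finally have B: "(LINT x|lebesgue. rel_energy \<gamma> (\<rho>0 x) (u0 x) * \<phi> (0, x)) = \<dots>" .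
  have "(LINT z|?M. \<rho> z * g z + (\<rho> z *\<^sub>R u z) \<bullet> G z) = - (LINT x|lebesgue. \<rho>0 x * \<phi> (0, x))"
    using mass_identity[OF sol T \<gamma> test] by linarith
  then show ?thesis
    unfolding A B using ent background_identity[OF sol T \<gamma> test, of "1 / \<gamma>"] by simp
qed

section \<open>Finite propagation of the quiescent region\<close>

lemma AE_lebesgue_on_iff:
  assumes "A \<in> sets lebesgue"
  shows "(AE x in lebesgue_on A. P x) \<longleftrightarrow> (AE x in lebesgue. x \<in> A \<longrightarrow> P x)"
  using assms by (subst AE_restrict_space_iff) auto

lemma AE_slab_time_neq: "AE z in lebesgue_on (slab T). fst z \<noteq> (s::real)"
proof -
  have "negligible {z :: spacetime. z \<bullet> (1, 0) = s}"
    by (rule negligible_standard_hyperplane) (simp add: Basis_prod_def)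
  then have "{z :: spacetime. fst z = s} \<in> null_sets lebesgue"
    by (simp add: negligible_iff_null_sets inner_prod_def)
  from AE_not_in[OF this] have "AE z in lebesgue. fst (z :: spacetime) \<noteq> s" by simp
  then show ?thesis by (auto simp: AE_lebesgue_on_iff elim: eventually_mono)
qed

lemma has_derivative_pos_part_power:
  fixes f :: "'a::real_normed_vector \<Rightarrow> real"
  assumes "(f has_derivative f') (at z)"
  shows "((\<lambda>z. max 0 (f z) ^ Suc (Suc n)) has_derivative
     (\<lambda>h. real (Suc (Suc n)) * max 0 (f z) ^ Suc n * f' h)) (at z)"
proof -
  have D: "((\<lambda>y. max 0 y ^ Suc (Suc n)) has_real_derivative real (Suc (Suc n)) * max 0 y ^ Suc n) (at y)" for y :: real
  proof -
    consider "y > 0" | "y < 0" | "y = 0" by linarith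
    then show ?thesis
    proof cases
      case 1
      have "((\<lambda>y. y ^ Suc (Suc n)) has_real_derivative real (Suc (Suc n)) * max 0 y ^ Suc n) (at y)"
        using DERIV_pow[of "Suc (Suc n)" y] 1 by simp
      then show ?thesis
        by (rule has_field_derivative_transform_within_open[of _ _ _ "{0<..}"]) (use 1 in auto)
    next
      case 2
      have "((\<lambda>y. 0) has_real_derivative real (Suc (Suc n)) * max 0 y ^ Suc n) (at y)"
        using 2 by simp
      then show ?thesis
        by (rule has_field_derivative_transform_within_open[of _ _ _ "{..<0}"]) (use 2 in auto)
    next
      case 3
      have "(\<lambda>h::real. max 0 h ^ Suc (Suc n) / h) \<midarrow>0\<rightarrow> 0"
      proof (rule tendsto_0_le[where K = 1])
        show "((\<lambda>h::real. h ^ Suc n) \<longlongrightarrow> 0) (at 0)"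
          by (rule tendsto_eq_intros | simp)+
        show "\<forall>\<^sub>F h::real in at 0. norm (max 0 h ^ Suc (Suc n) / h) \<le> norm (h ^ Suc n) * 1"
          by (intro always_eventually allI) (auto simp: max_def norm_power abs_mult intro: mult_nonpos_nonneg)
      qed
      then show ?thesis using 3 by (simp add: DERIV_def)
    qed
  qed
  from DERIV_compose_FDERIV[OF D assms] show ?thesis by (simp add: mult.commute)
qed

lemma has_derivative_pos_part_square:
  fixes f :: "'a::real_normed_vector \<Rightarrow> real"
  assumes "(f has_derivative f') (at z)"
  shows "((\<lambda>z. (max 0 (f z))\<^sup>2) has_derivative (\<lambda>h. 2 * max 0 (f z) * f' h)) (at z)"
  using has_derivative_pos_part_power[OF assms, of 0] by (simp add: numeral_2_eq_2)

text \<open>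
  A continuously differentiable time scale that equals \<open>s\<close> for \<open>s \<ge> 0\<close> and never drops below \<open>- \<delta>\<close>.
  A cone whose radius decreases in this scale hardly widens before the time \<open>\<tau>\<close>, so that there it stays
  over a fixed ball.
\<close>

definition soft_time :: "real \<Rightarrow> real \<Rightarrow> real" where
  "soft_time \<delta> s = s + (max 0 (- s))\<^sup>2 / (4 * \<delta>)"

lemma soft_time_of_nonneg: "0 \<le> s \<Longrightarrow> soft_time \<delta> s = s"
  by (simp add: soft_time_def)

lemma soft_time_ge: "0 < \<delta> \<Longrightarrow> - \<delta> \<le> soft_time \<delta> s"
proof (cases "s \<ge> 0")
  case False
  assume d: "0 < \<delta>"
  have "0 \<le> (s + 2 * \<delta>)\<^sup>2 / (4 * \<delta>)" using d by simp
  also have "\<dots> = s + s\<^sup>2 / (4 * \<delta>) + \<delta>" using d by (simp add: power2_eq_square field_simps)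
  finally show ?thesis using False by (simp add: soft_time_def)
qed (simp add: soft_time_def)

definition cone_radius :: "real \<Rightarrow> real \<Rightarrow> real \<Rightarrow> real \<Rightarrow> real \<Rightarrow> real" where
  "cone_radius r c \<tau> \<delta> t = r - c * soft_time \<delta> (t - \<tau>)"

definition cone_radius_deriv :: "real \<Rightarrow> real \<Rightarrow> real \<Rightarrow> real \<Rightarrow> real" where
  "cone_radius_deriv c \<tau> \<delta> t = - c * (1 - max 0 (\<tau> - t) / (2 * \<delta>))"

text \<open>
  The difference of squares makes the bump differentiable on the axis of the cone, where the distance
  to the axis is not.
\<close>

definition cone_bump :: "space \<Rightarrow> real \<Rightarrow> real \<Rightarrow> real \<Rightarrow> real \<Rightarrow> spacetime \<Rightarrow> real" where
  "cone_bump p r c \<tau> \<delta> z = max 0 ((max 0 (cone_radius r c \<tau> \<delta> (fst z)))\<^sup>2 - (norm (snd z - p))\<^sup>2)"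

lemma cone_radius_le:
  assumes "0 < \<delta>" "0 \<le> c"
  shows "cone_radius r c \<tau> \<delta> t \<le> r + c * \<delta>"
proof -
  have "c * (- \<delta>) \<le> c * soft_time \<delta> (t - \<tau>)"
    using assms soft_time_ge by (intro mult_left_mono) auto
  then show ?thesis by (simp add: cone_radius_def)
qed

lemma cone_bump_pos_iff:
  "0 < cone_bump p r c \<tau> \<delta> z \<longleftrightarrow> norm (snd z - p) < cone_radius r c \<tau> \<delta> (fst z)"
proof -
  have "0 < cone_bump p r c \<tau> \<delta> z \<longleftrightarrow> (norm (snd z - p))\<^sup>2 < (max 0 (cone_radius r c \<tau> \<delta> (fst z)))\<^sup>2"
    by (auto simp: cone_bump_def)
  also have "\<dots> \<longleftrightarrow> norm (snd z - p) < max 0 (cone_radius r c \<tau> \<delta> (fst z))"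
    by (simp add: not_le[symmetric] power_mono_iff)
  also have "\<dots> \<longleftrightarrow> norm (snd z - p) < cone_radius r c \<tau> \<delta> (fst z)"
    using norm_ge_zero[of "snd z - p"] by (auto simp: max_def simp del: norm_ge_zero split: if_splits)
  finally show ?thesis .
qed

lemma cone_C1_test:
  fixes p :: space and r c \<tau> \<delta> S T :: real
  assumes "0 < \<delta>" "0 \<le> c" "S < T"
  defines "M \<equiv> cone_bump p r c \<tau> \<delta>" and "R \<equiv> cone_radius r c \<tau> \<delta>"
  shows "C1_test T (\<lambda>z. (max 0 (S - fst z))\<^sup>2 * (M z)\<^sup>2)
    (\<lambda>z. - 2 * max 0 (S - fst z) * (M z)\<^sup>2
       + (max 0 (S - fst z))\<^sup>2 * (2 * M z * (2 * max 0 (R (fst z)) * cone_radius_deriv c \<tau> \<delta> (fst z))))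
    (\<lambda>z. ((max 0 (S - fst z))\<^sup>2 * (2 * M z)) *\<^sub>R ((-2) *\<^sub>R (snd z - p)))"
  unfolding C1_test_def
proof (intro conjI ballI)
  fix z :: spacetime
  have "((\<lambda>z::spacetime. \<tau> - fst z) has_derivative (\<lambda>h. - fst h)) (at z)"
    by (auto intro!: derivative_eq_intros)
  note has_derivative_pos_part_square[OF this]
  then have 1: "((\<lambda>z::spacetime. (max 0 (\<tau> - fst z))\<^sup>2) has_derivative (\<lambda>h. 2 * max 0 (\<tau> - fst z) * - fst h)) (at z)" .
  have "((\<lambda>z::spacetime. R (fst z)) has_derivative
      (\<lambda>h. - c * (fst h + (2 * max 0 (\<tau> - fst z) * - fst h) / (4 * \<delta>)))) (at z)"
    unfolding R_def cone_radius_def soft_time_def minus_diff_eq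
    by (rule derivative_eq_intros 1 refl | use assms in \<open>simp\<close>)+
  also have "(\<lambda>h::spacetime. - c * (fst h + (2 * max 0 (\<tau> - fst z) * - fst h) / (4 * \<delta>)))
     = (\<lambda>h. cone_radius_deriv c \<tau> \<delta> (fst z) * fst h)"
    using assms by (auto simp: cone_radius_deriv_def field_simps)
  finally have 2: "((\<lambda>z. (max 0 (R (fst z)))\<^sup>2) has_derivative
      (\<lambda>h. 2 * max 0 (R (fst z)) * (cone_radius_deriv c \<tau> \<delta> (fst z) * fst h))) (at z)"
    by (rule has_derivative_pos_part_square)
  have 3: "((\<lambda>z::spacetime. (norm (snd z - p))\<^sup>2) has_derivative (\<lambda>h. 2 * ((snd z - p) \<bullet> snd h))) (at z)"
    unfolding power2_norm_eq_inner
    by (auto intro!: derivative_eq_intros simp: inner_commute)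
  have 4: "((\<lambda>z. (M z)\<^sup>2) has_derivative
      (\<lambda>h. 2 * M z * (2 * max 0 (R (fst z)) * (cone_radius_deriv c \<tau> \<delta> (fst z) * fst h) - 2 * ((snd z - p) \<bullet> snd h)))) (at z)"
    unfolding M_def cone_bump_def R_def
    by (rule has_derivative_pos_part_square[OF has_derivative_diff[OF 2[unfolded R_def] 3]])
  have "((\<lambda>z::spacetime. S - fst z) has_derivative (\<lambda>h. - fst h)) (at z)"
    by (auto intro!: derivative_eq_intros)
  then have 5: "((\<lambda>z::spacetime. (max 0 (S - fst z))\<^sup>2) has_derivative (\<lambda>h. 2 * max 0 (S - fst z) * - fst h)) (at z)"
    by (rule has_derivative_pos_part_square)
  show "((\<lambda>z. (max 0 (S - fst z))\<^sup>2 * (M z)\<^sup>2) has_derivative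
      (\<lambda>h. (- 2 * max 0 (S - fst z) * (M z)\<^sup>2
       + (max 0 (S - fst z))\<^sup>2 * (2 * M z * (2 * max 0 (R (fst z)) * cone_radius_deriv c \<tau> \<delta> (fst z)))) * fst h
       + (((max 0 (S - fst z))\<^sup>2 * (2 * M z)) *\<^sub>R ((-2) *\<^sub>R (snd z - p))) \<bullet> snd h)) (at z)"
    by (rule has_derivative_eq_rhs[OF has_derivative_mult[OF 5 4]]) (auto simp: algebra_simps)
next
  have Rc: "continuous_on A (\<lambda>z::spacetime. R (fst z))" for A
    unfolding R_def cone_radius_def soft_time_def using assms by (intro continuous_intros) auto
  have Mc: "continuous_on A M" for A
    unfolding M_def cone_bump_def using Rc[unfolded R_def] by (intro continuous_intros)
  have Dc: "continuous_on A (\<lambda>z::spacetime. cone_radius_deriv c \<tau> \<delta> (fst z))" for A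
    unfolding cone_radius_deriv_def using assms by (intro continuous_intros) auto
  show "continuous_on time_domain (\<lambda>z. - 2 * max 0 (S - fst z) * (M z)\<^sup>2
       + (max 0 (S - fst z))\<^sup>2 * (2 * M z * (2 * max 0 (R (fst z)) * cone_radius_deriv c \<tau> \<delta> (fst z))))"
    by (intro continuous_intros Rc Mc Dc)
  show "continuous_on time_domain (\<lambda>z. ((max 0 (S - fst z))\<^sup>2 * (2 * M z)) *\<^sub>R ((-2) *\<^sub>R (snd z - p)))"
    by (intro continuous_intros Mc)
next
  have "fst z \<le> S \<and> norm (snd z) \<le> norm p + (r + c * \<delta>)"
    if nz: "(max 0 (S - fst z))\<^sup>2 * (M z)\<^sup>2 \<noteq> 0" for z
  proof
    show "fst z \<le> S" using nz by (auto simp: max_def split: if_splits)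
    have "M z \<noteq> 0" "0 \<le> M z" using nz by (auto simp: M_def cone_bump_def)
    then have "0 < M z" by simp
    then have "norm (snd z - p) < R (fst z)" unfolding M_def R_def by (simp add: cone_bump_pos_iff)
    also have "\<dots> \<le> r + c * \<delta>" unfolding R_def by (rule cone_radius_le) fact+
    finally show "norm (snd z) \<le> norm p + (r + c * \<delta>)"
      using norm_triangle_sub[of "snd z" p] by linarith
  qed
  with \<open>S < T\<close> show "\<exists>S'<T. \<exists>R. \<forall>z\<in>time_domain.
      (max 0 (S - fst z))\<^sup>2 * (M z)\<^sup>2 \<noteq> 0 \<longrightarrow> fst z \<le> S' \<and> norm (snd z) \<le> R"
    by blast
qed

text \<open>
  After \<open>\<tau>\<close> the radius shrinks with speed \<open>c\<close>, which is at least the speed of the relative energy, so the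
  lateral terms are nonpositive and the decreasing time cutoff makes the integrand negative wherever there is
  relative energy. Before \<open>\<tau>\<close>, and
  initially, the relative energy vanishes on the support of the test function. The entropy
  inequality then leaves no room for relative energy in the cone.
\<close>

lemma cone_quiescent_AE:
  fixes p :: space
  assumes adm: "entropy_admissible \<gamma> T \<rho> u \<rho>0 u0" and T: "0 < T" and \<gamma>: "1 < \<gamma>"
    and c: "0 < c" and S: "S < T" and \<delta>: "0 < \<delta>"
    and init: "AE x in lebesgue. norm (x - p) < r \<longrightarrow> \<rho>0 x = 1 \<and> u0 x = 0"
    and past: "AE z in lebesgue_on (slab T). fst z < \<tau> \<and> norm (snd z - p) < r \<longrightarrow> \<rho> z = 1 \<and> u z = 0"
    and speed: "AE z in lebesgue_on (slab T). \<tau> < fst z \<and> fst z < S \<and> norm (snd z - p) + c * (fst z - \<tau>) < r \<longrightarrow>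
        norm (rel_flux \<gamma> (\<rho> z) (u z)) \<le> c * rel_energy \<gamma> (\<rho> z) (u z)"
  shows "AE z in lebesgue_on (slab T). \<tau> < fst z \<and> fst z < S \<and>
      norm (snd z - p) + c * (fst z - \<tau>) < r - c * \<delta> \<longrightarrow> \<rho> z = 1 \<and> u z = 0"
proof -
  define M where "M = cone_bump p (r - c * \<delta>) c \<tau> \<delta>"
  define R where "R = cone_radius (r - c * \<delta>) c \<tau> \<delta>"
  define R' where "R' = cone_radius_deriv c \<tau> \<delta>"
  define \<phi> where "\<phi> z = (max 0 (S - fst z))\<^sup>2 * (M z)\<^sup>2" for z
  define g where "g z = - 2 * max 0 (S - fst z) * (M z)\<^sup>2
       + (max 0 (S - fst z))\<^sup>2 * (2 * M z * (2 * max 0 (R (fst z)) * R' (fst z)))" for z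
  define G where "G z = ((max 0 (S - fst z))\<^sup>2 * (2 * M z)) *\<^sub>R ((-2) *\<^sub>R (snd z - p))" for z
  let ?M = "lebesgue_on (slab T)"
  let ?E = "\<lambda>z. rel_energy \<gamma> (\<rho> z) (u z)" and ?Q = "\<lambda>z. rel_flux \<gamma> (\<rho> z) (u z)"
  let ?I = "\<lambda>z. ?E z * g z + ?Q z \<bullet> G z"
  have sol: "weak_solution \<gamma> T \<rho> u \<rho>0 u0" using adm by (simp add: entropy_admissible_def)
  have test: "C1_test T \<phi> g G"
    unfolding \<phi>_def[abs_def] g_def[abs_def] G_def[abs_def] M_def R_def R'_def
    by (rule cone_C1_test) (use \<delta> c S in auto)
  have Rle: "R t \<le> r" for t
    using cone_radius_le[OF \<delta>, of c "r - c * \<delta>" \<tau> t] c by (simp add: R_def)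
  have Mpos: "0 < M z \<longleftrightarrow> norm (snd z - p) < R (fst z)" for z
    unfolding M_def R_def by (rule cone_bump_pos_iff)
  have M0: "0 \<le> M z" for z by (simp add: M_def cone_bump_def)
  have init0: "(LINT x|lebesgue. rel_energy \<gamma> (\<rho>0 x) (u0 x) * \<phi> (0, x)) = 0"
  proof (rule integral_eq_zero_AE)
    show "AE x in lebesgue. rel_energy \<gamma> (\<rho>0 x) (u0 x) * \<phi> (0, x) = 0"
      using init
    proof eventually_elim
      case (elim x)
      show ?case
      proof (cases "M (0, x) = 0")
        case False
        then have "norm (x - p) < R 0" using Mpos[of "(0, x)"] M0[of "(0, x)"] by simp
        then have "\<rho>0 x = 1 \<and> u0 x = 0" using elim Rle[of 0] by simp
        then show ?thesis using rel_energy_eq_0_iff[of \<gamma> 1 0] \<gamma> by simp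
      qed (simp add: \<phi>_def)
    qed
  qed
  have sign: "AE z in ?M. ?I z \<le> - (2 * max 0 (S - fst z) * (M z)\<^sup>2 * ?E z) \<and> 0 \<le> ?E z"
    using past speed weak_solution_Linf(3)[OF sol] AE_slab_time_neq[of \<tau> T]
  proof eventually_elim
    case (elim z)
    have E0: "0 \<le> ?E z" using rel_energy_nonneg[OF \<gamma>] elim by simp
    show ?case
    proof (cases "0 < M z \<and> fst z < S")
      case False
      then have "M z = 0 \<or> max 0 (S - fst z) = 0" using M0[of z] by auto
      then have I: "?I z = 0" and X: "2 * max 0 (S - fst z) * (M z)\<^sup>2 * ?E z = 0"
        by (auto simp: g_def G_def)
      show ?thesis unfolding I X using E0 by simp
    next
      case True
      then have x: "norm (snd z - p) < R (fst z)" and t: "fst z < S" using Mpos by auto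
      have Rp: "0 < R (fst z)" using x norm_ge_zero[of "snd z - p"] by linarith
      show ?thesis
      proof (cases "fst z < \<tau>")
        case before: True
        then have "\<rho> z = 1 \<and> u z = 0" using elim(1) x Rle[of "fst z"] by auto
        then show ?thesis using rel_energy_eq_0_iff[of \<gamma> 1 0] \<gamma> rel_flux_eq[of \<gamma> 1 0] by simp
      next
        case False
        then have after: "\<tau> < fst z" using elim(4) by simp
        have Req: "R (fst z) = r - c * \<delta> - c * (fst z - \<tau>)" "R' (fst z) = - c"
          using after by (auto simp: R_def R'_def cone_radius_def cone_radius_deriv_def soft_time_of_nonneg)
        have "0 < c * \<delta>" using c \<delta> by simp
        then have Q: "norm (?Q z) \<le> c * ?E z" using elim(2) after t x Req by auto
        have "- (?Q z \<bullet> (snd z - p)) \<le> norm (?Q z) * norm (snd z - p)"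
          using norm_cauchy_schwarz[of "- ?Q z" "snd z - p"] by simp
        also have "\<dots> \<le> (c * ?E z) * R (fst z)"
          using Q x E0 c by (intro mult_mono) auto
        finally have key: "- c * ?E z * R (fst z) - ?Q z \<bullet> (snd z - p) \<le> 0" by simp
        have "?I z = - (2 * max 0 (S - fst z) * (M z)\<^sup>2 * ?E z)
            + (max 0 (S - fst z))\<^sup>2 * (2 * M z) * 2 * (- c * ?E z * R (fst z) - ?Q z \<bullet> (snd z - p))"
          using Rp by (simp add: g_def G_def Req(2) algebra_simps)
        also have "\<dots> \<le> - (2 * max 0 (S - fst z) * (M z)\<^sup>2 * ?E z)"
          using key M0[of z] by (intro add_decreasing2 mult_nonneg_nonpos mult_nonneg_nonneg) auto
        finally show ?thesis using E0 by simp
      qed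
    qed
  qed
  have sign0: "AE z in ?M. 0 \<le> - ?I z"
    using sign
  proof eventually_elim
    case (elim z)
    have "0 \<le> 2 * max 0 (S - fst z) * (M z)\<^sup>2 * ?E z" using elim by (intro mult_nonneg_nonneg) auto
    then show ?case using elim by linarith
  qed
  have int: "integrable ?M ?I" by (rule relative_energy_integrable[OF sol T \<gamma> test])
  have "0 \<le> (LINT z|?M. ?I z)"
    using relative_energy_inequality[OF adm T \<gamma> test] init0 by (simp add: \<phi>_def)
  moreover have "0 \<le> (LINT z|?M. - ?I z)" by (rule integral_nonneg_AE[OF sign0])
  ultimately have "(LINT z|?M. - ?I z) = 0"
    unfolding Bochner_Integration.integral_minus by linarith
  then have "AE z in ?M. - ?I z = 0"
    using integral_nonneg_eq_0_iff_AE[OF Bochner_Integration.integrable_minus[OF int] sign0] by simp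
  then show ?thesis
    using sign weak_solution_Linf(3)[OF sol]
  proof eventually_elim
    case (elim z)
    show ?case
    proof
      assume z: "\<tau> < fst z \<and> fst z < S \<and> norm (snd z - p) + c * (fst z - \<tau>) < r - c * \<delta>"
      then have "0 < M z" unfolding Mpos by (simp add: R_def cone_radius_def soft_time_of_nonneg)
      then have "0 < 2 * max 0 (S - fst z) * (M z)\<^sup>2" using z by simp
      moreover have "2 * max 0 (S - fst z) * (M z)\<^sup>2 * ?E z \<le> 0" using elim by linarith
      ultimately have "?E z \<le> 0" by (meson mult_pos_pos not_less)
      then have "?E z = 0" using elim by simp
      then show "\<rho> z = 1 \<and> u z = 0" using rel_energy_eq_0_iff[OF \<gamma>] elim(3) by simp
    qed
  qed
qed

lemma ess_null_setI:
  assumes "openin (top_of_set D) U" "z \<in> U" "AE x in lebesgue_on D. x \<in> U \<longrightarrow> f x = 0"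
  shows "z \<in> ess_null_set D f"
  using assms unfolding ess_null_set_def by blast

lemma not_in_perturbation_supp:
  assumes "open U" "z \<in> U" "AE y in lebesgue_on D. y \<in> U \<longrightarrow> r y = 1 \<and> v y = 0"
  shows "z \<notin> perturbation_supp D r v"
proof
  assume z: "z \<in> perturbation_supp D r v"
  then have "z \<in> D" by (simp add: perturbation_supp_def ess_supp_def)
  have "z \<in> ess_null_set D (\<lambda>z. (r z - 1, v z))"
  proof (rule ess_null_setI)
    show "openin (top_of_set D) (D \<inter> U)" using assms(1) by (rule openin_open_Int)
    show "z \<in> D \<inter> U" using assms(2) \<open>z \<in> D\<close> by simp
    show "AE x in lebesgue_on D. x \<in> D \<inter> U \<longrightarrow> (r x - 1, v x) = 0"
      using assms(3) by eventually_elim (simp add: zero_prod_def)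
  qed
  then show False using z by (simp add: perturbation_supp_def ess_supp_def)
qed

lemma AE_not_in_perturbation_supp:
  "AE z in lebesgue_on D. z \<in> D \<longrightarrow> z \<notin> perturbation_supp D r v \<longrightarrow> r z = 1 \<and> v z = 0"
  using AE_ess_null_set[of D "\<lambda>z. (r z - 1, v z)"]
  by eventually_elim (simp add: perturbation_supp_def ess_supp_def zero_prod_def)

text \<open>
  Letting the smoothing \<open>\<delta>\<close> tend to zero and the time cutoff tend to \<open>T'\<close>: every point of the open cone has a
  neighbourhood covered by the previous lemma for suitable parameters. The speed bound is assumed only in the cone
  itself, which permits the amplitude-dependent speeds needed for the jump of the front.
\<close>

lemma cone_quiescent:
  fixes p :: space
  assumes adm: "entropy_admissible \<gamma> T \<rho> u \<rho>0 u0" and T: "0 < T" and \<gamma>: "1 < \<gamma>"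
    and c: "0 < c" and T': "T' \<le> T"
    and init: "AE x in lebesgue. norm (x - p) < r \<longrightarrow> \<rho>0 x = 1 \<and> u0 x = 0"
    and past: "AE z in lebesgue_on (slab T). fst z < \<tau> \<and> norm (snd z - p) < r \<longrightarrow> \<rho> z = 1 \<and> u z = 0"
    and speed: "AE z in lebesgue_on (slab T). \<tau> < fst z \<and> fst z < T' \<and> norm (snd z - p) + c * (fst z - \<tau>) < r \<longrightarrow>
        norm (rel_flux \<gamma> (\<rho> z) (u z)) \<le> c * rel_energy \<gamma> (\<rho> z) (u z)"
    and z: "fst z < T'" "norm (snd z - p) + c * max 0 (fst z - \<tau>) < r"
  shows "z \<notin> perturbation_supp (slab T) \<rho> u"
proof -
  define a where "a = norm (snd z - p) + c * max 0 (fst z - \<tau>)"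
  have a: "a < r" using z(2) by (simp add: a_def)
  define \<delta> where "\<delta> = (r - a) / (2 * c)"
  have \<delta>: "0 < \<delta>" using a c by (simp add: \<delta>_def)
  have "c * \<delta> = (r - a) / 2" using c by (simp add: \<delta>_def)
  moreover have "a < r - (r - a) / 2" using a by (simp add: field_simps)
  ultimately have "a < r - c * \<delta>" by (simp only:)
  then have z\<delta>: "norm (snd z - p) + c * max 0 (fst z - \<tau>) < r - c * \<delta>" by (simp only: a_def)
  obtain S where S: "fst z < S" "S < T'" using z(1) dense by blast
  let ?U = "{y::spacetime. fst y < S} \<inter> {y. norm (snd y - p) + c * max 0 (fst y - \<tau>) < r - c * \<delta>}"
  show ?thesis
  proof (rule not_in_perturbation_supp)
    show "open ?U" by (intro open_Int open_Collect_less continuous_intros)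
    show "z \<in> ?U" using S z\<delta> by simp
    have "AE y in lebesgue_on (slab T). \<tau> < fst y \<and> fst y < S \<and>
      norm (snd y - p) + c * (fst y - \<tau>) < r - c * \<delta> \<longrightarrow> \<rho> y = 1 \<and> u y = 0"
    proof (rule cone_quiescent_AE[OF adm T \<gamma> c _ \<delta> init past])
      show "S < T" using S T' by simp
      show "AE z in lebesgue_on (slab T). \<tau> < fst z \<and> fst z < S \<and> norm (snd z - p) + c * (fst z - \<tau>) < r \<longrightarrow>
        norm (rel_flux \<gamma> (\<rho> z) (u z)) \<le> c * rel_energy \<gamma> (\<rho> z) (u z)"
        using speed by eventually_elim (use S in auto)
    qed
    then show "AE y in lebesgue_on (slab T). y \<in> ?U \<longrightarrow> \<rho> y = 1 \<and> u y = 0"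
      using past AE_slab_time_neq[of \<tau> T]
    proof eventually_elim
      case (elim y)
      show ?case
      proof
        assume y: "y \<in> ?U"
        have "0 < c * \<delta>" using c \<delta> by simp
        moreover have "0 \<le> c * max 0 (fst y - \<tau>)" using c by simp
        ultimately have "norm (snd y - p) < r" using y by auto
        then show "\<rho> y = 1 \<and> u y = 0" using elim y by (cases "fst y < \<tau>") auto
      qed
    qed
  qed
qed

lemma Linf_norm_add_le_AE:
  fixes f :: "'a::euclidean_space \<Rightarrow> 'b::real_normed_vector" and g :: "'a \<Rightarrow> 'c::real_normed_vector"
  assumes "Linf_norm A f + Linf_norm A g \<le> ennreal m" "0 \<le> m"
  shows "AE x in lebesgue_on A. norm (f x) + norm (g x) \<le> m"
proof -
  have "AE x in lebesgue_on A. ennreal (norm (f x)) \<le> Linf_norm A f"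
    "AE x in lebesgue_on A. ennreal (norm (g x)) \<le> Linf_norm A g"
    unfolding Linf_norm_def by (rule esssup_AE)+
  then show ?thesis
  proof eventually_elim
    case (elim x)
    have "ennreal (norm (f x) + norm (g x)) = ennreal (norm (f x)) + ennreal (norm (g x))" by simp
    also have "\<dots> \<le> ennreal m" using add_mono[OF elim] assms(1) by (rule order_trans)
    finally show ?case using assms(2) ennreal_le_iff by blast
  qed
qed

text \<open>
  A point with \<open>K t < dist(x, - V)\<close> lies in a cone over a ball inside \<open>V\<close>. Each \<open>\<alpha> < 1 / K\<close> therefore belongs to the
  set whose supremum is taken; the strict inequality also covers the lateral boundary of the closed cone region.
\<close>

lemma propagation_property_of_flux_bound:
  assumes \<gamma>: "1 < \<gamma>" and C: "C > 0"
    "\<And>m r v. r > 0 \<Longrightarrow> \<bar>inverse r * (r - 1)\<bar> + norm v \<le> m \<Longrightarrow>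
       norm (rel_flux \<gamma> r v) \<le> (1 + C * m) * rel_energy \<gamma> r v"
  shows "propagation_property \<gamma> C"
  unfolding propagation_property_def
proof (intro allI impI, elim conjE)
  fix T \<rho> u \<rho>0 u0 m V
  assume T: "0 < T" and adm: "entropy_admissible \<gamma> T \<rho> u \<rho>0 u0" and m: "0 < m"
    and dev: "deviation_norm (slab T) \<rho> u \<le> ennreal m"
    and V: "closed V" "bounded V" and V0: "cone_deviation T \<rho> u \<rho>0 u0 V 0 = 0"
  define K where "K = 1 + C * m"
  have "0 < C * m" using C m by simp
  then have K: "1 < K" by (simp add: K_def)
  have sol: "weak_solution \<gamma> T \<rho> u \<rho>0 u0" using adm by (simp add: entropy_admissible_def)
  note L = weak_solution_Linf[OF sol]
  have "AE z in lebesgue_on (slab T). norm (inverse (\<rho> z) * (\<rho> z - 1)) + norm (u z) \<le> m"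
    using dev m unfolding deviation_norm_def by (intro Linf_norm_add_le_AE) auto
  with L(3) have speed: "AE z in lebesgue_on (slab T). norm (rel_flux \<gamma> (\<rho> z) (u z)) \<le> K * rel_energy \<gamma> (\<rho> z) (u z)"
    unfolding K_def by eventually_elim (rule C(2), auto)
  have "Linf_norm V (\<lambda>z. inverse (\<rho>0 z) * (\<rho>0 z - 1)) = 0" "Linf_norm V u0 = 0"
    using V0 by (simp_all add: cone_deviation_def deviation_norm_def)
  from this[THEN Linf_norm_eq_0D]
  have "AE x in lebesgue. x \<in> V \<longrightarrow> inverse (\<rho>0 x) * (\<rho>0 x - 1) = 0" "AE x in lebesgue. x \<in> V \<longrightarrow> u0 x = 0"
    using V(1) by (simp_all add: AE_lebesgue_on_iff del: mult_eq_0_iff)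
  with L(6) have init: "AE x in lebesgue. x \<in> V \<longrightarrow> \<rho>0 x = 1 \<and> u0 x = 0"
    unfolding lebesgue_on_UNIV_eq by eventually_elim auto
  have Vne: "- V \<noteq> {}" using V(2) not_bounded_UNIV by (metis Compl_empty_eq double_complement)
  have quiet: "z \<notin> perturbation_supp (slab T) \<rho> u"
    if z: "fst z < T" "0 \<le> fst z" "K * fst z < infdist (snd z) (- V)" for z
  proof (rule cone_quiescent[OF adm T \<gamma>, where c = K and \<tau> = 0 and p = "snd z" and T' = T and r = "infdist (snd z) (- V)"])
    show "AE x in lebesgue. norm (x - snd z) < infdist (snd z) (- V) \<longrightarrow> \<rho>0 x = 1 \<and> u0 x = 0"
      using init
    proof eventually_elim
      case (elim x)
      have "x \<in> V" if "norm (x - snd z) < infdist (snd z) (- V)"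
      proof (rule ccontr)
        assume "x \<notin> V"
        then have "infdist (snd z) (- V) \<le> dist (snd z) x" by (intro infdist_le) auto
        then show False using that by (simp add: dist_norm norm_minus_commute)
      qed
      then show ?case using elim by blast
    qed
    show "AE y in lebesgue_on (slab T). fst y < 0 \<and> norm (snd y - snd z) < infdist (snd z) (- V) \<longrightarrow> \<rho> y = 1 \<and> u y = 0"
      by (rule AE_I2) (auto simp: mem_slab_iff)
  qed (use speed K z in \<open>auto elim!: eventually_mono\<close>)
  let ?A = "{\<alpha>. 0 \<le> \<alpha> \<and> \<alpha> \<le> 1 \<and> cone_deviation T \<rho> u \<rho>0 u0 V \<alpha> = 0}"
  have mem: "\<alpha> \<in> ?A" if \<alpha>: "0 < \<alpha>" "\<alpha> < inverse K" for \<alpha>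
  proof -
    let ?B = "cone_region T V \<alpha>"
    have B: "?B \<in> sets borel" "?B \<subseteq> slab T" unfolding cone_region_def by auto
    have Bl: "?B \<in> sets lebesgue" using B(1) by simp
    have sub: "fst z \<le> \<alpha> * infdist (snd z) (- V)" if "z \<in> ?B" for z
    proof -
      have "closure {z \<in> {0..} \<times> UNIV. cone_function V \<alpha> z \<noteq> 0} \<subseteq> {z. fst z \<le> \<alpha> * infdist (snd z) (- V)}"
      proof (rule closure_minimal)
        show "{z \<in> {0..} \<times> UNIV. cone_function V \<alpha> z \<noteq> 0} \<subseteq> {z. fst z \<le> \<alpha> * infdist (snd z) (- V)}"
          using \<alpha> by (auto simp: cone_function_def max_def field_simps split: if_splits)
        show "closed {z::spacetime. fst z \<le> \<alpha> * infdist (snd z) (- V)}"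
          by (intro closed_Collect_le continuous_intros)
      qed
      then show ?thesis using that by (auto simp: cone_region_def)
    qed
    have "AE z in lebesgue_on (slab T). z \<in> ?B \<longrightarrow> \<rho> z = 1 \<and> u z = 0"
      using AE_not_in_perturbation_supp[of "slab T" \<rho> u] AE_slab_time_neq[of 0 T]
    proof eventually_elim
      case (elim z)
      show ?case
      proof
        assume z: "z \<in> ?B"
        then have zs: "z \<in> slab T" using B by blast
        then have t: "0 < fst z" "fst z < T" using elim(2) by (auto simp: mem_slab_iff)
        then have "0 < \<alpha> * infdist (snd z) (- V)" using sub[OF z] by linarith
        then have d: "0 < infdist (snd z) (- V)" using \<alpha> by (simp add: zero_less_mult_iff)
        have "fst z < inverse K * infdist (snd z) (- V)"
          using sub[OF z] mult_strict_right_mono[OF \<alpha>(2) d] by linarith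
        then have "K * fst z < infdist (snd z) (- V)" using K by (simp add: field_simps)
        then show "\<rho> z = 1 \<and> u z = 0" using quiet[of z] t elim(1) zs by simp
      qed
    qed
    then have "AE z in lebesgue_on ?B. \<rho> z = 1 \<and> u z = 0"
      using B(2) Bl by (auto simp: AE_lebesgue_on_iff elim!: eventually_mono)
    moreover have "\<rho> \<in> borel_measurable (lebesgue_on ?B)" "u \<in> borel_measurable (lebesgue_on ?B)"
      using L(1,2)[THEN Linf_measurable] B(2) by (auto intro: measurable_restrict_mono)
    ultimately have "deviation_norm ?B \<rho> u = 0"
      unfolding deviation_norm_def by (subst (1 2) Linf_norm_eq_0I) (auto elim: eventually_mono)
    moreover have "inverse K \<le> 1" using K by (simp add: inverse_le_1_iff)
    ultimately show ?thesis using \<alpha> by (simp add: cone_deviation_def)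
  qed
  have bdd: "bdd_above ?A" by (auto simp: bdd_above_def)
  have "inverse K \<le> Sup ?A"
  proof (rule dense_le_bounded[of 0])
    show "0 < inverse K" using K by simp
    show "w \<le> Sup ?A" if "0 < w" "w < inverse K" for w
      using mem[OF that] bdd by (rule cSup_upper)
  qed
  then show "inverse (1 + C * m) \<le> Sup ?A" by (simp add: K_def)
qed

section \<open>The lifespan bound\<close>

definition cap :: "space \<Rightarrow> real \<Rightarrow> real \<Rightarrow> space set" where
  "cap \<omega> a b = {x. a \<le> \<omega> \<bullet> x \<and> norm x \<le> b}"

lemma compact_cap: "compact (cap \<omega> a b)"
proof -
  have "cap \<omega> a b = cball 0 b \<inter> {x. \<omega> \<bullet> x \<ge> a}" by (auto simp: cap_def)
  then show ?thesis by (simp add: compact_Int_closed closed_halfspace_ge)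
qed

text \<open>
  After a rotation the cap lies in a box of height \<open>b - a\<close> and half-width \<open>s\<close> with \<open>s\<^sup>2 = 2 (b - a) b\<close>, because
  \<open>b\<^sup>2 - a\<^sup>2 \<le> 2 b (b - a)\<close>.
\<close>

lemma measure_cap_le:
  assumes \<omega>: "norm \<omega> = 1" and ab: "0 \<le> a" "a \<le> b"
  shows "measure lebesgue (cap \<omega> a b) \<le> 8 * (b - a)\<^sup>2 * b"
proof -
  define e where "e = (axis 1 1 :: space)"
  have "norm e = norm \<omega>" using \<omega> by (simp add: e_def)
  then obtain f where f: "orthogonal_transformation f" "f e = \<omega>"
    using orthogonal_transformation_exists by metis
  have "f ` cap e a b = cap \<omega> a b"
  proof
    show "f ` cap e a b \<subseteq> cap \<omega> a b"
      using f by (auto simp: cap_def orthogonal_transformation_def orthogonal_transformation_norm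
          simp flip: f(2))
    show "cap \<omega> a b \<subseteq> f ` cap e a b"
    proof
      fix x assume x: "x \<in> cap \<omega> a b"
      obtain y where y: "x = f y" using orthogonal_transformation_surj[OF f(1)] by (metis surjD)
      have "\<omega> \<bullet> x = e \<bullet> y" "norm x = norm y"
        using f y by (auto simp: orthogonal_transformation_def orthogonal_transformation_norm simp flip: f(2))
      then show "x \<in> f ` cap e a b" using x y by (auto simp: cap_def)
    qed
  qed
  moreover have capl: "cap e a b \<in> lmeasurable" by (rule lmeasurable_compact[OF compact_cap])
  ultimately have eq: "measure lebesgue (cap \<omega> a b) = measure lebesgue (cap e a b)"
    using measure_orthogonal_image[OF f(1)] by metis
  define s where "s = sqrt (2 * (b - a) * b)"
  have s: "0 \<le> s" "s\<^sup>2 = 2 * (b - a) * b" using ab by (auto simp: s_def)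
  let ?l = "vector [a, - s, - s] :: space" and ?u = "vector [b, s, s] :: space"
  have sub: "cap e a b \<subseteq> cbox ?l ?u"
  proof
    fix x assume "x \<in> cap e a b"
    then have x: "a \<le> x $ 1" "norm x \<le> b" by (auto simp: cap_def e_def inner_axis' )
    have "(norm x)\<^sup>2 \<le> b\<^sup>2" using x by (intro power_mono) auto
    then have n: "(x $ 1)\<^sup>2 + (x $ 2)\<^sup>2 + (x $ 3)\<^sup>2 \<le> b\<^sup>2"
      unfolding power2_norm_eq_inner by (simp add: inner_vec_def sum_3 power2_eq_square)
    have "a\<^sup>2 \<le> (x $ 1)\<^sup>2" using x ab by (intro power_mono) auto
    moreover have "b\<^sup>2 - a\<^sup>2 \<le> 2 * (b - a) * b"
    proof -
      have "b\<^sup>2 - a\<^sup>2 = (b - a) * (b + a)" by (simp add: power2_eq_square algebra_simps)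
      also have "\<dots> \<le> (b - a) * (2 * b)" using ab by (intro mult_left_mono) auto
      finally show ?thesis by (simp add: algebra_simps)
    qed
    ultimately have "(x $ 2)\<^sup>2 + (x $ 3)\<^sup>2 \<le> s\<^sup>2" using n s by linarith
    moreover have "0 \<le> (x $ 2)\<^sup>2" "0 \<le> (x $ 3)\<^sup>2" by auto
    ultimately have "(x $ 2)\<^sup>2 \<le> s\<^sup>2" "(x $ 3)\<^sup>2 \<le> s\<^sup>2" by linarith+
    then have "\<bar>x $ 2\<bar> \<le> s" "\<bar>x $ 3\<bar> \<le> s" using s abs_le_square_iff[of _ s] by auto
    moreover have "x $ 1 \<le> b" using component_le_norm_cart[of x 1] x by simp
    ultimately show "x \<in> cbox ?l ?u" using x by (auto simp: mem_box_cart forall_3)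
  qed
  have "measure lebesgue (cap e a b) \<le> measure lebesgue (cbox ?l ?u)"
    by (rule measure_mono_fmeasurable[OF sub]) (use capl in auto)
  also have "\<dots> = (b - a) * (2 * s) * (2 * s)"
  proof -
    have ne: "cbox ?l ?u \<noteq> {}" using ab s by (auto simp: interval_ne_empty_cart forall_3)
    have "(\<Prod>i\<in>UNIV. ?u $ i - ?l $ i) = (?u $ 1 - ?l $ 1) * ((?u $ 2 - ?l $ 2) * (?u $ 3 - ?l $ 3))"
      unfolding UNIV_3 by simp
    also have "\<dots> = (b - a) * (2 * s) * (2 * s)" by simp
    finally show ?thesis using content_cbox_cart[OF ne] by simp
  qed
  also have "\<dots> = 4 * (b - a) * s\<^sup>2" by (simp add: power2_eq_square)
  also have "\<dots> = 8 * (b - a)\<^sup>2 * b" unfolding s(2) by (simp add: power2_eq_square algebra_simps)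
  finally show ?thesis using eq by simp
qed

definition cap_tube :: "space \<Rightarrow> real \<Rightarrow> real \<Rightarrow> spacetime set" where
  "cap_tube \<omega> k S = {z. 0 \<le> fst z \<and> fst z \<le> S \<and> snd z \<in> cap \<omega> (k + fst z) (1 + fst z)}"

lemma closed_cap_tube: "closed (cap_tube \<omega> k S)"
  unfolding cap_tube_def cap_def mem_Collect_eq
  by (intro closed_Collect_conj closed_Collect_le continuous_intros)

text \<open>
  The volume of the cap grows at most linearly in time, so the weight \<open>(1 + t)\<^sup>-\<^sup>2\<close> leaves a logarithm.
\<close>

lemma cap_tube_log_integral:
  assumes \<omega>: "norm \<omega> = 1" and k: "0 \<le> k" "k < 1" and S: "0 \<le> S" and A: "0 \<le> A"
  defines "b \<equiv> \<lambda>z. indicat_real (cap_tube \<omega> k S) z * (A / (1 + fst z)\<^sup>2)"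
  shows "integrable lebesgue b" "(LINT z|lebesgue. b z) \<le> 8 * A * (1 - k)\<^sup>2 * ln (1 + S)"
proof -
  have D [measurable]: "cap_tube \<omega> k S \<in> sets borel" by (simp add: borel_closed closed_cap_tube)
  have [measurable]: "(fst :: spacetime \<Rightarrow> real) \<in> borel_measurable borel"
    by (intro borel_measurable_continuous_onI continuous_intros)
  have b [measurable]: "b \<in> borel_measurable borel" unfolding b_def by measurable
  have b0: "0 \<le> b z" for z using A by (simp add: b_def)
  have "(\<integral>\<^sup>+ z. ennreal (b z) \<partial>lebesgue) = (\<integral>\<^sup>+ z. ennreal (b z) \<partial>lborel)"
    by (simp add: nn_integral_completion)
  also have "\<dots> = (\<integral>\<^sup>+ z. ennreal (b z) \<partial>(lborel \<Otimes>\<^sub>M lborel))" by (simp add: lborel_prod)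
  also have "\<dots> = (\<integral>\<^sup>+ t. \<integral>\<^sup>+ x. ennreal (b (t, x)) \<partial>lborel \<partial>lborel)"
  proof (rule lborel.nn_integral_fst[symmetric])
    show "(\<lambda>z. ennreal (b z)) \<in> borel_measurable (lborel \<Otimes>\<^sub>M lborel)"
      unfolding lborel_prod by measurable
  qed
  also have "\<dots> \<le> (\<integral>\<^sup>+ t. ennreal (8 * A * (1 - k)\<^sup>2 / (1 + t)) * indicator {0..S} t \<partial>lborel)"
  proof (rule nn_integral_mono)
    fix t :: real
    show "(\<integral>\<^sup>+ x. ennreal (b (t, x)) \<partial>lborel) \<le> ennreal (8 * A * (1 - k)\<^sup>2 / (1 + t)) * indicator {0..S} t"
    proof (cases "0 \<le> t \<and> t \<le> S")
      case False
      then show ?thesis by (auto simp: b_def cap_tube_def)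
    next
      case True
      let ?c = "cap \<omega> (k + t) (1 + t)"
      have cm: "?c \<in> sets borel" "?c \<in> lmeasurable"
        using compact_cap by (auto intro: borel_compact lmeasurable_compact)
      have "(\<integral>\<^sup>+ x. ennreal (b (t, x)) \<partial>lborel) = (\<integral>\<^sup>+ x. ennreal (A / (1 + t)\<^sup>2) * indicator ?c x \<partial>lborel)"
        using True by (intro nn_integral_cong) (auto simp: b_def cap_tube_def indicator_def)
      also have "\<dots> = ennreal (A / (1 + t)\<^sup>2) * emeasure lborel ?c"
        using cm by (intro nn_integral_cmult_indicator) auto
      also have "emeasure lborel ?c = ennreal (measure lebesgue ?c)"
        using cm emeasure_compact_finite[OF compact_cap]
        by (simp add: emeasure_eq_ennreal_measure less_top)
      also have "ennreal (A / (1 + t)\<^sup>2) * \<dots> = ennreal (A / (1 + t)\<^sup>2 * measure lebesgue ?c)"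
        using A by (intro ennreal_mult[symmetric]) auto
      also have "\<dots> \<le> ennreal (8 * A * (1 - k)\<^sup>2 / (1 + t))"
      proof (rule ennreal_leI)
        have "A / (1 + t)\<^sup>2 * measure lebesgue ?c \<le> A / (1 + t)\<^sup>2 * (8 * ((1 + t) - (k + t))\<^sup>2 * (1 + t))"
          using True k A by (intro mult_left_mono measure_cap_le \<omega>) auto
        also have "\<dots> = 8 * A * (1 - k)\<^sup>2 / (1 + t)"
          using True by (simp add: power2_eq_square divide_simps) 
        finally show "A / (1 + t)\<^sup>2 * measure lebesgue ?c \<le> 8 * A * (1 - k)\<^sup>2 / (1 + t)" .
      qed
      finally show ?thesis using True by simp
    qed
  qed
  also have "\<dots> = ennreal (8 * A * (1 - k)\<^sup>2 * ln (1 + S) - 8 * A * (1 - k)\<^sup>2 * ln (1 + 0))"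
  proof (rule nn_integral_FTC_Icc[where F = "\<lambda>t. 8 * A * (1 - k)\<^sup>2 * ln (1 + t)"])
    fix t assume "t \<in> {0..S}"
    then have t: "0 \<le> t" "t \<le> S" by auto
    show "((\<lambda>t. 8 * A * (1 - k)\<^sup>2 * ln (1 + t)) has_real_derivative 8 * A * (1 - k)\<^sup>2 / (1 + t)) (at t)"
      using t by (auto intro!: derivative_eq_intros)
    show "0 \<le> 8 * A * (1 - k)\<^sup>2 / (1 + t)" using t A by simp
  qed (use S in auto)
  finally have le: "(\<integral>\<^sup>+ z. ennreal (b z) \<partial>lebesgue) \<le> ennreal (8 * A * (1 - k)\<^sup>2 * ln (1 + S))" by simp
  show int: "integrable lebesgue b"
  proof (rule integrableI_nonneg)
    show "b \<in> borel_measurable lebesgue" using b by (simp add: measurable_completion)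
    show "(\<integral>\<^sup>+ z. ennreal (b z) \<partial>lebesgue) < \<infinity>" using le by (rule order_le_less_trans) simp
  qed (use b0 in auto)
  have "ennreal (LINT z|lebesgue. b z) \<le> ennreal (8 * A * (1 - k)\<^sup>2 * ln (1 + S))"
    using le b0 by (subst (asm) nn_integral_eq_integral[OF int]) auto
  moreover have "0 \<le> 8 * A * (1 - k)\<^sup>2 * ln (1 + S)" using A S by simp
  ultimately show "(LINT z|lebesgue. b z) \<le> 8 * A * (1 - k)\<^sup>2 * ln (1 + S)"
    by (simp add: ennreal_le_iff)
qed

text \<open>
  The time cutoff is a power of the function that decreases from one to zero linearly in \<open>log (1 + t)\<close>.
\<close>

definition log_cutoff :: "real \<Rightarrow> real \<Rightarrow> real" where
  "log_cutoff S t = max 0 (1 - ln (1 + t) / ln (1 + S))"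

definition height :: "space \<Rightarrow> real \<Rightarrow> spacetime \<Rightarrow> real" where
  "height \<omega> k z = max 0 (\<omega> \<bullet> snd z - k - fst z)"

text \<open>
  The lateral cutoff equals one inside the sonic cone, where this function is nonpositive, and vanishes
  where it exceeds one. For \<open>n\<close> tending to infinity the transition layer shrinks to the boundary of the cone.
\<close>

definition cone_excess :: "nat \<Rightarrow> spacetime \<Rightarrow> real" where
  "cone_excess n z = real (Suc n) * ((norm (snd z))\<^sup>2 - (1 + fst z)\<^sup>2)"

definition lateral_cutoff :: "real \<Rightarrow> real" where
  "lateral_cutoff q = (max 0 (1 - (max 0 q)\<^sup>2))\<^sup>2"

definition lateral_cutoff' :: "real \<Rightarrow> real" where
  "lateral_cutoff' q = 2 * max 0 (1 - (max 0 q)\<^sup>2) * - (2 * max 0 q)"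

lemma lateral_cutoff_inside: "q \<le> 0 \<Longrightarrow> lateral_cutoff q = 1" "q \<le> 0 \<Longrightarrow> lateral_cutoff' q = 0"
  by (simp_all add: lateral_cutoff_def lateral_cutoff'_def)

lemma lateral_cutoff_outside: "1 \<le> q \<Longrightarrow> lateral_cutoff q = 0"
proof -
  assume "1 \<le> q"
  then have "1 \<le> q\<^sup>2" by simp
  then show ?thesis using \<open>1 \<le> q\<close> by (simp add: lateral_cutoff_def)
qed

lemma lateral_cutoff_bounds: "0 \<le> lateral_cutoff q" "lateral_cutoff q \<le> 1"
  by (auto simp: lateral_cutoff_def power_le_one)

lemma lateral_cutoff_has_derivative:
  assumes "(f has_derivative f') (at z)"
  shows "((\<lambda>z. lateral_cutoff (f z)) has_derivative (\<lambda>h. lateral_cutoff' (f z) * f' h)) (at z)"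
proof -
  have "((\<lambda>z. 1 - (max 0 (f z))\<^sup>2) has_derivative (\<lambda>h. - (2 * max 0 (f z) * f' h))) (at z)"
    using has_derivative_diff[OF has_derivative_const has_derivative_pos_part_square[OF assms], of 1] by simp
  from has_derivative_pos_part_square[OF this] show ?thesis
    unfolding lateral_cutoff_def lateral_cutoff'_def by (simp add: mult_ac)
qed

definition moment_test :: "nat \<Rightarrow> space \<Rightarrow> real \<Rightarrow> real \<Rightarrow> nat \<Rightarrow> spacetime \<Rightarrow> real" where
  "moment_test N \<omega> k S n z =
     log_cutoff S (fst z) ^ Suc (Suc N) * ((height \<omega> k z)\<^sup>2 / 2) * lateral_cutoff (cone_excess n z)"

definition moment_test_dt :: "nat \<Rightarrow> space \<Rightarrow> real \<Rightarrow> real \<Rightarrow> nat \<Rightarrow> spacetime \<Rightarrow> real" where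
  "moment_test_dt N \<omega> k S n z =
     (let th = log_cutoff S (fst z); s = height \<omega> k z; q = cone_excess n z in
      - (real (Suc (Suc N)) * th ^ Suc N / ((1 + fst z) * ln (1 + S))) * (s\<^sup>2 / 2) * lateral_cutoff q
      - th ^ Suc (Suc N) * s * lateral_cutoff q
      - th ^ Suc (Suc N) * (s\<^sup>2 / 2) * lateral_cutoff' q * (real (Suc n) * (2 * (1 + fst z))))"

definition moment_test_dx :: "nat \<Rightarrow> space \<Rightarrow> real \<Rightarrow> real \<Rightarrow> nat \<Rightarrow> spacetime \<Rightarrow> space" where
  "moment_test_dx N \<omega> k S n z =
     (let th = log_cutoff S (fst z); s = height \<omega> k z; q = cone_excess n z in
      (th ^ Suc (Suc N) * s * lateral_cutoff q) *\<^sub>R \<omega>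
      + (th ^ Suc (Suc N) * (s\<^sup>2 / 2) * lateral_cutoff' q * (real (Suc n) * 2)) *\<^sub>R snd z)"

lemma moment_test_C1_test:
  assumes S: "0 < S" "S < T"
  shows "C1_test T (moment_test N \<omega> k S n) (moment_test_dt N \<omega> k S n) (moment_test_dx N \<omega> k S n)"
  unfolding C1_test_def
proof (intro conjI ballI)
  have L: "0 < ln (1 + S)" using S by simp
  fix z assume "z \<in> time_domain"
  then have t: "0 < 1 + fst z" by (simp add: time_domain_def)
  have "((\<lambda>z::spacetime. 1 - ln (1 + fst z) / ln (1 + S)) has_derivative
      (\<lambda>h. - (fst h / ((1 + fst z) * ln (1 + S))))) (at z)"
  proof -
    have "((\<lambda>z::spacetime. ln (1 + fst z)) has_derivative (\<lambda>h. fst h / (1 + fst z))) (at z)"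
      using t by (auto intro!: derivative_eq_intros simp: divide_inverse)
    then have "((\<lambda>z::spacetime. ln (1 + fst z) / ln (1 + S)) has_derivative
        (\<lambda>h. fst h / (1 + fst z) / ln (1 + S))) (at z)"
      by (rule bounded_linear.has_derivative[OF bounded_linear_divide])
    from has_derivative_diff[OF has_derivative_const[of 1] this] show ?thesis by simp
  qed
  from has_derivative_pos_part_power[OF this, of N]
  have 1: "((\<lambda>z::spacetime. log_cutoff S (fst z) ^ Suc (Suc N)) has_derivative
     (\<lambda>h. real (Suc (Suc N)) * log_cutoff S (fst z) ^ Suc N * - (fst h / ((1 + fst z) * ln (1 + S))))) (at z)"
    unfolding log_cutoff_def .
  have "((\<lambda>z. \<omega> \<bullet> snd z - k - fst z) has_derivative (\<lambda>h. \<omega> \<bullet> snd h - fst h)) (at z)"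
    by (auto intro!: derivative_eq_intros)
  from has_derivative_pos_part_square[OF this]
  have 2: "((\<lambda>z. (height \<omega> k z)\<^sup>2) has_derivative (\<lambda>h. 2 * height \<omega> k z * (\<omega> \<bullet> snd h - fst h))) (at z)"
    unfolding height_def .
  have 2: "((\<lambda>z. (height \<omega> k z)\<^sup>2 / 2) has_derivative (\<lambda>h. height \<omega> k z * (\<omega> \<bullet> snd h - fst h))) (at z)"
    by (rule has_derivative_eq_rhs[OF bounded_linear.has_derivative[OF bounded_linear_divide 2]]) auto
  have "(cone_excess n has_derivative (\<lambda>h. real (Suc n) * (2 * (snd z \<bullet> snd h) - 2 * (1 + fst z) * fst h))) (at z)"
    unfolding cone_excess_def power2_norm_eq_inner power2_eq_square[of "1 + fst _"]
    by (auto intro!: derivative_eq_intros simp: inner_commute algebra_simps)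
  note 3 = lateral_cutoff_has_derivative[OF this]
  show "(moment_test N \<omega> k S n has_derivative
      (\<lambda>h. moment_test_dt N \<omega> k S n z * fst h + moment_test_dx N \<omega> k S n z \<bullet> snd h)) (at z)"
    unfolding moment_test_def
    by (rule has_derivative_eq_rhs[OF has_derivative_mult[OF has_derivative_mult[OF 1 2] 3]])
       (auto simp: moment_test_dt_def moment_test_dx_def Let_def algebra_simps inner_add_left add_divide_distrib diff_divide_distrib)
next
  have L: "ln (1 + S) \<noteq> 0" using S by simp
  have t: "1 + fst z \<noteq> 0" "\<not> (1 + fst z \<le> 0)" "0 < 1 + fst z" if "z \<in> time_domain" for z
    using that by (auto simp: time_domain_def)
  have a: "continuous_on time_domain (\<lambda>z. log_cutoff S (fst z))"
    unfolding log_cutoff_def using t L by (intro continuous_intros) auto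
  have b: "continuous_on time_domain (height \<omega> k)"
    unfolding height_def by (intro continuous_intros)
  have c: "continuous_on time_domain (cone_excess n)"
    unfolding cone_excess_def by (intro continuous_intros)
  have d: "continuous_on time_domain (\<lambda>z. lateral_cutoff (cone_excess n z))"
      "continuous_on time_domain (\<lambda>z. lateral_cutoff' (cone_excess n z))"
    unfolding lateral_cutoff_def lateral_cutoff'_def by (intro continuous_intros c)+
  show "continuous_on time_domain (moment_test_dt N \<omega> k S n)"
    unfolding moment_test_dt_def Let_def using t L by (intro continuous_intros a b d) auto
  show "continuous_on time_domain (moment_test_dx N \<omega> k S n)"
    unfolding moment_test_dx_def Let_def by (intro continuous_intros a b d) auto
next
  have L: "0 < ln (1 + S)" using S by simp
  have "fst z \<le> S \<and> norm (snd z) \<le> 2 + S" if z: "z \<in> time_domain" and nz: "moment_test N \<omega> k S n z \<noteq> 0" for z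
  proof
    have t: "0 < 1 + fst z" using z by (simp add: time_domain_def)
    have "log_cutoff S (fst z) \<noteq> 0" using nz by (auto simp: moment_test_def)
    then have "ln (1 + fst z) < ln (1 + S)" using L by (auto simp: log_cutoff_def max_def field_simps split: if_splits)
    then show tS: "fst z \<le> S" using t S by simp
    have "\<not> 1 \<le> cone_excess n z" using nz lateral_cutoff_outside by (auto simp: moment_test_def)
    then have "real (Suc n) * ((norm (snd z))\<^sup>2 - (1 + fst z)\<^sup>2) < 1" by (simp add: cone_excess_def)
    then have "(norm (snd z))\<^sup>2 - (1 + fst z)\<^sup>2 < 1"
      by (smt (verit) mult_le_cancel_right1 of_nat_0_le_iff of_nat_Suc)
    moreover have "(1 + fst z)\<^sup>2 \<le> (1 + S)\<^sup>2" using t tS by (intro power_mono) auto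
    ultimately have "(norm (snd z))\<^sup>2 \<le> 1 + (1 + S)\<^sup>2" by linarith
    also have "\<dots> \<le> (2 + S)\<^sup>2" using S by (simp add: power2_eq_square algebra_simps)
    finally show "norm (snd z) \<le> 2 + S" by (rule power2_le_imp_le) (use S in simp)
  qed
  with S show "\<exists>S'<T. \<exists>R. \<forall>z\<in>time_domain. moment_test N \<omega> k S n z \<noteq> 0 \<longrightarrow> fst z \<le> S' \<and> norm (snd z) \<le> R"
    by blast
qed

text \<open>
  Outside the sonic cone the state is the constant one and the flux vanishes, so only points where the lateral cutoff is
  one contribute. There the terms with a derivative of the height combine to
  \<open>\<theta>\<^sup>N\<^sup>+\<^sup>2 s (r y\<^sup>2 + P(r))\<close> with \<open>y = \<omega> \<bullet> v\<close>, which dominates the term with the derivative of the time cutoff by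
  hypothesis \<open>B\<close>, up to a quadratic error in \<open>a\<close>.
\<close>

lemma moment_test_flux_bound:
  assumes \<gamma>: "1 < \<gamma>" and \<omega>: "norm \<omega> = 1" and k: "k < 1" and S: "0 < S"
    and a: "(real (Suc (Suc N)) / 2) * ((1 - k) / ln (1 + S)) \<le> M"
    and B: "0 \<le> B" "\<And>r v \<theta> a. 0 < r \<Longrightarrow> 0 < \<theta> \<Longrightarrow> \<theta> \<le> 1 \<Longrightarrow> 0 \<le> a \<Longrightarrow> a \<le> M \<Longrightarrow>
       \<bar>r - 1 + r * v\<bar> * (\<theta> powr (real (Suc (Suc N)) - 1) * a)
         \<le> \<theta> powr real (Suc (Suc N)) * (r * v\<^sup>2 + rel_pressure \<gamma> r) + B * a\<^sup>2"
    and r: "0 < r" and t: "0 \<le> fst z"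
    and quiet: "k + fst z < \<omega> \<bullet> snd z \<Longrightarrow> 1 + fst z < norm (snd z) \<Longrightarrow> fst z < S \<Longrightarrow> r = 1 \<and> v = 0"
  shows "- ((r - 1 + r * (\<omega> \<bullet> v)) * moment_test_dt N \<omega> k S n z
        + (1 + \<omega> \<bullet> v) * ((r *\<^sub>R v) \<bullet> moment_test_dx N \<omega> k S n z)
        + (r powr \<gamma> - 1) / \<gamma> * (moment_test_dx N \<omega> k S n z \<bullet> \<omega>))
     \<le> indicat_real (cap_tube \<omega> k S) z
        * (B * (real (Suc (Suc N)) / 2)\<^sup>2 * (1 - k) ^ 3 / (ln (1 + S))\<^sup>2 / (1 + fst z)\<^sup>2)"
    (is "- ?I \<le> ?b")
proof -
  define P where "P = real (Suc (Suc N))"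
  define L where "L = ln (1 + S)"
  define th where "th = log_cutoff S (fst z)"
  define s where "s = height \<omega> k z"
  define q where "q = cone_excess n z"
  define y where "y = \<omega> \<bullet> v"
  have L: "0 < L" using S by (simp add: L_def)
  have g: "moment_test_dt N \<omega> k S n z = - (P * th ^ Suc N / ((1 + fst z) * L)) * (s\<^sup>2 / 2) * lateral_cutoff q
      - th ^ Suc (Suc N) * s * lateral_cutoff q
      - th ^ Suc (Suc N) * (s\<^sup>2 / 2) * lateral_cutoff' q * (real (Suc n) * (2 * (1 + fst z)))"
    by (simp add: moment_test_dt_def Let_def P_def L_def th_def s_def q_def)
  have G: "moment_test_dx N \<omega> k S n z = (th ^ Suc (Suc N) * s * lateral_cutoff q) *\<^sub>R \<omega>
      + (th ^ Suc (Suc N) * (s\<^sup>2 / 2) * lateral_cutoff' q * (real (Suc n) * 2)) *\<^sub>R snd z"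
    by (simp add: moment_test_dx_def Let_def th_def s_def q_def)
  have b0: "0 \<le> ?b" using B k by (auto simp: indicator_def)
  have th0: "0 \<le> th" by (simp add: th_def log_cutoff_def)
  have s0: "0 \<le> s" by (simp add: s_def height_def)
  show ?thesis
  proof (cases "th = 0 \<or> s = 0")
    case True
    then have "moment_test_dt N \<omega> k S n z = 0" "moment_test_dx N \<omega> k S n z = 0" unfolding g G by auto
    then have I0: "?I = 0" by simp
    show ?thesis unfolding I0 using b0 by simp
  next
    case False
    then have "0 < th" "0 < s" using th0 s0 by auto
    then have "ln (1 + fst z) < L" and x: "k + fst z < \<omega> \<bullet> snd z" and sx: "s = \<omega> \<bullet> snd z - k - fst z"
      using L by (auto simp: th_def s_def log_cutoff_def height_def L_def max_def field_simps split: if_splits)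
    then have tS: "fst z < S" using t S by (simp add: L_def)
    show ?thesis
    proof (cases "1 + fst z < norm (snd z)")
      case True
      then have "r = 1 \<and> v = 0" using quiet x tS by blast
      then have I0: "?I = 0" by simp
      show ?thesis unfolding I0 using b0 by simp
    next
      case False
      have "(norm (snd z))\<^sup>2 \<le> (1 + fst z)\<^sup>2" using False by (intro power_mono) auto
      then have "q \<le> 0" by (auto simp: q_def cone_excess_def intro: mult_nonneg_nonpos)
      note lat = lateral_cutoff_inside[OF this]
      have g': "moment_test_dt N \<omega> k S n z = - (P * th ^ Suc N / ((1 + fst z) * L)) * (s\<^sup>2 / 2) - th ^ Suc (Suc N) * s"
        unfolding g lat by simp
      have G': "moment_test_dx N \<omega> k S n z = (th ^ Suc (Suc N) * s) *\<^sub>R \<omega>"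
        unfolding G lat by simp
      have "\<omega> \<bullet> snd z \<le> norm (snd z)" using norm_cauchy_schwarz[of \<omega> "snd z"] \<omega> by simp
      then have s1: "s \<le> 1 - k" using False sx by simp
      \<comment> \<open>\<open>th\<^sup>N\<^sup>+\<^sup>1 a\<close> is the rate of decay of the time cutoff times half the height\<close>
      define a where "a = P / 2 * s / ((1 + fst z) * L)"
      have a0: "0 \<le> a" using s0 t L by (simp add: a_def P_def)
      have aM: "a \<le> M"
      proof -
        have "a = P / 2 * (s / ((1 + fst z) * L))" by (simp add: a_def)
        also have "\<dots> \<le> P / 2 * ((1 - k) / L)"
        proof (rule mult_left_mono)
          have "L \<le> (1 + fst z) * L" using t L by (simp add: distrib_right)
          then show "s / ((1 + fst z) * L) \<le> (1 - k) / L" using s1 s0 L k by (intro frac_le) auto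
        qed (simp add: P_def)
        finally show ?thesis using assms(5) by (simp add: P_def L_def)
      qed
      have th1: "th \<le> 1"
      proof -
        have "0 \<le> ln (1 + fst z) / L" using t L by simp
        then show ?thesis by (simp add: th_def log_cutoff_def L_def)
      qed
      have p1: "th powr (real (Suc (Suc N)) - 1) = th ^ Suc N"
        using \<open>0 < th\<close> powr_realpow[of th "Suc N"] by simp
      have p2: "th powr real (Suc (Suc N)) = th ^ Suc (Suc N)"
        using \<open>0 < th\<close> by (rule powr_realpow)
      have young: "\<bar>r - 1 + r * y\<bar> * (th ^ Suc N * a) \<le> th ^ Suc (Suc N) * (r * y\<^sup>2 + rel_pressure \<gamma> r) + B * a\<^sup>2"
        using B(2)[OF r \<open>0 < th\<close> th1 a0 aM, of y] unfolding p1 p2 .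
      have "- ?I = s * ((r - 1 + r * y) * (th ^ Suc N * a) - th ^ Suc (Suc N) * (r * y\<^sup>2 + rel_pressure \<gamma> r))"
      proof -
        have 1: "- (P * th ^ Suc N / ((1 + fst z) * L)) * (s\<^sup>2 / 2) = - (s * (th ^ Suc N * a))"
          by (simp add: a_def power2_eq_square mult_ac)
        have \<omega>\<omega>: "\<omega> \<bullet> \<omega> = 1" using \<omega> by (simp add: norm_eq_1)
        have 2: "(r *\<^sub>R v) \<bullet> ((th ^ Suc (Suc N) * s) *\<^sub>R \<omega>) = th ^ Suc (Suc N) * s * (r * y)"
          by (simp add: y_def inner_commute)
        have 3: "((th ^ Suc (Suc N) * s) *\<^sub>R \<omega>) \<bullet> \<omega> = th ^ Suc (Suc N) * s"
          using \<omega>\<omega> by simp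
        show ?thesis
          unfolding g' G' 1 2 3 rel_pressure_def y_def[symmetric]
          by (simp add: algebra_simps power2_eq_square del: power_Suc)
      qed
      also have "\<dots> \<le> s * (B * a\<^sup>2)"
      proof (rule mult_left_mono[OF _ s0])
        have "(r - 1 + r * y) * (th ^ Suc N * a) \<le> \<bar>r - 1 + r * y\<bar> * (th ^ Suc N * a)"
          using th0 a0 by (intro mult_right_mono) auto
        then show "(r - 1 + r * y) * (th ^ Suc N * a) - th ^ Suc (Suc N) * (r * y\<^sup>2 + rel_pressure \<gamma> r) \<le> B * a\<^sup>2"
          using young by linarith
      qed
      also have "\<dots> = B * (P / 2)\<^sup>2 * s ^ 3 / L\<^sup>2 / (1 + fst z)\<^sup>2"
      proof -
        have "s * (B * (P / 2 * s / (c * L))\<^sup>2) = B * (P / 2)\<^sup>2 * s ^ 3 / L\<^sup>2 / c\<^sup>2" for c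
          by (simp add: power_divide power_mult_distrib power2_eq_square power3_eq_cube mult_ac)
        then show ?thesis unfolding a_def .
      qed
      also have "\<dots> \<le> B * (P / 2)\<^sup>2 * (1 - k) ^ 3 / L\<^sup>2 / (1 + fst z)\<^sup>2"
        using s1 s0 B by (intro divide_right_mono mult_left_mono power_mono) auto
      also have "\<dots> = ?b"
      proof -
        have "z \<in> cap_tube \<omega> k S" using t tS x False by (auto simp: cap_tube_def cap_def)
        then show ?thesis by (simp add: P_def L_def)
      qed
      finally show ?thesis .
    qed
  qed
qed

text \<open>
  Shrinking the lateral transition layer to the boundary of the unit ball turns the initial term into \<open>w0\<close>, while
  the bound for the space-time integral does not depend on the layer.
\<close>

lemma w0_le_log:
  assumes sol: "weak_solution \<gamma> T \<rho> u \<rho>0 u0" and \<gamma>: "1 < \<gamma>" and \<omega>: "norm \<omega> = 1"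
    and k: "0 \<le> k" "k < 1" and S: "0 < S" "S < T"
    and a: "(real (Suc (Suc N)) / 2) * ((1 - k) / ln (1 + S)) \<le> M"
    and B: "0 \<le> B" "\<And>r v \<theta> a. 0 < r \<Longrightarrow> 0 < \<theta> \<Longrightarrow> \<theta> \<le> 1 \<Longrightarrow> 0 \<le> a \<Longrightarrow> a \<le> M \<Longrightarrow>
       \<bar>r - 1 + r * v\<bar> * (\<theta> powr (real (Suc (Suc N)) - 1) * a)
         \<le> \<theta> powr real (Suc (Suc N)) * (r * v\<^sup>2 + rel_pressure \<gamma> r) + B * a\<^sup>2"
    and quiet: "AE z in lebesgue_on (slab T). k + fst z < \<omega> \<bullet> snd z \<and> 1 + fst z < norm (snd z) \<and> fst z < S
        \<longrightarrow> \<rho> z = 1 \<and> u z = 0"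
  shows "w0 \<omega> \<rho>0 u0 k \<le> 8 * (B * (real (Suc (Suc N)) / 2)\<^sup>2) * (1 - k) ^ 5 / ln (1 + S)"
proof -
  define A where "A = B * (real (Suc (Suc N)) / 2)\<^sup>2 * (1 - k) ^ 3 / (ln (1 + S))\<^sup>2"
  have T: "0 < T" using S by simp
  have L: "0 < ln (1 + S)" using S by simp
  have A: "0 \<le> A" using B k by (simp add: A_def)
  note Li = weak_solution_Linf[OF sol]
  define b where "b z = indicat_real (cap_tube \<omega> k S) z * (A / (1 + fst z)\<^sup>2)" for z :: spacetime
  define F where "F x = \<omega> \<bullet> (\<rho>0 x *\<^sub>R u0 x) + \<rho>0 x - 1" for x
  have FL: "F \<in> Linf UNIV"
    unfolding F_def[abs_def] by (intro Linf_add Linf_diff Linf_inner Linf_scaleR Linf_const Li)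
  have tube: "cap_tube \<omega> k S \<subseteq> slab T" using S by (auto simp: cap_tube_def mem_slab_iff)
  have bint: "integrable lebesgue b" and ble: "(LINT z|lebesgue. b z) \<le> 8 * A * (1 - k)\<^sup>2 * ln (1 + S)"
    unfolding b_def[abs_def] by (rule cap_tube_log_integral; use \<omega> k S A in simp)+
  have bres: "indicator (slab T) z *\<^sub>R b z = b z" for z
    using tube by (auto simp: b_def indicator_def)
  have bint': "integrable (lebesgue_on (slab T)) b"
    using bint by (subst integrable_restrict_space) (simp_all only: bres slab_sets_lebesgue space_completion space_lborel space_borel Int_UNIV_right)
  have bl: "(LINT z|lebesgue_on (slab T). b z) = (LINT z|lebesgue. b z)"
    by (subst integral_restrict_space) (simp_all only: bres slab_sets_lebesgue space_completion space_lborel space_borel Int_UNIV_right)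
  have J: "(LINT x|lebesgue. F x * moment_test N \<omega> k S n (0, x)) \<le> 8 * A * (1 - k)\<^sup>2 * ln (1 + S)" for n
  proof -
    let ?I = "\<lambda>z. (\<rho> z - 1 + \<rho> z * (\<omega> \<bullet> u z)) * moment_test_dt N \<omega> k S n z
        + (1 + \<omega> \<bullet> u z) * ((\<rho> z *\<^sub>R u z) \<bullet> moment_test_dx N \<omega> k S n z)
        + (\<rho> z powr \<gamma> - 1) / \<gamma> * (moment_test_dx N \<omega> k S n z \<bullet> \<omega>)"
    have test: "C1_test T (moment_test N \<omega> k S n) (moment_test_dt N \<omega> k S n) (moment_test_dx N \<omega> k S n)"
      by (rule moment_test_C1_test[OF S])
    have "(LINT x|lebesgue. F x * moment_test N \<omega> k S n (0, x)) = - (LINT z|lebesgue_on (slab T). ?I z)"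
      using relative_identity[OF sol T \<gamma> test \<omega>] unfolding F_def by linarith
    also have "\<dots> = (LINT z|lebesgue_on (slab T). - ?I z)" by (rule Bochner_Integration.integral_minus[symmetric])
    also have "\<dots> \<le> (LINT z|lebesgue_on (slab T). b z)"
    proof (rule integral_mono_AE[OF Bochner_Integration.integrable_minus[OF relative_identity_integrable(1)[OF sol T \<gamma> test]] bint'])
      have "AE z in lebesgue_on (slab T). 0 \<le> fst z" by (rule AE_I2) (auto simp: mem_slab_iff)
      with quiet Li(3) show "AE z in lebesgue_on (slab T). - ?I z \<le> b z"
      proof eventually_elim
        case (elim z)
        show ?case
          unfolding b_def A_def
          by (rule moment_test_flux_bound[OF \<gamma> \<omega> k(2) S(1) a B]) (use elim in auto)
      qed
    qed
    also have "\<dots> \<le> 8 * A * (1 - k)\<^sup>2 * ln (1 + S)" using ble bl by simp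
    finally show ?thesis .
  qed
  have "(\<lambda>n. LINT x|lebesgue. F x * moment_test N \<omega> k S n (0, x)) \<longlonglongrightarrow>
      (LINT x|lebesgue. indicat_real (Omega \<omega> k 1 0) x *\<^sub>R (1/2 * (F x * (\<omega> \<bullet> x - k)\<^sup>2)))"
  proof (rule integral_dominated_convergence)
    have "compact (Omega \<omega> k 1 0)"
      using compact_cap[of \<omega> k 1] by (simp add: cap_def Omega_def Omega_inf_def Int_def)
    then have Om: "Omega \<omega> k 1 0 \<in> sets borel" by (rule borel_compact)
    have Fm [measurable]: "F \<in> borel_measurable lebesgue"
      using Linf_measurable[OF FL] by (simp add: lebesgue_on_UNIV_eq)
    have pm: "(\<lambda>x. (\<omega> \<bullet> x - k)\<^sup>2) \<in> borel_measurable lebesgue"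
      by (intro measurable_completion) measurable
    show "(\<lambda>x. indicat_real (Omega \<omega> k 1 0) x *\<^sub>R (1/2 * (F x * (\<omega> \<bullet> x - k)\<^sup>2))) \<in> borel_measurable lebesgue"
      using Om pm by (intro borel_measurable_scaleR borel_measurable_indicator borel_measurable_times Fm) auto
    show "(\<lambda>x. F x * moment_test N \<omega> k S n (0, x)) \<in> borel_measurable lebesgue" for n
      using relative_identity_integrable(2)[OF sol T \<gamma> moment_test_C1_test[OF S], of \<omega> N \<omega> k n]
      unfolding F_def by (rule borel_measurable_integrable)
    have "integrable lborel (indicat_real (cball (0::space) 2))"
      by (intro integrable_real_indicator) (auto simp: emeasure_compact_finite[simplified])
    then have "integrable lebesgue (\<lambda>x. 9 * indicat_real (cball (0::space) 2) x)"
      by (intro integrable_mult_right) (simp add: integrable_completion)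
    then show "integrable lebesgue (\<lambda>x. \<bar>F x * (9 * indicat_real (cball (0::space) 2) x)\<bar>)"
      using integrable_Linf_mult[OF FL] by (intro integrable_abs) (simp add: lebesgue_on_UNIV_eq)
    have lc0: "log_cutoff S 0 = 1" by (simp add: log_cutoff_def)
    have mt0: "moment_test N \<omega> k S n (0, x) = (max 0 (\<omega> \<bullet> x - k))\<^sup>2 / 2 * lateral_cutoff (real (Suc n) * ((norm x)\<^sup>2 - 1))" for n x
      by (simp add: moment_test_def lc0 height_def cone_excess_def)
    show "AE x in lebesgue. (\<lambda>n. F x * moment_test N \<omega> k S n (0, x)) \<longlonglongrightarrow>
        indicat_real (Omega \<omega> k 1 0) x *\<^sub>R (1/2 * (F x * (\<omega> \<bullet> x - k)\<^sup>2))"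
    proof (rule AE_I2)
      fix x
      show "(\<lambda>n. F x * moment_test N \<omega> k S n (0, x)) \<longlonglongrightarrow>
        indicat_real (Omega \<omega> k 1 0) x *\<^sub>R (1/2 * (F x * (\<omega> \<bullet> x - k)\<^sup>2))"
      proof (cases "norm x \<le> 1")
        case True
        then have "(norm x)\<^sup>2 \<le> 1" by (simp add: power_le_one)
        then have "real (Suc n) * ((norm x)\<^sup>2 - 1) \<le> 0" for n by (intro mult_nonneg_nonpos) auto
        then have "F x * moment_test N \<omega> k S n (0, x) = indicat_real (Omega \<omega> k 1 0) x *\<^sub>R (1/2 * (F x * (\<omega> \<bullet> x - k)\<^sup>2))" for n
          unfolding mt0 lateral_cutoff_inside(1)[OF \<open>real (Suc n) * ((norm x)\<^sup>2 - 1) \<le> 0\<close>]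
          using True by (auto simp: Omega_def Omega_inf_def indicator_def max_def)
        then show ?thesis by (simp only: tendsto_const)
      next
        case False
        then have d: "0 < (norm x)\<^sup>2 - 1" by (simp add: one_less_power)
        then obtain m where m: "1 < real m * ((norm x)\<^sup>2 - 1)" using reals_Archimedean3 by blast
        have "F x * moment_test N \<omega> k S n (0, x) = 0" if "m \<le> n" for n
        proof -
          have "real m * ((norm x)\<^sup>2 - 1) \<le> real (Suc n) * ((norm x)\<^sup>2 - 1)"
            using that d by (intro mult_right_mono) auto
          then have "1 \<le> real (Suc n) * ((norm x)\<^sup>2 - 1)" using m by linarith
          then show ?thesis unfolding mt0 by (simp only: lateral_cutoff_outside)
        qed
        then have "eventually (\<lambda>n. F x * moment_test N \<omega> k S n (0, x) = 0) sequentially"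
          unfolding eventually_sequentially by blast
        moreover have "x \<notin> Omega \<omega> k 1 0" using False by (simp add: Omega_def)
        ultimately show ?thesis by (simp add: tendsto_eventually)
      qed
    qed
    show "AE x in lebesgue. norm (F x * moment_test N \<omega> k S n (0, x)) \<le> \<bar>F x * (9 * indicat_real (cball 0 2) x)\<bar>" for n
    proof (rule AE_I2)
      fix x :: space
      let ?q = "real (Suc n) * ((norm x)\<^sup>2 - 1)"
      have "\<bar>moment_test N \<omega> k S n (0, x)\<bar> \<le> 9 * indicat_real (cball 0 2) x"
      proof (cases "norm x \<le> 2")
        case True
        have "\<bar>\<omega> \<bullet> x\<bar> \<le> 2" using Cauchy_Schwarz_ineq2[of \<omega> x] \<omega> True by simp
        then have "max 0 (\<omega> \<bullet> x - k) \<le> 3" using k by linarith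
        then have "(max 0 (\<omega> \<bullet> x - k))\<^sup>2 \<le> 3\<^sup>2" by (intro power_mono) auto
        then have "(max 0 (\<omega> \<bullet> x - k))\<^sup>2 / 2 \<le> 9" by simp
        then have "(max 0 (\<omega> \<bullet> x - k))\<^sup>2 / 2 * lateral_cutoff ?q \<le> 9 * 1"
          by (intro mult_mono lateral_cutoff_bounds) auto
        then show ?thesis unfolding mt0 using True lateral_cutoff_bounds(1)[of ?q] by (simp add: abs_mult)
      next
        case False
        then have "2\<^sup>2 \<le> (norm x)\<^sup>2" by (intro power_mono) auto
        then have "1 * 1 \<le> ?q" by (intro mult_mono) auto
        then have "lateral_cutoff ?q = 0" by (intro lateral_cutoff_outside) simp
        then show ?thesis unfolding mt0 by simp
      qed
      then show "norm (F x * moment_test N \<omega> k S n (0, x)) \<le> \<bar>F x * (9 * indicat_real (cball 0 2) x)\<bar>"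
        unfolding real_norm_def abs_mult[of "F x"] by (intro mult_left_mono) auto
    qed
  qed
  moreover have "(LINT x|lebesgue. indicat_real (Omega \<omega> k 1 0) x *\<^sub>R (1/2 * (F x * (\<omega> \<bullet> x - k)\<^sup>2))) = w0 \<omega> \<rho>0 u0 k"
  proof -
    have "compact (Omega \<omega> k 1 0)"
      using compact_cap[of \<omega> k 1] by (simp add: cap_def Omega_def Omega_inf_def Int_def)
    then have "Omega \<omega> k 1 0 \<in> sets lebesgue" by (simp add: borel_compact)
    then have "(LINT x|lebesgue. indicat_real (Omega \<omega> k 1 0) x *\<^sub>R (1/2 * (F x * (\<omega> \<bullet> x - k)\<^sup>2)))
        = (LINT x|lebesgue_on (Omega \<omega> k 1 0). 1/2 * (F x * (\<omega> \<bullet> x - k)\<^sup>2))"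
      by (intro integral_restrict_space[symmetric]) simp
    then show ?thesis by (simp add: w0_def F_def)
  qed
  ultimately have "w0 \<omega> \<rho>0 u0 k \<le> 8 * A * (1 - k)\<^sup>2 * ln (1 + S)"
    using J by (intro LIMSEQ_le_const2) auto
  also have "\<dots> = 8 * (B * (real (Suc (Suc N)) / 2)\<^sup>2) * (1 - k) ^ 5 / ln (1 + S)"
    using L by (simp add: A_def field_simps power2_eq_square eval_nat_numeral)
  finally show ?thesis .
qed

text \<open>
  For \<open>\<gamma> < 2\<close> the exponent in \<open>time_bound\<close> carries an additional factor that is at least one, so both cases
  are bounded below by the same exponential.
\<close>

lemma T0_lower_bound:
  assumes "0 < \<Gamma>" "0 \<le> k0" "k0 < 1" "positive_decreasing w k0"
    and "\<And>k. k0 < k \<Longrightarrow> k < 1 \<Longrightarrow> x \<le> exp (\<Gamma> * ((1 - k0) ^ 6 / ((k - k0) * w k)))"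
  shows "x - (1 + k0) / 2 \<le> T0 \<gamma> \<Gamma> w k0"
proof -
  have "x \<le> (INF k\<in>{k0<..<1}. time_bound \<gamma> \<Gamma> w k k0)"
  proof (rule cINF_greatest)
    show "{k0<..<1} \<noteq> {}" using assms by simp
    fix k assume k: "k \<in> {k0<..<1}"
    then have w: "0 < w k" using assms(4) by (simp add: positive_decreasing_def)
    have X: "0 \<le> \<Gamma> * ((1 - k0) ^ 6 / ((k - k0) * w k))" using assms k w by simp
    have "1 \<le> (1 + 3 * w k / (1 - k) ^ 4) powr (2 - \<gamma>)" if "\<gamma> < 2"
      using w k that by (intro ge_one_powr_ge_zero) auto
    from mult_left_mono[OF this X] have "exp (\<Gamma> * ((1 - k0) ^ 6 / ((k - k0) * w k))) \<le> time_bound \<gamma> \<Gamma> w k k0"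
      by (simp add: time_bound_def)
    then show "x \<le> time_bound \<gamma> \<Gamma> w k k0" using assms(5)[of k] k by simp
  qed
  then show ?thesis by (simp add: T0_def)
qed

text \<open>
  If \<open>T1 \<le> (1 - k0) / 2\<close>, the shift by \<open>(1 + k0) / 2\<close> leaves \<open>T1 + (1 + k0) / 2\<close> at most one and there is nothing to prove.
  Otherwise the final time \<open>S\<close> of the cutoff can be taken above \<open>(1 - k0) / 2\<close>, so that \<open>1 - k\<close> is at most \<open>3 log (1 + S)\<close>
  and the parameter \<open>a\<close> of the Young inequality stays bounded independently of the solution.
  The support condition is imposed only up to \<open>T1\<close>, which makes the bound applicable to the time of escape.
\<close>

lemma lifespan_bound:
  assumes \<gamma>: "1 < \<gamma>"
  obtains \<Gamma> where "0 < \<Gamma>"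
    "\<And>T T1 \<rho> u \<rho>0 u0 \<omega> k0. weak_solution \<gamma> T \<rho> u \<rho>0 u0 \<Longrightarrow> 0 < T1 \<Longrightarrow> T1 \<le> T \<Longrightarrow> norm \<omega> = 1 \<Longrightarrow>
       0 \<le> k0 \<Longrightarrow> k0 < 1 \<Longrightarrow>
       perturbation_supp (slab T) \<rho> u \<inter> Omega_slab_inf \<omega> k0 T1 \<subseteq> Omega_slab \<omega> k0 1 T1 \<Longrightarrow>
       positive_decreasing (w0 \<omega> \<rho>0 u0) k0 \<Longrightarrow> T1 \<le> T0 \<gamma> \<Gamma> (w0 \<omega> \<rho>0 u0) k0"
proof -
  obtain N where N: "2 + 2 / (\<gamma> - 1) \<le> real N" using real_arch_simple by blast
  define P where "P = real (Suc (Suc N))"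
  have P: "2 + 2 / (\<gamma> - 1) \<le> P" using N by (simp add: P_def)
  have P0: "0 < P" by (simp add: P_def)
  obtain B where B: "B > 0"
    "\<And>r v \<theta> a. 0 < r \<Longrightarrow> 0 < \<theta> \<Longrightarrow> \<theta> \<le> 1 \<Longrightarrow> 0 \<le> a \<Longrightarrow> a \<le> 3 * P / 2 \<Longrightarrow>
       \<bar>r - 1 + r * v\<bar> * (\<theta> powr (P - 1) * a) \<le> \<theta> powr P * (r * v\<^sup>2 + rel_pressure \<gamma> r) + B * a\<^sup>2"
    using momentum_young[OF \<gamma> P, of "3 * P / 2"] P0 by auto
  define \<Gamma> where "\<Gamma> = 8 * (B * (P / 2)\<^sup>2)"
  have \<Gamma>: "0 < \<Gamma>" using B P0 by (simp add: \<Gamma>_def)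
  show ?thesis
  proof (rule that[OF \<Gamma>])
    fix T T1 \<rho> u \<rho>0 u0 \<omega> k0
    assume sol: "weak_solution \<gamma> T \<rho> u \<rho>0 u0" and T1: "0 < T1" "T1 \<le> T" and \<omega>: "norm \<omega> = 1"
      and k0: "0 \<le> k0" "k0 < 1"
      and supp: "perturbation_supp (slab T) \<rho> u \<inter> Omega_slab_inf \<omega> k0 T1 \<subseteq> Omega_slab \<omega> k0 1 T1"
      and pd: "positive_decreasing (w0 \<omega> \<rho>0 u0) k0"
    let ?w = "w0 \<omega> \<rho>0 u0"
    have quiet: "AE z in lebesgue_on (slab T). k0 + fst z < \<omega> \<bullet> snd z \<and> 1 + fst z < norm (snd z) \<and> fst z < T1
        \<longrightarrow> \<rho> z = 1 \<and> u z = 0"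
      using AE_not_in_perturbation_supp[of "slab T" \<rho> u] AE_space[of "lebesgue_on (slab T)"]
    proof eventually_elim
      case (elim z)
      show ?case
      proof
        assume z: "k0 + fst z < \<omega> \<bullet> snd z \<and> 1 + fst z < norm (snd z) \<and> fst z < T1"
        have "z \<in> slab T" using elim(2) by simp
        then have "z \<in> Omega_slab_inf \<omega> k0 T1" "z \<notin> Omega_slab \<omega> k0 1 T1"
          using z by (cases z; simp add: Omega_slab_inf_def Omega_slab_def Omega_inf_def Omega_def)+
        then have "z \<notin> perturbation_supp (slab T) \<rho> u" using supp by blast
        then show "\<rho> z = 1 \<and> u z = 0" using elim(1) \<open>z \<in> slab T\<close> by blast
      qed
    qed
    have main: "max 1 (T1 + (1 + k0) / 2) \<le> exp (\<Gamma> * ((1 - k0) ^ 6 / ((k - k0) * ?w k)))"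
      if k: "k0 < k" "k < 1" for k
    proof -
      have w: "0 < ?w k" using pd k by (simp add: positive_decreasing_def)
      define X where "X = (1 - k0) ^ 6 / ((k - k0) * ?w k)"
      have X0: "0 \<le> X" using k k0 w by (simp add: X_def)
      have le: "ln (1 + S) \<le> \<Gamma> * X" if S: "(1 - k0) / 2 < S" "S < T1" for S
      proof -
        have S0: "0 < S" using S k0 by simp
        have L: "0 < ln (1 + S)" using S0 by simp
        have kS: "(1 - k) / 3 \<le> ln (1 + S)"
        proof -
          have "(1 - k) / 3 \<le> S / (1 + S)"
          proof (cases "S \<le> 1/2")
            case True
            have "(1 - k) / 3 \<le> (2 * S) / 3" using S k by simp
            also have "\<dots> \<le> S / (1 + S)" using True S0 by (simp add: divide_simps mult_left_mono)
            finally show ?thesis .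
          next
            case False
            have "(1 - k) / 3 \<le> 1 / 3" using k k0 by simp
            also have "\<dots> \<le> S / (1 + S)" using False by (simp add: divide_simps)
            finally show ?thesis .
          qed
          also have "\<dots> \<le> ln (1 + S)"
          proof -
            have "ln (1 / (1 + S)) \<le> 1 / (1 + S) - 1" using S0 by (intro ln_le_minus_one) simp
            moreover have "1 / (1 + S) - 1 = - (S / (1 + S))" using S0 by (simp add: divide_simps)
            ultimately show ?thesis using S0 by (simp add: ln_div)
          qed
          finally show ?thesis .
        qed
        have "(1 - k) / ln (1 + S) \<le> 3" using kS L by (simp add: divide_simps)
        then have a: "P / 2 * ((1 - k) / ln (1 + S)) \<le> P / 2 * 3" using P0 by (intro mult_left_mono) auto
        have "?w k \<le> 8 * (B * (real (Suc (Suc N)) / 2)\<^sup>2) * (1 - k) ^ 5 / ln (1 + S)"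
        proof (rule w0_le_log[OF sol \<gamma> \<omega> _ k(2) S0, where M = "3 * P / 2"])
          show "0 \<le> k" "S < T" "0 \<le> B" using k k0 S T1 B by auto
          show "real (Suc (Suc N)) / 2 * ((1 - k) / ln (1 + S)) \<le> 3 * P / 2"
            using a by (simp add: P_def)
          show "AE z in lebesgue_on (slab T). k + fst z < \<omega> \<bullet> snd z \<and> 1 + fst z < norm (snd z) \<and> fst z < S
            \<longrightarrow> \<rho> z = 1 \<and> u z = 0"
            using quiet by eventually_elim (use k S in auto)
          show "\<bar>r - 1 + r * v\<bar> * (\<theta> powr (real (Suc (Suc N)) - 1) * a)
              \<le> \<theta> powr real (Suc (Suc N)) * (r * v\<^sup>2 + rel_pressure \<gamma> r) + B * a\<^sup>2"
            if "0 < r" "0 < \<theta>" "\<theta> \<le> 1" "0 \<le> a" "a \<le> 3 * P / 2" for r v \<theta> a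
            using B(2)[OF that] by (simp only: P_def)
        qed
        then have "?w k \<le> \<Gamma> * (1 - k) ^ 5 / ln (1 + S)" by (simp only: \<Gamma>_def P_def)
        then have "ln (1 + S) \<le> \<Gamma> * ((1 - k) ^ 5 / ?w k)" using L w by (simp add: field_simps)
        also have "\<dots> \<le> \<Gamma> * X"
        proof (rule mult_left_mono)
          have "(1 - k) ^ 5 * (k - k0) \<le> (1 - k0) ^ 5 * (1 - k0)"
            using k k0 by (intro mult_mono power_mono) auto
          also have "\<dots> = (1 - k0) ^ 6" by (simp add: eval_nat_numeral)
          finally have "(1 - k) ^ 5 * (k - k0) / ((k - k0) * ?w k) \<le> X"
            unfolding X_def using k w by (intro divide_right_mono) auto
          then show "(1 - k) ^ 5 / ?w k \<le> X" using k by simp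
        qed (use \<Gamma> in simp)
        finally show ?thesis .
      qed
      have "T1 + (1 + k0) / 2 \<le> exp (\<Gamma> * X)"
      proof (cases "T1 \<le> (1 - k0) / 2")
        case True
        have "1 \<le> exp (\<Gamma> * X)" using X0 \<Gamma> by simp
        moreover have "T1 + (1 + k0) / 2 \<le> 1" using True by (simp add: field_simps)
        ultimately show ?thesis by linarith
      next
        case False
        have "T1 \<le> exp (\<Gamma> * X) - 1"
        proof (rule dense_le_bounded[of "(1 - k0) / 2"])
          show "(1 - k0) / 2 < T1" using False by simp
          fix S assume S: "(1 - k0) / 2 < S" "S < T1"
          have "0 < 1 + S" using S k0 by simp
          then have "1 + S = exp (ln (1 + S))" by simp
          also have "\<dots> \<le> exp (\<Gamma> * X)" using le[OF S] by simp
          finally show "S \<le> exp (\<Gamma> * X) - 1" by simp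
        qed
        moreover have "(1 + k0) / 2 \<le> 1" using k0 by simp
        ultimately show ?thesis by (rule order_trans[OF add_mono]) simp
      qed
      moreover have "1 \<le> exp (\<Gamma> * X)" using X0 \<Gamma> by simp
      ultimately show ?thesis by (simp add: X_def)
    qed
    have "T1 + (1 + k0) / 2 - (1 + k0) / 2 \<le> T0 \<gamma> \<Gamma> ?w k0"
      by (rule T0_lower_bound[OF \<Gamma> k0 pd]) (use main in auto)
    then show "T1 \<le> T0 \<gamma> \<Gamma> ?w k0" by simp
  qed
qed

section \<open>Escape from the sonic cone\<close>

lemma perturbation_supp_not_AE:
  assumes "z \<in> perturbation_supp D r v" "open U" "z \<in> U"
  shows "\<not> (AE y in lebesgue_on D. y \<in> U \<longrightarrow> r y = 1 \<and> v y = 0)"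
  using not_in_perturbation_supp[OF assms(2,3)] assms(1) by blast

lemma perturbation_supp_subset: "perturbation_supp D r v \<subseteq> D"
  by (auto simp: perturbation_supp_def ess_supp_def)

lemma half_space_region_borel: "half_space_region \<nu> c \<tau> \<tau>' \<in> sets borel"
proof -
  have "half_space_region \<nu> c \<tau> \<tau>' =
      {z. \<tau> < fst z} \<inter> {z. fst z < \<tau>'} \<inter> {z. 1 + \<tau> + c * (fst z - \<tau>) \<le> \<nu> \<bullet> snd z}"
    by (auto simp: half_space_region_def)
  moreover have "open {z::spacetime. \<tau> < fst z}" "open {z::spacetime. fst z < \<tau>'}"
      "closed {z::spacetime. 1 + \<tau> + c * (fst z - \<tau>) \<le> \<nu> \<bullet> snd z}"
    by (intro open_Collect_less closed_Collect_le continuous_intros)+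
  ultimately show ?thesis by simp
qed

lemma half_space_region_mono:
  assumes "c \<le> d"
  shows "half_space_region \<nu> d \<tau> \<tau>' \<subseteq> half_space_region \<nu> c \<tau> \<tau>'"
proof
  fix z assume "z \<in> half_space_region \<nu> d \<tau> \<tau>'"
  then have z: "\<tau> < fst z" "fst z < \<tau>'" "1 + \<tau> + d * (fst z - \<tau>) \<le> \<nu> \<bullet> snd z"
    by (auto simp: half_space_region_def)
  have "c * (fst z - \<tau>) \<le> d * (fst z - \<tau>)" using assms z(1) by (intro mult_right_mono) auto
  then have "1 + \<tau> + c * (fst z - \<tau>) \<le> \<nu> \<bullet> snd z" using z(3) by linarith
  then show "z \<in> half_space_region \<nu> c \<tau> \<tau>'" using z by (cases z) (simp add: half_space_region_def)
qed

lemma Linf_norm_mono: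
  assumes "A \<in> sets lebesgue" "B \<in> sets lebesgue" "A \<subseteq> B" "f \<in> borel_measurable (lebesgue_on B)"
  shows "Linf_norm A f \<le> Linf_norm B f"
proof -
  have f: "f \<in> borel_measurable (lebesgue_on A)" using assms(3,4) by (rule measurable_restrict_mono[rotated])
  have "AE x in lebesgue_on B. ennreal (norm (f x)) \<le> Linf_norm B f"
    unfolding Linf_norm_def by (rule esssup_AE)
  then have "AE x in lebesgue_on A. ennreal (norm (f x)) \<le> Linf_norm B f"
    using assms(3) by (auto simp: AE_lebesgue_on_iff[OF assms(1)] AE_lebesgue_on_iff[OF assms(2)] elim!: eventually_mono)
  then show ?thesis unfolding Linf_norm_def[of A] using f by (intro esssup_I) auto
qed

context
  fixes \<gamma> T :: real and \<rho> u \<rho>0 u0 and \<tau> \<tau>' :: real and \<nu> :: space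
  assumes sol: "weak_solution \<gamma> T \<rho> u \<rho>0 u0" and \<tau>: "0 \<le> \<tau>" "\<tau>' < T"
begin

lemma half_space_region_subset_slab: "half_space_region \<nu> c \<tau> \<tau>' \<subseteq> slab T"
  using \<tau> by (auto simp: half_space_region_def)

lemma front_profile_measurable:
  "(\<lambda>z. \<rho> z - 1) \<in> borel_measurable (lebesgue_on (half_space_region \<nu> c \<tau> \<tau>'))"
  "u \<in> borel_measurable (lebesgue_on (half_space_region \<nu> c \<tau> \<tau>'))"
proof -
  have "(\<lambda>z. \<rho> z - 1) \<in> Linf (slab T)" "u \<in> Linf (slab T)"
    using weak_solution_Linf[OF sol] by (auto intro: Linf_diff Linf_const)
  from this[THEN Linf_measurable]
  show "(\<lambda>z. \<rho> z - 1) \<in> borel_measurable (lebesgue_on (half_space_region \<nu> c \<tau> \<tau>'))"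
    "u \<in> borel_measurable (lebesgue_on (half_space_region \<nu> c \<tau> \<tau>'))"
    by (auto intro: measurable_restrict_mono[OF _ half_space_region_subset_slab])
qed

lemma front_profile_antimono: "antimono (front_profile \<rho> u \<nu> \<tau> \<tau>')"
proof (rule antimonoI)
  fix c d :: real assume "c \<le> d"
  then show "front_profile \<rho> u \<nu> \<tau> \<tau>' d \<le> front_profile \<rho> u \<nu> \<tau> \<tau>' c"
    unfolding front_profile_def
    by (intro add_mono Linf_norm_mono front_profile_measurable half_space_region_mono)
       (simp_all add: half_space_region_borel)
qed

lemma front_profile_finite: "front_profile \<rho> u \<nu> \<tau> \<tau>' c < \<infinity>"
proof -
  have L: "(\<lambda>z. \<rho> z - 1) \<in> Linf (slab T)" "u \<in> Linf (slab T)"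
    using weak_solution_Linf[OF sol] by (auto intro: Linf_diff Linf_const)
  have "Linf_norm (half_space_region \<nu> c \<tau> \<tau>') (\<lambda>z. \<rho> z - 1) \<le> Linf_norm (slab T) (\<lambda>z. \<rho> z - 1)"
    using L(1) by (intro Linf_norm_mono half_space_region_subset_slab Linf_measurable) (simp_all add: half_space_region_borel)
  moreover have "Linf_norm (half_space_region \<nu> c \<tau> \<tau>') u \<le> Linf_norm (slab T) u"
    using L(2) by (intro Linf_norm_mono half_space_region_subset_slab Linf_measurable) (simp_all add: half_space_region_borel)
  ultimately show ?thesis
    using L by (auto simp: front_profile_def Linf_def order_le_less_trans)
qed

lemma front_profile_AE_le:
  assumes "front_profile \<rho> u \<nu> \<tau> \<tau>' c \<le> ennreal \<mu>" "0 \<le> \<mu>"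
  shows "AE z in lebesgue_on (slab T). z \<in> half_space_region \<nu> c \<tau> \<tau>' \<longrightarrow> \<bar>\<rho> z - 1\<bar> + norm (u z) \<le> \<mu>"
proof -
  have "AE z in lebesgue_on (half_space_region \<nu> c \<tau> \<tau>'). norm (\<rho> z - 1) + norm (u z) \<le> \<mu>"
    using assms unfolding front_profile_def by (rule Linf_norm_add_le_AE)
  then show ?thesis
    by (auto simp: AE_lebesgue_on_iff half_space_region_borel elim!: eventually_mono)
qed

lemma front_profile_eq_0:
  assumes "half_space_region \<nu> c \<tau> \<tau>' \<inter> perturbation_supp (slab T) \<rho> u = {}"
  shows "front_profile \<rho> u \<nu> \<tau> \<tau>' c = 0"
proof -
  have "AE z in lebesgue_on (slab T). z \<in> half_space_region \<nu> c \<tau> \<tau>' \<longrightarrow> \<rho> z = 1 \<and> u z = 0"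
    using AE_not_in_perturbation_supp[of "slab T" \<rho> u]
    by eventually_elim (use assms half_space_region_subset_slab in blast)
  then have "AE z in lebesgue_on (half_space_region \<nu> c \<tau> \<tau>'). \<rho> z = 1 \<and> u z = 0"
    using half_space_region_subset_slab[of c]
    by (auto simp: AE_lebesgue_on_iff half_space_region_borel elim!: eventually_mono)
  then show ?thesis
    unfolding front_profile_def using front_profile_measurable
    by (subst (1 2) Linf_norm_eq_0I) (auto elim: eventually_mono)
qed

end

text \<open>
  \<open>B\<close> is a bound for the time up to which the perturbation can stay inside the sonic cone. Both the slope bound after
  \<open>\<tau>\<close> and the jump come from cones over balls that lie outside the ball of radius \<open>1 + \<tau>\<close>: before \<open>\<tau>\<close> the
  solution is constant over such a ball.
\<close>

lemma escape_and_front_jump: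
  assumes \<gamma>: "1 < \<gamma>"
    and C: "0 < C" "\<And>m r v. r > 0 \<Longrightarrow> \<bar>inverse r * (r - 1)\<bar> + norm v \<le> m \<Longrightarrow>
       norm (rel_flux \<gamma> r v) \<le> (1 + C * m) * rel_energy \<gamma> r v"
    and lifespan: "\<And>T1. 0 < T1 \<Longrightarrow> T1 \<le> T \<Longrightarrow>
       perturbation_supp (slab T) \<rho> u \<inter> Omega_slab_inf \<omega> k0 T1 \<subseteq> Omega_slab \<omega> k0 1 T1 \<Longrightarrow> T1 \<le> B"
    and B: "0 < B" "B < T"
    and adm: "entropy_admissible \<gamma> T \<rho> u \<rho>0 u0"
    and m: "0 < m" "Linf_norm (slab T) (\<lambda>z. inverse (\<rho> z) * (\<rho> z - 1)) + Linf_norm (slab T) u \<le> ennreal m"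
    and init: "ess_supp UNIV (\<lambda>x. (\<rho>0 x - 1, u0 x)) \<subseteq> {x. norm x \<le> 1}"
  defines "c0 \<equiv> 1 + C * m" and "\<tau> \<equiv> Inf (escape_times T \<rho> u)" and "E \<equiv> perturbation_supp (slab T) \<rho> u"
  shows "escape_times T \<rho> u \<noteq> {}" "0 \<le> \<tau>" "\<tau> \<le> B"
    "E \<inter> slab \<tau> \<subseteq> {(t, x). (t, x) \<in> slab \<tau> \<and> norm x \<le> 1 + t}"
    "\<And>\<tau>'. \<tau> < \<tau>' \<Longrightarrow> \<tau>' < T \<Longrightarrow>
        E \<inter> ({\<tau><..<\<tau>'} \<times> UNIV) \<subseteq> {(t, x). \<tau> < t \<and> t < \<tau>' \<and> norm x \<le> 1 + \<tau> + c0 * (t - \<tau>)}"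
    "\<And>\<tau>'. \<tau> < \<tau>' \<Longrightarrow> \<tau>' < T \<Longrightarrow>
        E \<inter> {(t, x). \<tau> < t \<and> t < \<tau>' \<and> 1 + t < norm x \<and> norm x \<le> 1 + \<tau> + c0 * (t - \<tau>)} \<noteq> {}"
    "\<And>\<tau>'. \<tau> < \<tau>' \<Longrightarrow> \<tau>' < T \<Longrightarrow>
        \<exists>\<nu> c1. norm \<nu> = 1 \<and> 1 < c1 \<and> c1 \<le> c0 \<and>
               antimono_on {1..} (front_profile \<rho> u \<nu> \<tau> \<tau>') \<and>
               (\<exists>g_left. (front_profile \<rho> u \<nu> \<tau> \<tau>' \<longlongrightarrow> g_left) (at_left c1) \<and>
                  0 < g_left \<and> g_left < \<infinity> \<and>
                  (front_profile \<rho> u \<nu> \<tau> \<tau>' \<longlongrightarrow> 0) (at_right c1))"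
proof -
  have T: "0 < T" using B by simp
  have sol: "weak_solution \<gamma> T \<rho> u \<rho>0 u0" using adm by (simp add: entropy_admissible_def)
  have "0 < C * m" using C m by simp
  then have c0: "1 < c0" by (simp add: c0_def)
  have escape: "t \<in> escape_times T \<rho> u" if t: "B < t" "t < T" for t
  proof (rule ccontr)
    assume "t \<notin> escape_times T \<rho> u"
    then have none: "E \<inter> {(s, x). (s, x) \<in> slab t \<and> 1 + s < norm x} = {}"
      using t B by (simp add: escape_times_def E_def)
    have "E \<inter> Omega_slab_inf \<omega> k0 t \<subseteq> Omega_slab \<omega> k0 1 t"
    proof
      fix z assume "z \<in> E \<inter> Omega_slab_inf \<omega> k0 t"
      then show "z \<in> Omega_slab \<omega> k0 1 t"
        using none by (cases z) (force simp: Omega_slab_inf_def Omega_slab_def Omega_def not_less)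
    qed
    then have "t \<le> B" using lifespan[of t] t B by (simp add: E_def)
    then show False using t by simp
  qed
  obtain t1 where "B < t1" "t1 < T" using dense[OF B(2)] by blast
  then show ne: "escape_times T \<rho> u \<noteq> {}" using escape by blast
  have bdd: "bdd_below (escape_times T \<rho> u)"
    by (rule bdd_belowI[of _ 0]) (simp add: escape_times_def)
  show \<tau>0: "0 \<le> \<tau>" unfolding \<tau>_def by (rule cInf_greatest[OF ne]) (simp add: escape_times_def)
  show \<tau>B: "\<tau> \<le> B"
  proof (rule dense_ge_bounded[OF B(2)])
    fix t assume "B < t" "t < T"
    then show "\<tau> \<le> t" unfolding \<tau>_def using escape bdd by (intro cInf_lower) auto
  qed
  have before: "norm x \<le> 1 + t" if E: "(t, x) \<in> E" and t: "t < \<tau>" for t x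
  proof (rule ccontr)
    assume x: "\<not> norm x \<le> 1 + t"
    have t0: "0 \<le> t" using E perturbation_supp_subset[of "slab T" \<rho> u] by (auto simp: E_def)
    obtain t' where t': "t < t'" "t' < \<tau>" using dense[OF t] by blast
    have "t' < T" using t' \<tau>B B by simp
    then have "t' \<in> escape_times T \<rho> u"
      using E x t0 t' unfolding escape_times_def E_def[symmetric] by (auto simp: not_le)
    then have "\<tau> \<le> t'" unfolding \<tau>_def using bdd by (rule cInf_lower)
    then show False using t' by simp
  qed
  then show "E \<inter> slab \<tau> \<subseteq> {(t, x). (t, x) \<in> slab \<tau> \<and> norm x \<le> 1 + t}" by auto
  have init': "AE x in lebesgue. 1 < norm x \<longrightarrow> \<rho>0 x = 1 \<and> u0 x = 0"
  proof -
    have "AE x in lebesgue_on UNIV. x \<in> ess_null_set UNIV (\<lambda>x. (\<rho>0 x - 1, u0 x)) \<longrightarrow> (\<rho>0 x - 1, u0 x) = 0"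
      by (rule AE_ess_null_set)
    then show ?thesis unfolding lebesgue_on_UNIV_eq
    proof eventually_elim
      case (elim x)
      have "x \<in> ess_null_set UNIV (\<lambda>x. (\<rho>0 x - 1, u0 x))" if "1 < norm x"
        using init that unfolding ess_supp_def by force
      then show ?case using elim by (auto simp: zero_prod_def)
    qed
  qed
  have past: "AE z in lebesgue_on (slab T). fst z < \<tau> \<and> 1 + fst z < norm (snd z) \<longrightarrow> \<rho> z = 1 \<and> u z = 0"
    using AE_not_in_perturbation_supp[of "slab T" \<rho> u] AE_space[of "lebesgue_on (slab T)"]
  proof eventually_elim
    case (elim z)
    have "z \<notin> E" if "fst z < \<tau>" "1 + fst z < norm (snd z)"
      using before[of "fst z" "snd z"] that by auto
    then show ?case using elim by (auto simp: E_def)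
  qed
  have cone: "z \<notin> E"
    if z: "fst z < T'" "T' \<le> T" "norm (snd z - p) + c * max 0 (fst z - \<tau>) < r" and c: "0 < c"
      and far: "\<And>x. norm (x - p) < r \<Longrightarrow> 1 + \<tau> < norm x"
      and speed: "AE y in lebesgue_on (slab T). \<tau> < fst y \<and> fst y < T' \<and> norm (snd y - p) + c * (fst y - \<tau>) < r \<longrightarrow>
        norm (rel_flux \<gamma> (\<rho> y) (u y)) \<le> c * rel_energy \<gamma> (\<rho> y) (u y)"
    for z T' p c r
    unfolding E_def
  proof (rule cone_quiescent[OF adm T \<gamma> c z(2) _ _ speed z(1,3)])
    show "AE x in lebesgue. norm (x - p) < r \<longrightarrow> \<rho>0 x = 1 \<and> u0 x = 0"
      using init'
    proof eventually_elim
      case (elim x)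
      then show ?case using far[of x] \<tau>0 by auto
    qed
    show "AE y in lebesgue_on (slab T). fst y < \<tau> \<and> norm (snd y - p) < r \<longrightarrow> \<rho> y = 1 \<and> u y = 0"
      using past
    proof eventually_elim
      case (elim y)
      then show ?case using far[of "snd y"] by auto
    qed
  qed
  have "AE z in lebesgue_on (slab T). norm (inverse (\<rho> z) * (\<rho> z - 1)) + norm (u z) \<le> m"
    using m by (intro Linf_norm_add_le_AE) auto
  with weak_solution_Linf(3)[OF sol]
  have speed0: "AE z in lebesgue_on (slab T). norm (rel_flux \<gamma> (\<rho> z) (u z)) \<le> c0 * rel_energy \<gamma> (\<rho> z) (u z)"
    unfolding c0_def by eventually_elim (rule C(2), auto)
  have after: "norm x \<le> 1 + \<tau> + c0 * max 0 (t - \<tau>)" if E: "(t, x) \<in> E" for t x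
  proof (rule ccontr)
    assume x: "\<not> norm x \<le> 1 + \<tau> + c0 * max 0 (t - \<tau>)"
    have t: "t < T" using E perturbation_supp_subset[of "slab T" \<rho> u] by (auto simp: E_def)
    have "(t, x) \<notin> E"
    proof (rule cone[where c = c0 and p = x and r = "norm x - 1 - \<tau>" and T' = T])
      show "1 + \<tau> < norm y" if "norm (y - x) < norm x - 1 - \<tau>" for y
        using that norm_triangle_sub[of x y] by (simp add: norm_minus_commute)
    qed (use t x c0 speed0 in \<open>auto elim!: eventually_mono\<close>)
    then show False using E by simp
  qed
  {
    fix \<tau>' assume \<tau>': "\<tau> < \<tau>'" "\<tau>' < T"
    show A: "E \<inter> ({\<tau><..<\<tau>'} \<times> UNIV) \<subseteq> {(t, x). \<tau> < t \<and> t < \<tau>' \<and> norm x \<le> 1 + \<tau> + c0 * (t - \<tau>)}"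
      using after by fastforce
    obtain t where t: "t \<in> escape_times T \<rho> u" "t < \<tau>'"
      using \<tau>'(1) ne bdd unfolding \<tau>_def by (auto simp: cInf_less_iff)
    then obtain s x where sx: "(s, x) \<in> E" "s < t" "1 + s < norm x" "0 \<le> s"
      unfolding escape_times_def E_def[symmetric] by auto
    \<comment> \<open>the time of the point is not \<open>\<tau>\<close> itself, where the support is still in the ball of radius \<open>1 + \<tau>\<close>\<close>
    have "\<tau> \<le> s" using before[OF sx(1)] sx(3) by force
    moreover have "s \<noteq> \<tau>" using after[OF sx(1)] sx(3) by auto
    ultimately have s: "\<tau> < s" "s < \<tau>'" using sx t by auto
    then have "norm x \<le> 1 + \<tau> + c0 * (s - \<tau>)" using after[OF sx(1)] by simp
    then show "E \<inter> {(t, x). \<tau> < t \<and> t < \<tau>' \<and> 1 + t < norm x \<and> norm x \<le> 1 + \<tau> + c0 * (t - \<tau>)} \<noteq> {}"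
      using sx s by blast
    \<comment> \<open>in this direction the point \<open>(s, x)\<close> of the support is ahead of every front of speed slightly above one\<close>
    define \<nu> where "\<nu> = x /\<^sub>R norm x"
    have x0: "0 < norm x" using sx by linarith
    have \<nu>: "norm \<nu> = 1" "\<nu> \<bullet> x = norm x"
      using x0 by (auto simp: \<nu>_def power2_norm_eq_inner[symmetric] power2_eq_square)
    define g where "g = front_profile \<rho> u \<nu> \<tau> \<tau>'"
    have anti: "antimono g" unfolding g_def by (rule front_profile_antimono[OF sol \<tau>0 \<tau>'(2)])
    have fin: "g c < \<infinity>" for c unfolding g_def by (rule front_profile_finite[OF sol \<tau>0 \<tau>'(2)])
    have g0: "g c = 0" if c: "c0 < c" for c
      unfolding g_def
    proof (rule front_profile_eq_0[OF sol \<tau>0 \<tau>'(2)])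
      have "(t, y) \<notin> E" if t: "\<tau> < t" "t < \<tau>'" "1 + \<tau> + c * (t - \<tau>) \<le> \<nu> \<bullet> y" for t y
      proof
        assume "(t, y) \<in> E"
        then have "norm y \<le> 1 + \<tau> + c0 * (t - \<tau>)" using after[of t y] t by simp
        moreover have "\<nu> \<bullet> y \<le> norm y" using norm_cauchy_schwarz[of \<nu> y] \<nu> by simp
        moreover have "c0 * (t - \<tau>) < c * (t - \<tau>)" using c t by (intro mult_strict_right_mono) auto
        ultimately show False using t by linarith
      qed
      then show "half_space_region \<nu> c \<tau> \<tau>' \<inter> perturbation_supp (slab T) \<rho> u = {}"
        by (auto simp: half_space_region_def E_def)
    qed
    obtain c2 where c2: "1 < c2" "g c2 \<noteq> 0"
    proof -
      have "1 < (norm x - 1 - \<tau>) / (s - \<tau>)" using s sx by (simp add: field_simps)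
      then obtain c2 where c2: "1 < c2" "c2 < (norm x - 1 - \<tau>) / (s - \<tau>)" using dense by blast
      then have "c2 * (s - \<tau>) < norm x - 1 - \<tau>" using s by (simp add: pos_less_divide_eq)
      then have sxU: "1 + \<tau> + c2 * (s - \<tau>) < \<nu> \<bullet> x" using \<nu> by simp
      let ?U = "{z::spacetime. \<tau> < fst z} \<inter> {z. fst z < \<tau>'} \<inter> {z. 1 + \<tau> + c2 * (fst z - \<tau>) < \<nu> \<bullet> snd z}"
      have U: "open ?U" "(s, x) \<in> ?U"
        using s sxU by (auto intro!: open_Int open_Collect_less continuous_intros)
      have "g c2 \<noteq> 0"
      proof
        assume "g c2 = 0"
        then have "AE z in lebesgue_on (slab T). z \<in> half_space_region \<nu> c2 \<tau> \<tau>' \<longrightarrow> \<bar>\<rho> z - 1\<bar> + norm (u z) \<le> 0"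
          unfolding g_def by (intro front_profile_AE_le[OF sol \<tau>0 \<tau>'(2)]) auto
        then have "AE z in lebesgue_on (slab T). z \<in> ?U \<longrightarrow> \<rho> z = 1 \<and> u z = 0"
        proof eventually_elim
          case (elim z)
          show ?case
          proof
            assume "z \<in> ?U"
            then have "z \<in> half_space_region \<nu> c2 \<tau> \<tau>'" by (cases z) (auto simp: half_space_region_def)
            then have "\<bar>\<rho> z - 1\<bar> + norm (u z) \<le> 0" using elim by blast
            then show "\<rho> z = 1 \<and> u z = 0" by (smt (verit) norm_ge_zero norm_eq_zero)
          qed
        qed
        then show False using perturbation_supp_not_AE[OF sx(1)[unfolded E_def] U] by blast
      qed
      then show ?thesis using that c2 by blast
    qed
    \<comment> \<open>a small amplitude beyond a front of speed \<open>c\<close> cannot keep up with that front; passing to \<open>d > c\<close> leaves out its boundary\<close>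
    have quiet: "g d = 0" if c: "1 < c" "c < d" and \<mu>: "g c \<le> ennreal \<mu>" "0 \<le> \<mu>" "\<mu> \<le> 1/2" "1 + C * (2 * \<mu>) \<le> c"
      for c d \<mu>
      unfolding g_def
    proof (rule front_profile_eq_0[OF sol \<tau>0 \<tau>'(2)])
      have amp: "AE z in lebesgue_on (slab T). z \<in> half_space_region \<nu> c \<tau> \<tau>' \<longrightarrow> \<bar>\<rho> z - 1\<bar> + norm (u z) \<le> \<mu>"
        using \<mu>(1,2) unfolding g_def by (rule front_profile_AE_le[OF sol \<tau>0 \<tau>'(2)])
      have sp: "AE z in lebesgue_on (slab T). z \<in> half_space_region \<nu> c \<tau> \<tau>' \<longrightarrow>
          norm (rel_flux \<gamma> (\<rho> z) (u z)) \<le> c * rel_energy \<gamma> (\<rho> z) (u z)"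
        using amp weak_solution_Linf(3)[OF sol]
      proof eventually_elim
        case (elim z)
        show ?case
        proof
          assume "z \<in> half_space_region \<nu> c \<tau> \<tau>'"
          then have a: "\<bar>\<rho> z - 1\<bar> + norm (u z) \<le> \<mu>" using elim by blast
          have "1/2 \<le> \<rho> z" using a \<mu>(3) norm_ge_zero[of "u z"] by linarith
          then have "inverse (\<rho> z) \<le> 2" using elim(2) by (simp add: inverse_eq_divide divide_simps)
          then have "inverse (\<rho> z) * \<bar>\<rho> z - 1\<bar> \<le> 2 * \<bar>\<rho> z - 1\<bar>" by (intro mult_right_mono) auto
          then have "\<bar>inverse (\<rho> z) * (\<rho> z - 1)\<bar> \<le> 2 * \<bar>\<rho> z - 1\<bar>"
            using elim(2) by (simp add: abs_mult)
          then have "\<bar>inverse (\<rho> z) * (\<rho> z - 1)\<bar> + norm (u z) \<le> 2 * \<bar>\<rho> z - 1\<bar> + 2 * norm (u z)"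
            by (rule add_mono) simp
          also have "\<dots> \<le> 2 * \<mu>" using a by simp
          finally have "\<bar>inverse (\<rho> z) * (\<rho> z - 1)\<bar> + norm (u z) \<le> 2 * \<mu>" .
          from C(2)[OF elim(2) this]
          have "norm (rel_flux \<gamma> (\<rho> z) (u z)) \<le> (1 + C * (2 * \<mu>)) * rel_energy \<gamma> (\<rho> z) (u z)" .
          also have "\<dots> \<le> c * rel_energy \<gamma> (\<rho> z) (u z)"
            using \<mu>(4) rel_energy_nonneg[OF \<gamma> elim(2)] by (intro mult_right_mono) auto
          finally show "norm (rel_flux \<gamma> (\<rho> z) (u z)) \<le> c * rel_energy \<gamma> (\<rho> z) (u z)" .
        qed
      qed
      have "(t, y) \<notin> E" if t: "\<tau> < t" "t < \<tau>'" "1 + \<tau> + d * (t - \<tau>) \<le> \<nu> \<bullet> y" for t y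
      proof (rule cone[where c = c and p = y and r = "\<nu> \<bullet> y - 1 - \<tau>" and T' = \<tau>'])
        have dist: "\<nu> \<bullet> y - norm (v - y) \<le> \<nu> \<bullet> v" for v
          using norm_cauchy_schwarz[of \<nu> "y - v"] \<nu> by (simp add: inner_diff_right norm_minus_commute)
        have "c * (t - \<tau>) < d * (t - \<tau>)" using c t by (intro mult_strict_right_mono) auto
        then have "c * (t - \<tau>) < \<nu> \<bullet> y - 1 - \<tau>" using t(3) by linarith
        then show "norm (snd (t, y) - y) + c * max 0 (fst (t, y) - \<tau>) < \<nu> \<bullet> y - 1 - \<tau>" using t by simp
        show "1 + \<tau> < norm v" if "norm (v - y) < \<nu> \<bullet> y - 1 - \<tau>" for v
        proof -
          have "\<nu> \<bullet> v \<le> norm v" using norm_cauchy_schwarz[of \<nu> v] \<nu> by simp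
          then show ?thesis using dist[of v] that by linarith
        qed
        show "AE z in lebesgue_on (slab T). \<tau> < fst z \<and> fst z < \<tau>' \<and> norm (snd z - y) + c * (fst z - \<tau>) < \<nu> \<bullet> y - 1 - \<tau> \<longrightarrow>
            norm (rel_flux \<gamma> (\<rho> z) (u z)) \<le> c * rel_energy \<gamma> (\<rho> z) (u z)"
          using sp
        proof eventually_elim
          case (elim z)
          show ?case
          proof
            assume z: "\<tau> < fst z \<and> fst z < \<tau>' \<and> norm (snd z - y) + c * (fst z - \<tau>) < \<nu> \<bullet> y - 1 - \<tau>"
            then have "1 + \<tau> + c * (fst z - \<tau>) \<le> \<nu> \<bullet> snd z" using dist[of "snd z"] by linarith
            then have "z \<in> half_space_region \<nu> c \<tau> \<tau>'" using z by (cases z) (simp add: half_space_region_def)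
            then show "norm (rel_flux \<gamma> (\<rho> z) (u z)) \<le> c * rel_energy \<gamma> (\<rho> z) (u z)" using elim by blast
          qed
        qed
      qed (use t c \<tau>' in auto)
      then show "half_space_region \<nu> d \<tau> \<tau>' \<inter> perturbation_supp (slab T) \<rho> u = {}"
        by (auto simp: half_space_region_def E_def)
    qed
    define Z where "Z = {c. 1 \<le> c \<and> g c = 0}"
    define c1 where "c1 = Inf Z"
    have Zne: "Z \<noteq> {}" using g0[of "c0 + 1"] c0 by (auto simp: Z_def intro!: exI[of _ "c0 + 1"])
    have Zbdd: "bdd_below Z" by (rule bdd_belowI[of _ 1]) (simp add: Z_def)
    have "c2 \<le> c1" unfolding c1_def
    proof (rule cInf_greatest[OF Zne])
      fix c assume "c \<in> Z"
      then have gc: "g c = 0" by (simp add: Z_def)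
      show "c2 \<le> c"
      proof (rule ccontr)
        assume "\<not> c2 \<le> c"
        then have "g c2 \<le> g c" by (intro antimonoD[OF anti]) simp
        then show False using gc c2 by simp
      qed
    qed
    then have c1: "1 < c1" using c2 by simp
    have c1c0: "c1 \<le> c0"
    proof (rule dense_ge)
      fix c assume "c0 < c"
      then have "c \<in> Z" using g0 c0 by (simp add: Z_def)
      then show "c1 \<le> c" unfolding c1_def using Zbdd by (rule cInf_lower)
    qed
    have right: "g c = 0" if "c1 < c" for c
    proof -
      obtain d where d: "d \<in> Z" "d < c" using \<open>c1 < c\<close> Zne Zbdd unfolding c1_def by (auto simp: cInf_less_iff)
      then have "g c \<le> g d" by (intro antimonoD[OF anti]) simp
      then show ?thesis using d by (simp add: Z_def)
    qed
    have left: "g c \<noteq> 0" if "1 \<le> c" "c < c1" for c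
    proof
      assume "g c = 0"
      then have "c \<in> Z" using that by (simp add: Z_def)
      then have "c1 \<le> c" unfolding c1_def using Zbdd by (rule cInf_lower)
      then show False using that by simp
    qed
    define gl where "gl = (INF c\<in>{..<c1}. g c)"
    have lim: "(g \<longlongrightarrow> gl) (at_left c1)"
      unfolding gl_def
    proof (rule order_tendstoI)
      fix a assume "a < (INF c\<in>{..<c1}. g c)"
      then have "a < g c" if "c < c1" for c using that by (auto intro: order_less_le_trans INF_lower)
      then show "eventually (\<lambda>c. a < g c) (at_left c1)"
        by (auto simp: eventually_at_filter)
    next
      fix a assume "(INF c\<in>{..<c1}. g c) < a"
      then obtain c where c: "c < c1" "g c < a" by (auto simp: INF_less_iff)
      have "eventually (\<lambda>d. d \<in> {c<..<c1}) (at_left c1)" using c by (intro eventually_at_leftI) auto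
      then show "eventually (\<lambda>d. g d < a) (at_left c1)"
      proof eventually_elim
        case (elim d)
        then have "g d \<le> g c" by (intro antimonoD[OF anti]) simp
        then show ?case using c(2) by (rule order_le_less_trans)
      qed
    qed
    have gl_fin: "gl < \<infinity>"
    proof -
      have "gl \<le> g (c1 - 1)" unfolding gl_def by (rule INF_lower) simp
      then show ?thesis using fin by (rule order_le_less_trans)
    qed
    have gl_pos: "0 < gl"
    proof (rule ccontr)
      assume "\<not> 0 < gl"
      then have gl0: "gl = 0" by simp
      define c where "c = (1 + c1) / 2"
      have c: "1 < c" "c < c1" using c1 by (auto simp: c_def)
      \<comment> \<open>since \<open>\<bar>1 - 1 / \<rho>\<bar> \<le> 2 \<bar>\<rho> - 1\<bar>\<close> for \<open>\<rho> \<ge> 1/2\<close>, amplitude \<open>\<mu>\<close> gives speed at most \<open>1 + 2 C \<mu> \<le> c\<close>\<close>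
      define \<mu> where "\<mu> = min (1/2) ((c - 1) / (2 * C))"
      have \<mu>: "0 < \<mu>" "\<mu> \<le> 1/2" using c C by (auto simp: \<mu>_def)
      have "C * (2 * \<mu>) \<le> C * (2 * ((c - 1) / (2 * C)))" using C by (intro mult_left_mono) (auto simp: \<mu>_def)
      then have \<mu>c: "1 + C * (2 * \<mu>) \<le> c" using C by simp
      have "gl < ennreal \<mu>" using gl0 \<mu> by simp
      then obtain e where e: "e < c1" "g e < ennreal \<mu>" unfolding gl_def by (auto simp: INF_less_iff)
      define e' where "e' = max c e"
      have e': "1 < e'" "e' < c1" "c \<le> e'" using c e by (auto simp: e'_def)
      obtain d where d: "e' < d" "d < c1" using dense[OF e'(2)] by blast
      have "g e' \<le> g e" by (intro antimonoD[OF anti]) (simp add: e'_def)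
      then have "g e' \<le> ennreal \<mu>" using e by simp
      then have "g d = 0" by (rule quiet[OF e'(1) d(1)]) (use \<mu> \<mu>c e' in auto)
      then show False using left[of d] d e' by simp
    qed
    have limr: "(g \<longlongrightarrow> 0) (at_right c1)"
    proof (rule tendsto_eventually)
      show "eventually (\<lambda>c. g c = 0) (at_right c1)"
        using right by (auto simp: eventually_at_filter)
    qed
    have "antimono_on {1..} g" using anti by (rule monotone_on_subset) simp
    note this[unfolded g_def]
    moreover have "\<exists>g_left. (front_profile \<rho> u \<nu> \<tau> \<tau>' \<longlongrightarrow> g_left) (at_left c1) \<and>
                  0 < g_left \<and> g_left < \<infinity> \<and>
                  (front_profile \<rho> u \<nu> \<tau> \<tau>' \<longlongrightarrow> 0) (at_right c1)"
      by (rule exI[of _ gl]) (intro conjI lim[unfolded g_def] limr[unfolded g_def] gl_pos gl_fin)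
    ultimately have "norm \<nu> = 1 \<and> 1 < c1 \<and> c1 \<le> c0 \<and>
               antimono_on {1..} (front_profile \<rho> u \<nu> \<tau> \<tau>') \<and>
               (\<exists>g_left. (front_profile \<rho> u \<nu> \<tau> \<tau>' \<longlongrightarrow> g_left) (at_left c1) \<and>
                  0 < g_left \<and> g_left < \<infinity> \<and>
                  (front_profile \<rho> u \<nu> \<tau> \<tau>' \<longlongrightarrow> 0) (at_right c1))"
      using \<nu>(1) c1 c1c0 by (intro conjI)
    then show "\<exists>\<nu> c1. norm \<nu> = 1 \<and> 1 < c1 \<and> c1 \<le> c0 \<and>
               antimono_on {1..} (front_profile \<rho> u \<nu> \<tau> \<tau>') \<and>
               (\<exists>g_left. (front_profile \<rho> u \<nu> \<tau> \<tau>' \<longlongrightarrow> g_left) (at_left c1) \<and>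
                  0 < g_left \<and> g_left < \<infinity> \<and>
                  (front_profile \<rho> u \<nu> \<tau> \<tau>' \<longlongrightarrow> 0) (at_right c1))"
      by (intro exI)
  }
qed

theorem theorem3:
  fixes \<gamma> :: real
  assumes "\<gamma> > 1"
  shows "\<exists>\<Gamma>>0. \<exists>C>0. lifespan_property \<gamma> \<Gamma> \<and> propagation_property \<gamma> C \<and>
    (\<forall>(T::real) (\<rho> :: real \<times> (real^3) \<Rightarrow> real) (u :: real \<times> (real^3) \<Rightarrow> real^3)
       (\<rho>0 :: real^3 \<Rightarrow> real) (u0 :: real^3 \<Rightarrow> real^3) (m::real) (\<omega> :: real^3) (k0::real).
      0 < T \<and> entropy_admissible \<gamma> T \<rho> u \<rho>0 u0 \<and>
      Linf_norm (slab T) (\<lambda>z. inverse (\<rho> z)) < \<infinity> \<and>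
      0 < m \<and>
      Linf_norm (slab T) (\<lambda>z. inverse (\<rho> z) * (\<rho> z - 1)) + Linf_norm (slab T) u \<le> ennreal m \<and>
      ess_supp UNIV (\<lambda>x. (\<rho>0 x - 1, u0 x)) \<subseteq> {x. norm x \<le> 1} \<and>
      norm \<omega> = 1 \<and> 0 \<le> k0 \<and> k0 < 1 \<and>
      positive_decreasing (w0 \<omega> \<rho>0 u0) k0 \<and>
      T > T0 \<gamma> \<Gamma> (w0 \<omega> \<rho>0 u0) k0
      \<longrightarrow>
      (let c0 = 1 + C * m;
           \<tau> = Inf (escape_times T \<rho> u);
           E = ess_supp (slab T) (\<lambda>z. (\<rho> z - 1, u z))
       in
         escape_times T \<rho> u \<noteq> {} \<and>
         0 \<le> \<tau> \<and> \<tau> \<le> T0 \<gamma> \<Gamma> (w0 \<omega> \<rho>0 u0) k0 \<and>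
         E \<inter> slab \<tau> \<subseteq> {(t, x). (t, x) \<in> slab \<tau> \<and> norm x \<le> 1 + t} \<and>
         (\<forall>\<tau>'. \<tau> < \<tau>' \<and> \<tau>' < T \<longrightarrow>
            E \<inter> ({\<tau><..<\<tau>'} \<times> UNIV)
              \<subseteq> {(t, x). \<tau> < t \<and> t < \<tau>' \<and> norm x \<le> 1 + \<tau> + c0 * (t - \<tau>)} \<and>
            E \<inter> {(t, x). \<tau> < t \<and> t < \<tau>' \<and> 1 + t < norm x \<and> norm x \<le> 1 + \<tau> + c0 * (t - \<tau>)}
              \<noteq> {}) \<and>
         (\<forall>\<tau>'. \<tau> < \<tau>' \<and> \<tau>' < T \<longrightarrow>
            (\<exists>\<nu> c1. norm \<nu> = 1 \<and> 1 < c1 \<and> c1 \<le> c0 \<and>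
               antimono_on {1..} (front_profile \<rho> u \<nu> \<tau> \<tau>') \<and>
               (\<exists>g_left. (front_profile \<rho> u \<nu> \<tau> \<tau>' \<longlongrightarrow> g_left) (at_left c1) \<and>
                  0 < g_left \<and> g_left < \<infinity> \<and>
                  (front_profile \<rho> u \<nu> \<tau> \<tau>' \<longlongrightarrow> 0) (at_right c1))))))"
proof -
  obtain C where C: "C > 0" "\<And>m r v. r > 0 \<Longrightarrow> \<bar>inverse r * (r - 1)\<bar> + norm v \<le> m \<Longrightarrow>
       norm (rel_flux \<gamma> r v) \<le> (1 + C * m) * rel_energy \<gamma> r v"
    using rel_flux_le_rel_energy[OF assms] by blast
  obtain \<Gamma> where \<Gamma>: "0 < \<Gamma>"
    and lifespan: "\<And>T T1 \<rho> u \<rho>0 u0 \<omega> k0. weak_solution \<gamma> T \<rho> u \<rho>0 u0 \<Longrightarrow> 0 < T1 \<Longrightarrow> T1 \<le> T \<Longrightarrow> norm \<omega> = 1 \<Longrightarrow>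
       0 \<le> k0 \<Longrightarrow> k0 < 1 \<Longrightarrow>
       perturbation_supp (slab T) \<rho> u \<inter> Omega_slab_inf \<omega> k0 T1 \<subseteq> Omega_slab \<omega> k0 1 T1 \<Longrightarrow>
       positive_decreasing (w0 \<omega> \<rho>0 u0) k0 \<Longrightarrow> T1 \<le> T0 \<gamma> \<Gamma> (w0 \<omega> \<rho>0 u0) k0"
    using lifespan_bound[OF assms] by blast
  show ?thesis
  proof (rule exI[of _ \<Gamma>], rule conjI[OF \<Gamma>], rule exI[of _ C], rule conjI[OF C(1)],
      intro conjI allI impI)
    show "lifespan_property \<gamma> \<Gamma>"
      unfolding lifespan_property_def using lifespan by blast
    show "propagation_property \<gamma> C"
      by (rule propagation_property_of_flux_bound[OF assms C])
  next
    fix T :: real and \<rho> u \<rho>0 u0 and m :: real and \<omega> :: "real^3" and k0 :: real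
    assume *: "0 < T \<and> entropy_admissible \<gamma> T \<rho> u \<rho>0 u0 \<and>
      Linf_norm (slab T) (\<lambda>z. inverse (\<rho> z)) < \<infinity> \<and>
      0 < m \<and>
      Linf_norm (slab T) (\<lambda>z. inverse (\<rho> z) * (\<rho> z - 1)) + Linf_norm (slab T) u \<le> ennreal m \<and>
      ess_supp UNIV (\<lambda>x. (\<rho>0 x - 1, u0 x)) \<subseteq> {x. norm x \<le> 1} \<and>
      norm \<omega> = 1 \<and> 0 \<le> k0 \<and> k0 < 1 \<and>
      positive_decreasing (w0 \<omega> \<rho>0 u0) k0 \<and>
      T > T0 \<gamma> \<Gamma> (w0 \<omega> \<rho>0 u0) k0"
    then have k0: "0 \<le> k0" "k0 < 1" and pd: "positive_decreasing (w0 \<omega> \<rho>0 u0) k0" by blast+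
    have sol: "weak_solution \<gamma> T \<rho> u \<rho>0 u0" using * by (simp add: entropy_admissible_def)
    let ?B = "T0 \<gamma> \<Gamma> (w0 \<omega> \<rho>0 u0) k0"
    have "1 - (1 + k0) / 2 \<le> ?B"
    proof (rule T0_lower_bound[OF \<Gamma> k0 pd])
      fix k assume "k0 < k" "k < 1"
      then show "1 \<le> exp (\<Gamma> * ((1 - k0) ^ 6 / ((k - k0) * w0 \<omega> \<rho>0 u0 k)))"
        using pd \<Gamma> k0 by (simp add: positive_decreasing_def less_imp_le)
    qed
    moreover have "0 < 1 - (1 + k0) / 2" using k0 by simp
    ultimately have "0 < ?B" by (rule order_less_le_trans[rotated])
    moreover have "?B < T" using * by blast
    ultimately have B: "0 < ?B" "?B < T" .
    have life: "T1 \<le> ?B" if "0 < T1" "T1 \<le> T"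
      "perturbation_supp (slab T) \<rho> u \<inter> Omega_slab_inf \<omega> k0 T1 \<subseteq> Omega_slab \<omega> k0 1 T1" for T1
      using lifespan[OF sol that(1,2) _ k0 that(3) pd] * by blast
    have adm: "entropy_admissible \<gamma> T \<rho> u \<rho>0 u0" and m: "0 < m"
      "Linf_norm (slab T) (\<lambda>z. inverse (\<rho> z) * (\<rho> z - 1)) + Linf_norm (slab T) u \<le> ennreal m"
      and init: "ess_supp UNIV (\<lambda>x. (\<rho>0 x - 1, u0 x)) \<subseteq> {x. norm x \<le> 1}"
      using * by blast+
    note concl = escape_and_front_jump[OF assms C life B adm m init, unfolded perturbation_supp_def]
    show "let c0 = 1 + C * m;
           \<tau> = Inf (escape_times T \<rho> u);
           E = ess_supp (slab T) (\<lambda>z. (\<rho> z - 1, u z))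
       in
         escape_times T \<rho> u \<noteq> {} \<and>
         0 \<le> \<tau> \<and> \<tau> \<le> T0 \<gamma> \<Gamma> (w0 \<omega> \<rho>0 u0) k0 \<and>
         E \<inter> slab \<tau> \<subseteq> {(t, x). (t, x) \<in> slab \<tau> \<and> norm x \<le> 1 + t} \<and>
         (\<forall>\<tau>'. \<tau> < \<tau>' \<and> \<tau>' < T \<longrightarrow>
            E \<inter> ({\<tau><..<\<tau>'} \<times> UNIV)
              \<subseteq> {(t, x). \<tau> < t \<and> t < \<tau>' \<and> norm x \<le> 1 + \<tau> + c0 * (t - \<tau>)} \<and>
            E \<inter> {(t, x). \<tau> < t \<and> t < \<tau>' \<and> 1 + t < norm x \<and> norm x \<le> 1 + \<tau> + c0 * (t - \<tau>)}
              \<noteq> {}) \<and>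
         (\<forall>\<tau>'. \<tau> < \<tau>' \<and> \<tau>' < T \<longrightarrow>
            (\<exists>\<nu> c1. norm \<nu> = 1 \<and> 1 < c1 \<and> c1 \<le> c0 \<and>
               antimono_on {1..} (front_profile \<rho> u \<nu> \<tau> \<tau>') \<and>
               (\<exists>g_left. (front_profile \<rho> u \<nu> \<tau> \<tau>' \<longlongrightarrow> g_left) (at_left c1) \<and>
                  0 < g_left \<and> g_left < \<infinity> \<and>
                  (front_profile \<rho> u \<nu> \<tau> \<tau>' \<longlongrightarrow> 0) (at_right c1))))"
      unfolding Let_def
      by (intro conjI allI impI; (elim conjE)?; rule concl; assumption)
  qed
qed

end
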